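(* Let $(M,g)$ be a compact orientable Riemannian manifold without boundary, and let $(N,h)$ be a Riemannian manifold admitting a conformal vector field $\xi$ with potential function $f$ satisfying $f>0$ at every point of $N$. Then any harmonic map $\varphi:(M,g)\to(N,h)$ is constant.
   Context: Manifolds are smooth and connected; maps, vector fields and functions are smooth. A vector field $\xi$ on a Riemannian manifold $(N,h)$ is conformal with potential function $f\in C^\infty(N)$ if $\mathcal{L}_\xi h=2fh$, i.e. $h(\nabla_X\xi,Y)+h(\nabla_Y\xi,X)=2f\,h(X,Y)$ for all vector fields $X,Y$, where $\nabla$ is the Levi-Civita connection of $h$. For a smooth map $\varphi:(M,g)\to(N,h)$, the tension field is $\tau(\varphi)=\operatorname{trace}_g\nabla d\varphi=\sum_i\big(\nabla^{\varphi}_{e_i}d\varphi(e_i)-d\varphi(\nabla^{M}_{e_i}e_i)\big)$, where $\{e_i\}$ is a local orthonormal frame of $(M,g)$, $\nabla^M$ is the Levi-Civita connection of $g$ and $\nabla^\varphi$ is the pull-back connection on $\varphi^{-1}TN$. The map $\varphi$ is harmonic if $\tau(\varphi)=0$. *)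

theory Defs
  imports "HOL-Analysis.Analysis"
begin

section \<open>Smooth functions on open subsets of normed spaces\<close>

text \<open>Only used for open \<open>S\<close>: being \<open>C\<^sup>k\<^sup>+\<^sup>1\<close> means being differentiable with all directional
  derivatives \<open>C\<^sup>k\<close>.\<close>

fun Ck_on :: "nat \<Rightarrow> 'a::euclidean_space set \<Rightarrow> ('a \<Rightarrow> 'b::real_normed_vector) \<Rightarrow> bool" where
  "Ck_on 0 S f \<longleftrightarrow> continuous_on S f"
| "Ck_on (Suc k) S f \<longleftrightarrow>
     (\<forall>x\<in>S. f differentiable (at x)) \<and>
     (\<forall>v. Ck_on k S (\<lambda>x. frechet_derivative f (at x) v))"

definition smooth_on :: "'a::euclidean_space set \<Rightarrow> ('a \<Rightarrow> 'b::real_normed_vector) \<Rightarrow> bool" where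
  "smooth_on S f \<longleftrightarrow> (\<forall>k. Ck_on k S f)"


section \<open>Smooth manifolds\<close>

text \<open>A chart is a pair of its domain and its coordinate map; the latter is only meaningful on the
  domain.  The atlas of a manifold need not be maximal.\<close>

type_synonym ('m, 'n) chart = "'m set \<times> ('m \<Rightarrow> real ^ 'n)"

abbreviation chart_dom :: "('m, 'n) chart \<Rightarrow> 'm set" where
  "chart_dom c \<equiv> fst c"

abbreviation chart_map :: "('m, 'n) chart \<Rightarrow> 'm \<Rightarrow> real ^ 'n" where
  "chart_map c \<equiv> snd c"

definition chart_inv :: "('m, 'n) chart \<Rightarrow> real ^ 'n \<Rightarrow> 'm" where
  "chart_inv c = inv_into (chart_dom c) (chart_map c)"

definition is_chart :: "'m topology \<Rightarrow> ('m, 'n::finite) chart \<Rightarrow> bool" where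
  "is_chart T c \<longleftrightarrow>
     openin T (chart_dom c) \<and>
     open (chart_map c ` chart_dom c) \<and>
     homeomorphic_map (subtopology T (chart_dom c)) (top_of_set (chart_map c ` chart_dom c))
       (chart_map c)"

definition smooth_transition :: "('m, 'n::finite) chart \<Rightarrow> ('m, 'n) chart \<Rightarrow> bool" where
  "smooth_transition c d \<longleftrightarrow>
     smooth_on (chart_map c ` (chart_dom c \<inter> chart_dom d)) (chart_map d \<circ> chart_inv c)"

record ('m, 'n) manifold =
  mtop :: "'m topology"
  atlas :: "('m, 'n) chart set"

abbreviation points :: "('m, 'n) manifold \<Rightarrow> 'm set" where
  "points M \<equiv> topspace (mtop M)"

definition smooth_manifold :: "('m, 'n::finite) manifold \<Rightarrow> bool" where
  "smooth_manifold M \<longleftrightarrow>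
     points M \<noteq> {} \<and> Hausdorff_space (mtop M) \<and> second_countable (mtop M) \<and>
     connected_space (mtop M) \<and>
     (\<forall>c\<in>atlas M. is_chart (mtop M) c) \<and>
     (\<Union>c\<in>atlas M. chart_dom c) = points M \<and>
     (\<forall>c\<in>atlas M. \<forall>d\<in>atlas M. smooth_transition c d)"

definition orientable :: "('m, 'n::finite) manifold \<Rightarrow> bool" where
  "orientable M \<longleftrightarrow>
     (\<exists>A. (\<forall>c\<in>A. is_chart (mtop M) c) \<and>
          (\<Union>c\<in>A. chart_dom c) = points M \<and>
          (\<forall>c\<in>A. \<forall>d\<in>atlas M. smooth_transition c d \<and> smooth_transition d c) \<and>
          (\<forall>c\<in>A. \<forall>d\<in>A. \<forall>p\<in>chart_dom c \<inter> chart_dom d.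
             det (matrix (frechet_derivative (chart_map d \<circ> chart_inv c) (at (chart_map c p)))) > 0))"

definition smooth_fun ::
  "('m, 'n::finite) manifold \<Rightarrow> 'm set \<Rightarrow> ('m \<Rightarrow> 'b::real_normed_vector) \<Rightarrow> bool" where
  "smooth_fun M U f \<longleftrightarrow>
     openin (mtop M) U \<and>
     (\<forall>c\<in>atlas M. smooth_on (chart_map c ` (chart_dom c \<inter> U)) (f \<circ> chart_inv c))"

definition smooth_map ::
  "('m, 'n::finite) manifold \<Rightarrow> ('q, 'k::finite) manifold \<Rightarrow> ('m \<Rightarrow> 'q) \<Rightarrow> bool" where
  "smooth_map M N \<phi> \<longleftrightarrow>
     continuous_map (mtop M) (mtop N) \<phi> \<and>
     (\<forall>d\<in>atlas N. smooth_fun M {p \<in> points M. \<phi> p \<in> chart_dom d} (chart_map d \<circ> \<phi>))"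


section \<open>Tangent vectors and vector fields\<close>

text \<open>At every point \<open>p\<close> a chart \<open>chart_at M p\<close> of the atlas around \<open>p\<close> is chosen, and the tangent
  space at \<open>p\<close> is identified with \<open>real ^ 'n\<close> through this chart.  The choice varies arbitrarily with
  \<open>p\<close>, so smoothness of a vector field is \<^emph>\<open>not\<close> smoothness of the resulting function into
  \<open>real ^ 'n\<close>.  \<open>dir_deriv M p v F\<close> is the derivative \<open>v(F)\<close> of \<open>F\<close> at \<open>p\<close> in the direction of the
  tangent vector \<open>v\<close>.\<close>

definition chart_at :: "('m, 'n) manifold \<Rightarrow> 'm \<Rightarrow> ('m, 'n) chart" where
  "chart_at M p = (SOME c. c \<in> atlas M \<and> p \<in> chart_dom c)"

definition dir_deriv ::
  "('m, 'n::finite) manifold \<Rightarrow> 'm \<Rightarrow> real ^ 'n \<Rightarrow> ('m \<Rightarrow> 'b::real_normed_vector) \<Rightarrow> 'b" where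
  "dir_deriv M p v F =
     frechet_derivative (F \<circ> chart_inv (chart_at M p)) (at (chart_map (chart_at M p) p)) v"

definition differential ::
  "('m, 'n::finite) manifold \<Rightarrow> ('q, 'k::finite) manifold \<Rightarrow> ('m \<Rightarrow> 'q) \<Rightarrow> 'm \<Rightarrow> real ^ 'n \<Rightarrow> real ^ 'k"
  where
  "differential M N \<phi> p v = dir_deriv M p v (chart_map (chart_at N (\<phi> p)) \<circ> \<phi>)"

text \<open>A section over \<open>U\<close> of the pull-back bundle \<open>\<phi>\<^sup>-\<^sup>1TN\<close>: \<open>V p\<close> is a tangent vector of \<open>N\<close> at
  \<open>\<phi> p\<close>.  The components of a tangent vector \<open>w\<close> in an arbitrary chart \<open>d\<close> are the derivatives
  \<open>w(chart_map d)\<close> of the coordinate functions; it is these that have to be smooth.\<close>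

definition smooth_section ::
  "('m, 'n::finite) manifold \<Rightarrow> ('q, 'k::finite) manifold \<Rightarrow> ('m \<Rightarrow> 'q) \<Rightarrow>
   'm set \<Rightarrow> ('m \<Rightarrow> real ^ 'k) \<Rightarrow> bool" where
  "smooth_section M N \<phi> U V \<longleftrightarrow>
     openin (mtop M) U \<and>
     (\<forall>d\<in>atlas N. smooth_fun M {p \<in> U. \<phi> p \<in> chart_dom d}
        (\<lambda>p. dir_deriv N (\<phi> p) (V p) (chart_map d)))"

text \<open>The tangent bundle is the pull-back of itself under the identity.\<close>

abbreviation smooth_vector_field ::
  "('m, 'n::finite) manifold \<Rightarrow> 'm set \<Rightarrow> ('m \<Rightarrow> real ^ 'n) \<Rightarrow> bool" where
  "smooth_vector_field M \<equiv> smooth_section M M id"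


section \<open>Riemannian metrics and connections\<close>

type_synonym ('m, 'n) metric = "'m \<Rightarrow> real ^ 'n \<Rightarrow> real ^ 'n \<Rightarrow> real"

definition riemannian_metric :: "('m, 'n::finite) manifold \<Rightarrow> ('m, 'n) metric \<Rightarrow> bool" where
  "riemannian_metric M g \<longleftrightarrow>
     (\<forall>p\<in>points M. bilinear (g p) \<and> (\<forall>u v. g p u v = g p v u) \<and> (\<forall>u. u \<noteq> 0 \<longrightarrow> g p u u > 0)) \<and>
     (\<forall>U X Y. smooth_vector_field M U X \<and> smooth_vector_field M U Y \<longrightarrow>
        smooth_fun M U (\<lambda>p. g p (X p) (Y p)))"

definition riemannian_manifold :: "('m, 'n::finite) manifold \<Rightarrow> ('m, 'n) metric \<Rightarrow> bool" where
  "riemannian_manifold M g \<longleftrightarrow> smooth_manifold M \<and> riemannian_metric M g"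

text \<open>Linear connections on \<open>\<phi>\<^sup>-\<^sup>1TN\<close>: \<open>D p v V\<close> is the covariant derivative at \<open>p\<close> of the section
  \<open>V\<close> in the direction of the tangent vector \<open>v\<close> of \<open>M\<close> at \<open>p\<close>.  Since a section over \<open>U\<close> is
  represented by a total function, \<open>D\<close> must not depend on its values off \<open>U\<close>.\<close>

definition is_connection ::
  "('m, 'n::finite) manifold \<Rightarrow> ('q, 'k::finite) manifold \<Rightarrow> ('m \<Rightarrow> 'q) \<Rightarrow>
   ('m \<Rightarrow> real ^ 'n \<Rightarrow> ('m \<Rightarrow> real ^ 'k) \<Rightarrow> real ^ 'k) \<Rightarrow> bool" where
  "is_connection M N \<phi> D \<longleftrightarrow>
     (\<forall>U V. smooth_section M N \<phi> U V \<longrightarrow>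
       (\<forall>p\<in>U. linear (\<lambda>v. D p v V)) \<and>
       (\<forall>W. (\<forall>q\<in>U. W q = V q) \<longrightarrow> (\<forall>p\<in>U. \<forall>v. D p v W = D p v V)) \<and>
       (\<forall>W. smooth_section M N \<phi> U W \<longrightarrow>
          (\<forall>p\<in>U. \<forall>v. D p v (\<lambda>q. V q + W q) = D p v V + D p v W)) \<and>
       (\<forall>f::'m \<Rightarrow> real. smooth_fun M U f \<longrightarrow>
          (\<forall>p\<in>U. \<forall>v. D p v (\<lambda>q. f q *\<^sub>R V q) = dir_deriv M p v f *\<^sub>R V p + f p *\<^sub>R D p v V)) \<and>
       (\<forall>X. smooth_vector_field M U X \<longrightarrow> smooth_section M N \<phi> U (\<lambda>p. D p (X p) V)))"

text \<open>Metric and torsion-free; the latter is \<open>\<nabla>\<^sub>X Y - \<nabla>\<^sub>Y X = [X, Y]\<close>, where the bracket acts on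
  functions by \<open>[X, Y] f = X (Y f) - Y (X f)\<close>.\<close>

definition levi_civita ::
  "('m, 'n::finite) manifold \<Rightarrow> ('m, 'n) metric \<Rightarrow>
   ('m \<Rightarrow> real ^ 'n \<Rightarrow> ('m \<Rightarrow> real ^ 'n) \<Rightarrow> real ^ 'n) \<Rightarrow> bool" where
  "levi_civita M g D \<longleftrightarrow>
     is_connection M M id D \<and>
     (\<forall>U X Y. smooth_vector_field M U X \<and> smooth_vector_field M U Y \<longrightarrow>
       (\<forall>p\<in>U. \<forall>v. dir_deriv M p v (\<lambda>q. g q (X q) (Y q)) = g p (D p v X) (Y p) + g p (X p) (D p v Y)) \<and>
       (\<forall>f::'m \<Rightarrow> real. smooth_fun M U f \<longrightarrow>
         (\<forall>p\<in>U. dir_deriv M p (D p (X p) Y - D p (Y p) X) f =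
            dir_deriv M p (X p) (\<lambda>q. dir_deriv M q (Y q) f) -
            dir_deriv M p (Y p) (\<lambda>q. dir_deriv M q (X q) f))))"

text \<open>The pull-back of a connection \<open>DN\<close> on \<open>N\<close> is the unique connection on \<open>\<phi>\<^sup>-\<^sup>1TN\<close> with
  \<open>\<nabla>\<^sup>\<phi>\<^sub>v (Y \<circ> \<phi>) = \<nabla>\<^sup>N\<^bsub>d\<phi>(v)\<^esub> Y\<close> for local vector fields \<open>Y\<close> on \<open>N\<close>.\<close>

definition pullback_connection ::
  "('m, 'n::finite) manifold \<Rightarrow> ('q, 'k::finite) manifold \<Rightarrow> ('m \<Rightarrow> 'q) \<Rightarrow>
   ('q \<Rightarrow> real ^ 'k \<Rightarrow> ('q \<Rightarrow> real ^ 'k) \<Rightarrow> real ^ 'k) \<Rightarrow>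
   ('m \<Rightarrow> real ^ 'n \<Rightarrow> ('m \<Rightarrow> real ^ 'k) \<Rightarrow> real ^ 'k) \<Rightarrow> bool" where
  "pullback_connection M N \<phi> DN D\<phi> \<longleftrightarrow>
     is_connection M N \<phi> D\<phi> \<and>
     (\<forall>W Y. smooth_vector_field N W Y \<longrightarrow>
       (\<forall>p\<in>points M. \<phi> p \<in> W \<longrightarrow>
         (\<forall>v. D\<phi> p v (Y \<circ> \<phi>) = DN (\<phi> p) (differential M N \<phi> p v) Y)))"


section \<open>Conformal vector fields and harmonic maps\<close>

definition conformal_field ::
  "('q, 'k::finite) manifold \<Rightarrow> ('q, 'k) metric \<Rightarrow>
   ('q \<Rightarrow> real ^ 'k \<Rightarrow> ('q \<Rightarrow> real ^ 'k) \<Rightarrow> real ^ 'k) \<Rightarrow> ('q \<Rightarrow> real ^ 'k) \<Rightarrow> ('q \<Rightarrow> real) \<Rightarrow> bool" where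
  "conformal_field N h DN \<xi> f \<longleftrightarrow>
     smooth_vector_field N (points N) \<xi> \<and> smooth_fun N (points N) f \<and>
     (\<forall>X Y. smooth_vector_field N (points N) X \<and> smooth_vector_field N (points N) Y \<longrightarrow>
       (\<forall>q\<in>points N.
          h q (DN q (X q) \<xi>) (Y q) + h q (DN q (Y q) \<xi>) (X q) = 2 * f q * h q (X q) (Y q)))"

definition orthonormal_frame ::
  "('m, 'n::finite) manifold \<Rightarrow> ('m, 'n) metric \<Rightarrow> 'm set \<Rightarrow> ('n \<Rightarrow> 'm \<Rightarrow> real ^ 'n) \<Rightarrow> bool" where
  "orthonormal_frame M g U e \<longleftrightarrow>
     (\<forall>i. smooth_vector_field M U (e i)) \<and>
     (\<forall>p\<in>U. \<forall>i j. g p (e i p) (e j p) = (if i = j then 1 else 0))"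

text \<open>The value of the tension field at \<open>p\<close>, computed in some local orthonormal frame around \<open>p\<close>;
  it does not depend on the frame.\<close>

definition tension_field ::
  "('m, 'n::finite) manifold \<Rightarrow> ('m, 'n) metric \<Rightarrow> ('q, 'k::finite) manifold \<Rightarrow> ('m \<Rightarrow> 'q) \<Rightarrow>
   ('m \<Rightarrow> real ^ 'n \<Rightarrow> ('m \<Rightarrow> real ^ 'n) \<Rightarrow> real ^ 'n) \<Rightarrow>
   ('m \<Rightarrow> real ^ 'n \<Rightarrow> ('m \<Rightarrow> real ^ 'k) \<Rightarrow> real ^ 'k) \<Rightarrow> 'm \<Rightarrow> real ^ 'k" where
  "tension_field M g N \<phi> DM D\<phi> p =
     (let e = (SOME e. \<exists>U. p \<in> U \<and> orthonormal_frame M g U e) in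
      \<Sum>i\<in>UNIV. D\<phi> p (e i p) (\<lambda>q. differential M N \<phi> q (e i q))
               - differential M N \<phi> p (DM p (e i p) (e i)))"

definition harmonic_map ::
  "('m, 'n::finite) manifold \<Rightarrow> ('m, 'n) metric \<Rightarrow> ('q, 'k::finite) manifold \<Rightarrow> ('m \<Rightarrow> 'q) \<Rightarrow>
   ('m \<Rightarrow> real ^ 'n \<Rightarrow> ('m \<Rightarrow> real ^ 'n) \<Rightarrow> real ^ 'n) \<Rightarrow>
   ('m \<Rightarrow> real ^ 'n \<Rightarrow> ('m \<Rightarrow> real ^ 'k) \<Rightarrow> real ^ 'k) \<Rightarrow> bool" where
  "harmonic_map M g N \<phi> DM D\<phi> \<longleftrightarrow>
     smooth_map M N \<phi> \<and> (\<forall>p\<in>points M. tension_field M g N \<phi> DM D\<phi> p = 0)"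

end

theory Submission
  imports Defs
begin

text \<open>Let \<open>Z\<close> be the vector field on \<open>M\<close> dual to the one-form \<open>v \<mapsto> h (\<xi> \<circ> \<phi>) (d\<phi> v)\<close>.  Since \<open>\<phi>\<close> is
  harmonic and \<open>\<xi>\<close> is conformal, \<open>div Z = (f \<circ> \<phi>) |d\<phi>|\<^sup>2 \<ge> 0\<close>.  On a compact manifold a divergence
  has integral \<open>0\<close>, so \<open>d\<phi> = 0\<close>.

  The integral over \<open>M\<close> is never formed.  In a chart \<open>c\<close> with Riemannian
  density \<open>w\<close> the divergence is \<open>(\<Sum>k. \<partial>\<^sub>k (w Z\<^sup>k)) / w\<close>, hence the chart integral \<open>I\<^sub>c (div Y)\<close>
  vanishes for every field \<open>Y\<close> supported in \<open>c\<close>.  For a partition of unity \<open>\<rho>\<^sub>a\<close> subordinate to charts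
  \<open>a\<close>, the change of variables formula \<open>I\<^sub>a = I\<^sub>b\<close> on overlaps gives
  \<open>(\<Sum>b. I\<^sub>b (\<rho>\<^sub>b div Z)) = (\<Sum>a. \<Sum>b. I\<^sub>a (\<rho>\<^sub>b div (\<rho>\<^sub>a Z))) = (\<Sum>a. I\<^sub>a (div (\<rho>\<^sub>a Z))) = 0\<close>,
  and all terms on the left are nonnegative.\<close>

section \<open>Calculus of smooth functions\<close>

text \<open>For a local orthonormal frame \<open>e i\<close>, differentiating
  \<open>g Z (e i) = h \<xi> (d\<phi> (e i))\<close> along \<open>e i\<close> in two ways gives
  \<open>g (DM (e i) Z) (e i) = h (DN (d\<phi> (e i)) \<xi>) (d\<phi> (e i)) + h \<xi> (D\<phi> (e
  i) (d\<phi> (e i)) - d\<phi> (DM (e i) (e i)))\<close>. Summed over \<open>i\<close>, the last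
  terms form the inner product of \<xi> with the tension field, and conformality with
  \<open>X = Y\<close> turns each first term into \<open>f\<close> times the squared length of
  \<open>d\<phi> (e i)\<close>.

  Two features of the encoding shape the rest. A tangent vector at \<open>p\<close> is a coordinate
  vector in a chart that depends arbitrarily on \<open>p\<close>, so a field cannot be
  differentiated as a function into \<open>real ^ 'n\<close>; every computation passes to components
  in one fixed chart. A connection is known only through its axioms, so even the compatibility of
  the pull-back connection with the metric has to be derived, by expanding sections in pulled-back
  coordinate frames.\<close>

lemma has_derivative_cong_open:
  assumes "open S" "x \<in> S" "\<And>y. y \<in> S \<Longrightarrow> f y = g y"
  shows "(f has_derivative D) (at x) \<longleftrightarrow> (g has_derivative D) (at x)"
  using assms has_derivative_transform_within_open[of f D x UNIV S g]
    has_derivative_transform_within_open[of g D x UNIV S f] by metis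

lemma frechet_derivative_cong_open:
  assumes "open S" "x \<in> S" "\<And>y. y \<in> S \<Longrightarrow> f y = g y"
  shows "frechet_derivative f (at x) = frechet_derivative g (at x)"
  unfolding frechet_derivative_def using has_derivative_cong_open[OF assms] by simp

lemma differentiable_cong_open:
  assumes "open S" "x \<in> S" "\<And>y. y \<in> S \<Longrightarrow> f y = g y"
  shows "f differentiable (at x) \<longleftrightarrow> g differentiable (at x)"
  unfolding differentiable_def using has_derivative_cong_open[OF assms] by simp

lemma Ck_on_cong:
  assumes "open S"
  shows "Ck_on k S f \<Longrightarrow> (\<And>x. x \<in> S \<Longrightarrow> f x = g x) \<Longrightarrow> Ck_on k S g"
proof (induction k arbitrary: f g)
  case 0
  then show ?case by (metis Ck_on.simps(1) continuous_on_cong)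
next
  case (Suc k)
  have eq: "frechet_derivative f (at x) = frechet_derivative g (at x)"
    "f differentiable (at x) \<longleftrightarrow> g differentiable (at x)" if "x \<in> S" for x
    using frechet_derivative_cong_open[of S x f g] differentiable_cong_open[of S x f g] assms that Suc.prems(2)
    by auto
  show ?case
    unfolding Ck_on.simps
  proof (intro conjI ballI allI)
    show "g differentiable at x" if "x \<in> S" for x
      using Suc.prems(1) that eq(2)[OF that] by simp
    show "Ck_on k S (\<lambda>x. frechet_derivative g (at x) v)" for v
    proof (rule Suc.IH)
      show "Ck_on k S (\<lambda>x. frechet_derivative f (at x) v)"
        using Suc.prems(1) by simp
    qed (simp only: eq(1))
  qed
qed

text \<open>\<open>frechet_derivative\<close> is a choice operator; as derivatives are unique, any
  explicitly known derivative may replace it on an open set. Most closure properties below are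
  inductions on \<open>k\<close> through this rule.\<close>

lemma Ck_on_SucI:
  assumes "open S" "\<And>x. x \<in> S \<Longrightarrow> (f has_derivative f' x) (at x)"
    and "\<And>v. Ck_on k S (\<lambda>x. f' x v)"
  shows "Ck_on (Suc k) S f"
proof -
  have "f' x = frechet_derivative f (at x)" if "x \<in> S" for x
    using assms(2)[OF that] frechet_derivative_at by force
  then have "Ck_on k S (\<lambda>x. frechet_derivative f (at x) v)" for v
    by (intro Ck_on_cong[OF assms(1) assms(3)]) simp
  moreover have "f differentiable (at x)" if "x \<in> S" for x
    using assms(2)[OF that] by (auto simp: differentiable_def)
  ultimately show ?thesis by simp
qed

lemma Ck_on_SucD:
  assumes "Ck_on (Suc k) S f"
  shows "x \<in> S \<Longrightarrow> (f has_derivative frechet_derivative f (at x)) (at x)"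
    and "Ck_on k S (\<lambda>x. frechet_derivative f (at x) v)"
  using assms by (auto simp: frechet_derivative_works)

lemma Ck_on_lower: "Ck_on (Suc k) S f \<Longrightarrow> Ck_on k S f"
proof (induction k arbitrary: f)
  case 0
  then show ?case
    using differentiable_at_imp_differentiable_on differentiable_imp_continuous_on
    by fastforce
next
  case (Suc k)
  then show ?case by auto
qed

lemma Ck_on_subset: "Ck_on k S f \<Longrightarrow> S' \<subseteq> S \<Longrightarrow> Ck_on k S' f"
  by (induction k arbitrary: f) (auto intro: continuous_on_subset)

lemma Ck_on_local:
  "(\<And>x. x \<in> S \<Longrightarrow> \<exists>U. open U \<and> x \<in> U \<and> Ck_on k U f) \<Longrightarrow> Ck_on k S f"
proof (induction k arbitrary: f)
  case 0
  have "continuous (at x within S) f" if "x \<in> S" for x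
    using 0[OF that] by (auto simp: continuous_on_eq_continuous_at intro: continuous_at_imp_continuous_at_within)
  then show ?case by (simp add: continuous_on_eq_continuous_within)
next
  case (Suc k)
  then show ?case by (auto; metis)
qed

lemma Ck_on_const: "Ck_on k S (\<lambda>x. c)"
  by (induction k arbitrary: c) auto

lemma Ck_on_bounded_linear: "bounded_linear L \<Longrightarrow> open S \<Longrightarrow> Ck_on k S L"
proof (cases k)
  case (Suc k)
  assume "bounded_linear L" "open S"
  then show ?thesis unfolding Suc
    by (intro Ck_on_SucI[where f'="\<lambda>_. L"] Ck_on_const)
      (auto intro: bounded_linear_imp_has_derivative)
qed (auto intro: linear_continuous_on)

lemma Ck_on_bounded_linear_comp:
  assumes "bounded_linear L" "open S"
  shows "Ck_on k S f \<Longrightarrow> Ck_on k S (\<lambda>x. L (f x))"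
proof (induction k arbitrary: f)
  case 0
  then show ?case using bounded_linear.continuous_on[OF assms(1)] by simp
next
  case (Suc k)
  show ?case
    using Suc.IH[OF Ck_on_SucD(2)[OF Suc.prems]] bounded_linear.has_derivative[OF assms(1) Ck_on_SucD(1)[OF Suc.prems]]
    by (intro Ck_on_SucI[OF assms(2)])
qed

lemma Ck_on_add:
  assumes "open S"
  shows "Ck_on k S f \<Longrightarrow> Ck_on k S g \<Longrightarrow> Ck_on k S (\<lambda>x. f x + g x)"
proof (induction k arbitrary: f g)
  case 0
  then show ?case by (auto intro: continuous_intros)
next
  case (Suc k)
  show ?case
    using Suc.IH[OF Ck_on_SucD(2)[OF Suc.prems(1)] Ck_on_SucD(2)[OF Suc.prems(2)]]
      has_derivative_add[OF Ck_on_SucD(1)[OF Suc.prems(1)] Ck_on_SucD(1)[OF Suc.prems(2)]]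
    by (intro Ck_on_SucI[OF assms])
qed

lemma Ck_on_sum:
  assumes "open S" "\<And>i. i \<in> I \<Longrightarrow> Ck_on k S (f i)"
  shows "Ck_on k S (\<lambda>x. \<Sum>i\<in>I. f i x)"
  using assms(2) by (induction I rule: infinite_finite_induct) (auto intro: Ck_on_const Ck_on_add[OF assms(1)])

lemma Ck_on_scaleR:
  assumes "open S"
  shows "Ck_on k S f \<Longrightarrow> Ck_on k S g \<Longrightarrow> Ck_on k S (\<lambda>x. f x *\<^sub>R g x)"
proof (induction k arbitrary: f g)
  case 0
  then show ?case by (auto intro: continuous_intros)
next
  case (Suc k)
  note f = Ck_on_SucD[OF Suc.prems(1)] and g = Ck_on_SucD[OF Suc.prems(2)]
  show ?case
    using has_derivative_scaleR[OF f(1) g(1)]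
    by (intro Ck_on_SucI[OF assms]) (auto intro!: Ck_on_add assms Suc.IH f g Ck_on_lower[OF Suc.prems(1)] Ck_on_lower[OF Suc.prems(2)])
qed

text \<open>By the chain rule the derivative of \<open>g\<close> is taken in the direction
  \<open>frechet_derivative f (at x) v\<close>, which moves with \<open>x\<close>, whereas
  \<open>Ck_on\<close> speaks of fixed directions only. Expanding the direction over
  \<open>Basis\<close> leaves a sum of products to which the induction hypothesis applies.\<close>

lemma Ck_on_compose:
  fixes f :: "'a::euclidean_space \<Rightarrow> 'b::euclidean_space"
  assumes "open S" "open T" "f ` S \<subseteq> T"
  shows "Ck_on k T g \<Longrightarrow> Ck_on k S f \<Longrightarrow> Ck_on k S (\<lambda>x. g (f x))"
proof (induction k arbitrary: g)
  case 0
  then show ?case using assms(3) by (auto intro: continuous_on_compose2)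
next
  case (Suc k)
  note f = Ck_on_SucD[OF Suc.prems(2)] and g = Ck_on_SucD[OF Suc.prems(1)]
  show ?case
  proof (rule Ck_on_SucI[OF assms(1)])
    fix x assume x: "x \<in> S"
    then have fx: "f x \<in> T" using assms(3) by auto
    have lin: "linear (frechet_derivative g (at (f x)))"
      using has_derivative_linear g(1)[OF fx] by blast
    have rep: "frechet_derivative g (at (f x)) u
        = (\<Sum>b\<in>Basis. (u \<bullet> b) *\<^sub>R frechet_derivative g (at (f x)) b)" for u
      by (subst euclidean_representation[of u, symmetric])
        (simp only: linear_sum[OF lin] linear_scale[OF lin])
    show "((\<lambda>x. g (f x)) has_derivative
        (\<lambda>v. \<Sum>b\<in>Basis. (frechet_derivative f (at x) v \<bullet> b) *\<^sub>R frechet_derivative g (at (f x)) b)) (at x)"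
      using has_derivative_compose[OF f(1)[OF x] g(1)[OF fx]]
      unfolding rep[symmetric] .
  next
    fix v
    show "Ck_on k S (\<lambda>x. \<Sum>b\<in>Basis. (frechet_derivative f (at x) v \<bullet> b) *\<^sub>R frechet_derivative g (at (f x)) b)"
      by (intro Ck_on_sum Ck_on_scaleR assms(1) Suc.IH[OF g(2) Ck_on_lower[OF Suc.prems(2)]]
          Ck_on_bounded_linear_comp[OF bounded_linear_inner_left] f(2))
  qed
qed

lemma Ck_on_real_SucI:
  fixes f :: "real \<Rightarrow> real"
  assumes "open S" "\<And>x. x \<in> S \<Longrightarrow> (f has_real_derivative f' x) (at x)" "Ck_on k S f'"
  shows "Ck_on (Suc k) S f"
proof (rule Ck_on_SucI[OF assms(1)])
  show "(f has_derivative (\<lambda>v. f' x *\<^sub>R v)) (at x)" if "x \<in> S" for x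
    using assms(2)[OF that] by (simp add: has_field_derivative_def)
  show "Ck_on k S (\<lambda>x. f' x *\<^sub>R v)" for v
    by (intro Ck_on_scaleR assms Ck_on_const)
qed

section \<open>Closure properties of smooth functions\<close>

lemma smooth_onI: "(\<And>k. Ck_on k S f) \<Longrightarrow> smooth_on S f"
  and smooth_onD: "smooth_on S f \<Longrightarrow> Ck_on k S f"
  by (auto simp: smooth_on_def)

lemma smooth_on_cong:
  "open S \<Longrightarrow> smooth_on S f \<Longrightarrow> (\<And>x. x \<in> S \<Longrightarrow> f x = g x) \<Longrightarrow> smooth_on S g"
  unfolding smooth_on_def by (metis Ck_on_cong)

lemma smooth_on_subset: "smooth_on S f \<Longrightarrow> S' \<subseteq> S \<Longrightarrow> smooth_on S' f"
  unfolding smooth_on_def by (metis Ck_on_subset)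

lemma smooth_on_local:
  "(\<And>x. x \<in> S \<Longrightarrow> \<exists>U. open U \<and> x \<in> U \<and> smooth_on U f) \<Longrightarrow> smooth_on S f"
  unfolding smooth_on_def using Ck_on_local by metis

lemma smooth_on_const: "smooth_on S (\<lambda>x. c)"
  by (simp add: smooth_on_def Ck_on_const)

lemma smooth_on_bounded_linear: "bounded_linear L \<Longrightarrow> open S \<Longrightarrow> smooth_on S L"
  by (simp add: smooth_on_def Ck_on_bounded_linear)

lemma smooth_on_bounded_linear_comp:
  "bounded_linear L \<Longrightarrow> open S \<Longrightarrow> smooth_on S f \<Longrightarrow> smooth_on S (\<lambda>x. L (f x))"
  by (simp add: smooth_on_def Ck_on_bounded_linear_comp)

lemma smooth_on_add:
  "open S \<Longrightarrow> smooth_on S f \<Longrightarrow> smooth_on S g \<Longrightarrow> smooth_on S (\<lambda>x. f x + g x)"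
  by (simp add: smooth_on_def Ck_on_add)

lemma smooth_on_sum:
  "open S \<Longrightarrow> (\<And>i. i \<in> I \<Longrightarrow> smooth_on S (f i)) \<Longrightarrow> smooth_on S (\<lambda>x. \<Sum>i\<in>I. f i x)"
  by (simp add: smooth_on_def Ck_on_sum)

lemma smooth_on_scaleR:
  "open S \<Longrightarrow> smooth_on S f \<Longrightarrow> smooth_on S g \<Longrightarrow> smooth_on S (\<lambda>x. f x *\<^sub>R g x)"
  by (simp add: smooth_on_def Ck_on_scaleR)

lemma smooth_on_mult:
  fixes f g :: "'a::euclidean_space \<Rightarrow> real"
  shows "open S \<Longrightarrow> smooth_on S f \<Longrightarrow> smooth_on S g \<Longrightarrow> smooth_on S (\<lambda>x. f x * g x)"
  using smooth_on_scaleR[of S f g] by simp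

lemma smooth_on_prod:
  fixes f :: "'i \<Rightarrow> 'a::euclidean_space \<Rightarrow> real"
  shows "open S \<Longrightarrow> (\<And>i. i \<in> I \<Longrightarrow> smooth_on S (f i)) \<Longrightarrow> smooth_on S (\<lambda>x. \<Prod>i\<in>I. f i x)"
  by (induction I rule: infinite_finite_induct) (auto intro: smooth_on_const smooth_on_mult)

lemma smooth_on_compose:
  fixes f :: "'a::euclidean_space \<Rightarrow> 'b::euclidean_space"
  assumes "open S" "open T" "f ` S \<subseteq> T" "smooth_on T g" "smooth_on S f"
  shows "smooth_on S (\<lambda>x. g (f x))"
  using assms by (simp add: smooth_on_def Ck_on_compose)

lemma smooth_on_has_derivative:
  "smooth_on S f \<Longrightarrow> x \<in> S \<Longrightarrow> (f has_derivative frechet_derivative f (at x)) (at x)"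
  using Ck_on_SucD(1) smooth_onD by blast

lemma smooth_on_differentiable: "smooth_on S f \<Longrightarrow> x \<in> S \<Longrightarrow> f differentiable (at x)"
  using smooth_on_has_derivative differentiable_def by blast

lemma smooth_on_frechet_derivative:
  "smooth_on S f \<Longrightarrow> smooth_on S (\<lambda>x. frechet_derivative f (at x) v)"
  using Ck_on_SucD(2) smooth_onD smooth_onI by metis

lemma smooth_on_continuous: "smooth_on S f \<Longrightarrow> continuous_on S f"
  using smooth_onD[of S f 0] by simp

text \<open>The function \<open>r\<close> satisfies \<open>r' = - r ^ 3 / 2\<close>, a polynomial in
  \<open>r\<close> itself, so the induction on \<open>k\<close> closes. Square root and inverse are
  then the products \<open>t * r t\<close> and \<open>r t * r t\<close>.\<close>

lemma smooth_on_inverse_sqrt: "smooth_on {0<..} (\<lambda>t::real. inverse (sqrt t))"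
proof (rule smooth_onI)
  fix k
  show "Ck_on k {0<..} (\<lambda>t::real. inverse (sqrt t))"
  proof (induction k)
    case 0
    then show ?case by (auto intro!: continuous_intros)
  next
    case (Suc k)
    let ?r = "\<lambda>t::real. inverse (sqrt t)"
    have "Ck_on k {0<..} (\<lambda>t. (-1/2) *\<^sub>R ?r t *\<^sub>R ?r t *\<^sub>R ?r t)"
      by (intro Ck_on_scaleR Suc.IH Ck_on_const) auto
    moreover have "(?r has_real_derivative (-1/2) *\<^sub>R ?r t *\<^sub>R ?r t *\<^sub>R ?r t) (at t)" if "t \<in> {0<..}" for t
      using that by (auto intro!: derivative_eq_intros simp: field_simps power2_eq_square)
    ultimately show ?case
      by (intro Ck_on_real_SucI) auto
  qed
qed

lemma smooth_on_sqrt: "smooth_on {0<..} sqrt"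
proof (rule smooth_on_cong)
  show "smooth_on {0<..} (\<lambda>t. t * inverse (sqrt t))"
    by (intro smooth_on_mult smooth_on_inverse_sqrt smooth_on_bounded_linear bounded_linear_ident) auto
  show "t * inverse (sqrt t) = sqrt t" if "t \<in> {0<..}" for t
    using that by (metis divide_inverse real_div_sqrt greaterThan_iff less_imp_le)
qed auto

lemma smooth_on_inverse: "smooth_on {0<..} (inverse :: real \<Rightarrow> real)"
proof (rule smooth_on_cong)
  show "smooth_on {0<..} (\<lambda>t. inverse (sqrt t) * inverse (sqrt t))"
    by (intro smooth_on_mult smooth_on_inverse_sqrt) auto
  show "inverse (sqrt t) * inverse (sqrt t) = inverse t" if "t \<in> {0<..}" for t
    using that by (metis inverse_mult_distrib real_sqrt_mult_self abs_of_pos greaterThan_iff)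
qed auto

text \<open>The functions \<open>exp (- 1 / t) / t ^ m\<close> for all \<open>m\<close> are needed together: the derivative of one is
  a combination of two others.\<close>

definition flat_exp :: "nat \<Rightarrow> real \<Rightarrow> real" where
  "flat_exp m t = (if t > 0 then exp (- 1 / t) * (1 / t) ^ m else 0)"

text \<open>Substituting \<open>s = 1 / t\<close> on the right of 0 reduces this to
  \<open>s ^ m / exp s\<close> tending to 0 at infinity.\<close>

lemma flat_exp_tendsto_0: "(flat_exp m \<longlongrightarrow> 0) (at 0)"
proof -
  have "((\<lambda>t::real. (1 / t) ^ m / exp (1 / t)) \<longlongrightarrow> 0) (at_right 0)"
    using filterlim_compose[OF tendsto_power_div_exp_0 filterlim_inverse_at_top_right]
    by (simp add: inverse_eq_divide)
  then have "(flat_exp m \<longlongrightarrow> 0) (at_right 0)"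
    by (rule Lim_transform_eventually)
      (auto simp: flat_exp_def exp_minus eventually_at_filter field_simps)
  moreover have "(flat_exp m \<longlongrightarrow> 0) (at_left 0)"
    by (rule tendsto_eventually) (auto simp: flat_exp_def eventually_at_filter)
  ultimately show ?thesis
    using filterlim_split_at by blast
qed

lemma flat_exp_has_derivative:
  "(flat_exp m has_real_derivative flat_exp (m + 2) t - m * flat_exp (m + 1) t) (at t)"
proof (cases t "0::real" rule: linorder_cases)
  case less
  have "((\<lambda>_. 0) has_real_derivative 0) (at t)" by simp
  then have "(flat_exp m has_real_derivative 0) (at t)"
    by (rule DERIV_cong_ev[OF refl _ refl, THEN iffD1, rotated])
      (use less eventually_nhds_in_open[of "{..<0}" t] in \<open>auto simp: flat_exp_def elim!: eventually_mono\<close>)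
  then show ?thesis using less by (simp add: flat_exp_def)
next
  case equal
  \<comment> \<open>The difference quotient of \<open>flat_exp m\<close> at 0 is exactly
    \<open>flat_exp (Suc m) h\<close>.\<close>
  have "((\<lambda>h. (flat_exp m (0 + h) - flat_exp m 0) / h) \<longlongrightarrow> 0) (at 0)"
    by (rule Lim_transform_eventually[OF flat_exp_tendsto_0[of "Suc m"]])
      (auto simp: flat_exp_def eventually_at_filter)
  then show ?thesis
    unfolding equal DERIV_def by (simp add: flat_exp_def)
next
  case greater
  have "((\<lambda>t. exp (- 1 / t) * (1 / t) ^ m) has_real_derivative
      exp (- 1 / t) * (1 / t) ^ (m + 2) - m * (exp (- 1 / t) * (1 / t) ^ (m + 1))) (at t)"
    using greater
    by (auto intro!: derivative_eq_intros simp: field_simps power2_eq_square power_eq_if[of t m])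
  then have "(flat_exp m has_real_derivative
      exp (- 1 / t) * (1 / t) ^ (m + 2) - m * (exp (- 1 / t) * (1 / t) ^ (m + 1))) (at t)"
    by (rule DERIV_cong_ev[OF refl _ refl, THEN iffD1, rotated])
      (use greater eventually_nhds_in_open[of "{0<..}" t] in \<open>auto simp: flat_exp_def elim!: eventually_mono\<close>)
  then show ?thesis using greater by (simp add: flat_exp_def)
qed

lemma smooth_on_flat_exp: "smooth_on UNIV (flat_exp m)"
proof (rule smooth_onI)
  fix k
  show "Ck_on k UNIV (flat_exp m)"
  proof (induction k arbitrary: m)
    case 0
    have "isCont (flat_exp m) t" for t
      using DERIV_isCont flat_exp_has_derivative by blast
    then show ?case by (simp add: continuous_at_imp_continuous_on)
  next
    case (Suc k)
    have "Ck_on k UNIV (\<lambda>t. flat_exp (m + 2) t + (- real m) *\<^sub>R flat_exp (m + 1) t)"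
      by (intro Ck_on_add Ck_on_scaleR Ck_on_const Suc.IH open_UNIV)
    then show ?case
      using flat_exp_has_derivative[of m] by (intro Ck_on_real_SucI[OF open_UNIV]) auto
  qed
qed

text \<open>The witness is \<open>flat_exp 0\<close> applied to
  \<open>r\<^sup>2 - (dist a x)\<^sup>2\<close>, which is positive exactly inside the open
  ball.\<close>

lemma bump_function:
  fixes a :: "'a::euclidean_space" and r :: real
  assumes "r > 0"
  obtains \<psi> :: "'a \<Rightarrow> real" where "smooth_on UNIV \<psi>" "\<And>x. \<psi> x \<ge> 0" "\<psi> a > 0"
    "\<And>x. x \<notin> cball a r \<Longrightarrow> \<psi> x = 0"
proof
  \<comment> \<open>The squared distance is spelled out with sums, products and scalings only, so
    that the closure rules prove it smooth.\<close>
  let ?s = "\<lambda>x. r\<^sup>2 + (- 1) *\<^sub>R (\<Sum>b\<in>Basis. ((x + - a) \<bullet> b) * ((x + - a) \<bullet> b))"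
  have s: "?s x = r\<^sup>2 - (dist a x)\<^sup>2" for x
    using euclidean_inner[of "x - a" "x - a"] power2_norm_eq_inner[of "x - a"]
    by (simp add: dist_norm norm_minus_commute)
  show "smooth_on UNIV (\<lambda>x. flat_exp 0 (?s x))"
    by (intro smooth_on_compose[OF open_UNIV open_UNIV _ smooth_on_flat_exp] subset_UNIV smooth_on_add
        smooth_on_const smooth_on_scaleR smooth_on_sum smooth_on_mult open_UNIV
        smooth_on_bounded_linear_comp[OF bounded_linear_inner_left]
        smooth_on_bounded_linear[OF bounded_linear_ident])
  show "flat_exp 0 (?s x) \<ge> 0" for x by (simp add: flat_exp_def)
  show "flat_exp 0 (?s a) > 0" using assms unfolding s by (simp add: flat_exp_def)
  show "flat_exp 0 (?s x) = 0" if "x \<notin> cball a r" for x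
  proof -
    have "r < dist a x" using that by simp
    then have "r\<^sup>2 < (dist a x)\<^sup>2" using assms by (intro power_strict_mono) auto
    then show ?thesis unfolding s by (simp add: flat_exp_def)
  qed
qed


section \<open>Determinants\<close>

lemma smooth_on_det:
  fixes A :: "'a::euclidean_space \<Rightarrow> real ^ 'n ^ 'n"
  assumes "open S" "\<And>i j. smooth_on S (\<lambda>x. A x $ i $ j)"
  shows "smooth_on S (\<lambda>x. det (A x))"
  unfolding det_def
  by (intro smooth_on_sum smooth_on_mult smooth_on_prod smooth_on_const assms)

lemma smooth_on_det_UNIV: "smooth_on UNIV (det :: real ^ 'k ^ 'k \<Rightarrow> real)"
  by (intro smooth_on_det smooth_on_bounded_linear open_UNIV
      bounded_linear_compose[OF bounded_linear_vec_nth bounded_linear_vec_nth])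

text \<open>In the Leibniz expansion only the identity contributes: any other permutation moves at
  least two points, so after one factor has been differentiated an off-diagonal entry of the
  identity matrix remains. The identity contributes the diagonal sum of \<open>B\<close>.\<close>

lemma det_has_derivative_at_one:
  fixes B :: "real ^ 'n ^ 'n"
  shows "((\<lambda>t. det (mat 1 + t *\<^sub>R B)) has_real_derivative trace B) (at 0)"
proof -
  let ?P = "{p. p permutes (UNIV :: 'n set)}"
  let ?d = "\<lambda>p. \<Sum>i\<in>UNIV. B $ i $ p i * (\<Prod>j\<in>UNIV - {i}. (mat 1 :: real ^ 'n ^ 'n) $ j $ p j)"
  have "((\<lambda>t. \<Prod>i\<in>UNIV. (mat 1 + t *\<^sub>R B) $ i $ p i) has_real_derivative ?d p) (at 0)" for p
    unfolding has_field_derivative_def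
    by (rule has_derivative_eq_rhs, rule has_derivative_prod[where f'="\<lambda>i h. h * B $ i $ p i"])
      (auto intro!: derivative_eq_intros simp: fun_eq_iff sum_distrib_left ac_simps)
  then have "((\<lambda>t. det (mat 1 + t *\<^sub>R B)) has_real_derivative (\<Sum>p\<in>?P. of_int (sign p) * ?d p)) (at 0)"
    unfolding det_def by (intro DERIV_sum DERIV_cmult) auto
  moreover have "?d p = 0" if p: "p \<in> ?P" "p \<noteq> id" for p
  proof -
    have ex: "\<exists>j. j \<noteq> i \<and> p j \<noteq> j" for i
    proof (rule ccontr)
      assume "\<nexists>j. j \<noteq> i \<and> p j \<noteq> j"
      then have fix_p: "p j = j" if "j \<noteq> i" for j using that by auto
      have "inj p" using p permutes_inj by auto
      then have "p i = i" using fix_p by (metis injD)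
      then show False using fix_p p(2) by (metis eq_id_iff)
    qed
    have "\<exists>j\<in>UNIV - {i}. (mat 1 :: real ^ 'n ^ 'n) $ j $ p j = 0" for i
      using ex[of i] by (auto simp: mat_def intro!: bexI)
    then have "(\<Prod>j\<in>UNIV - {i}. (mat 1 :: real ^ 'n ^ 'n) $ j $ p j) = 0" for i
      by (intro prod_zero) auto
    then show ?thesis by (simp only: mult_zero_right sum.neutral_const)
  qed
  then have "(\<Sum>p\<in>?P. of_int (sign p) * ?d p) = (\<Sum>p\<in>{id}. of_int (sign p) * ?d p)"
    by (intro sum.mono_neutral_right) (auto simp: permutes_id finite_permutations)
  moreover have "?d id = trace B"
    by (simp add: trace_def mat_def)
  ultimately show ?thesis by simp
qed

text \<open>Jacobi's formula in the directions \<open>A ** B\<close> and \<open>B ** A\<close>, where it needs no inverse.\<close>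

lemma frechet_derivative_det:
  fixes A B :: "real ^ 'n ^ 'n"
  shows "frechet_derivative det (at A) (A ** B) = det A * trace B"
    and "frechet_derivative det (at A) (B ** A) = det A * trace B"
proof -
  have D: "(det has_derivative frechet_derivative det (at A)) (at A)"
    using smooth_on_has_derivative[OF smooth_on_det_UNIV] by simp
  \<comment> \<open>The factorisation lets the line \<open>A + t *\<^sub>R C\<close> be
    differentiated twice, by the chain rule at \<open>A\<close> and by the derivative at the
    identity matrix; uniqueness of derivatives compares the results.\<close>
  have *: "frechet_derivative det (at A) C = det A * trace B"
    if eq: "\<And>t. det (A + t *\<^sub>R C) = det A * det (mat 1 + t *\<^sub>R B)" for C
  proof -
    have "((\<lambda>t. A + t *\<^sub>R C) has_derivative (\<lambda>t. t *\<^sub>R C)) (at 0)"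
      by (auto intro!: derivative_eq_intros)
    from diff_chain_at[OF this, of det] D
    have "((\<lambda>t. det (A + t *\<^sub>R C)) has_derivative (\<lambda>t. frechet_derivative det (at A) (t *\<^sub>R C))) (at 0)"
      by (simp add: o_def)
    moreover have "((\<lambda>t. det (A + t *\<^sub>R C)) has_derivative (\<lambda>t. det A * trace B * t)) (at 0)"
      using DERIV_cmult[OF det_has_derivative_at_one[of B], of "det A"]
      by (simp add: eq has_field_derivative_def)
    ultimately have "(\<lambda>t. frechet_derivative det (at A) (t *\<^sub>R C)) = (\<lambda>t. det A * trace B * t)"
      by (rule has_derivative_unique)
    from fun_cong[OF this, of 1] show ?thesis by simp
  qed
  have rdistrib: "(X + Y) ** A = X ** A + Y ** A" for X Y
    by (simp add: vec_eq_iff matrix_matrix_mult_def distrib_right sum.distrib)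
  have "A + t *\<^sub>R (A ** B) = A ** (mat 1 + t *\<^sub>R B)" "A + t *\<^sub>R (B ** A) = (mat 1 + t *\<^sub>R B) ** A" for t
    by (simp_all add: matrix_add_ldistrib rdistrib matrix_scalar_ac scalar_matrix_assoc)
  then show "frechet_derivative det (at A) (A ** B) = det A * trace B"
    "frechet_derivative det (at A) (B ** A) = det A * trace B"
    by (auto intro!: * simp: det_mul)
qed

lemma trace_transpose: "trace (transpose A) = trace A"
  by (simp add: trace_def transpose_def)

text \<open>Conjugation with \<open>\<sigma>\<close> is a sign-preserving bijection between the
  permutations of the two index types. This carries Jacobians over to a relabelled coordinate
  space.\<close>

lemma det_reindex:
  fixes A :: "'a::comm_ring_1 ^ 'n ^ 'n" and \<sigma> :: "'m::finite \<Rightarrow> 'n"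
  assumes "bij \<sigma>"
  shows "det (\<chi> i j. A $ \<sigma> i $ \<sigma> j) = det A"
proof -
  let ?m = "map_permutation UNIV \<sigma>"
  let ?m' = "map_permutation UNIV (inv \<sigma>)"
  have inj: "inj \<sigma>" "inj (inv \<sigma>)" and s: "\<And>x. \<sigma> (inv \<sigma> x) = x" "\<And>x. inv \<sigma> (\<sigma> x) = x"
    using assms by (auto simp: bij_is_inj bij_is_surj surj_imp_inj_inv surj_f_inv_f)
  have m: "?m p = \<sigma> \<circ> p \<circ> inv \<sigma>" for p
    using bij_is_surj[OF assms] by (simp add: map_permutation_def restrict_id_def fun_eq_iff)
  have m': "?m' p = inv \<sigma> \<circ> p \<circ> \<sigma>" for p
    using assms by (simp add: map_permutation_def restrict_id_def fun_eq_iff inv_inv_eq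
        bij_imp_bij_inv bij_is_surj)
  have bij: "bij_betw ?m {p. p permutes UNIV} {p. p permutes UNIV}"
  proof (rule bij_betw_byWitness[where f'="?m'"])
    show "?m ` {p. p permutes UNIV} \<subseteq> {p. p permutes UNIV}"
      using map_permutation_permutes[OF assms] by auto
    show "?m' ` {p. p permutes UNIV} \<subseteq> {p. p permutes UNIV}"
      using map_permutation_permutes[OF bij_imp_bij_inv[OF assms]] by auto
  qed (auto simp: m m' s fun_eq_iff)
  have "det A = (\<Sum>p | p permutes (UNIV :: 'm set). of_int (sign (?m p)) * (\<Prod>i\<in>UNIV. A $ i $ ?m p i))"
    unfolding det_def using sum.reindex_bij_betw[OF bij] by (rule sym)
  also have "\<dots> = (\<Sum>p | p permutes (UNIV :: 'm set). of_int (sign p) * (\<Prod>i\<in>UNIV. A $ \<sigma> i $ \<sigma> (p i)))"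
  proof (rule sum.cong[OF refl])
    fix p :: "'m \<Rightarrow> 'm" assume "p \<in> {p. p permutes UNIV}"
    then have "sign (?m p) = sign p" using sign_map_permutation[OF inj(1)] by auto
    moreover have "(\<Prod>i\<in>UNIV. A $ i $ ?m p i) = (\<Prod>i\<in>UNIV. A $ \<sigma> i $ ?m p (\<sigma> i))"
      using prod.reindex_bij_betw[OF assms, of "\<lambda>i. A $ i $ ?m p i"] by simp
    ultimately show "of_int (sign (?m p)) * (\<Prod>i\<in>UNIV. A $ i $ ?m p i)
        = of_int (sign p) * (\<Prod>i\<in>UNIV. A $ \<sigma> i $ \<sigma> (p i))"
      by (simp add: m s)
  qed
  finally show ?thesis by (simp add: det_def)
qed


section \<open>Integration\<close>

text \<open>Lebesgue-Borel measure is determined by the volumes of boxes, and relabelling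
  coordinates only permutes the factors of such a volume.\<close>

lemma lborel_distr_reindex:
  fixes \<sigma> :: "'m::finite \<Rightarrow> 'n::finite"
  assumes "bij \<sigma>"
  shows "distr lborel borel (\<lambda>x :: real ^ 'n. \<chi> i. x $ \<sigma> i) = lborel"
proof (rule lborel_eqI[symmetric])
  let ?L = "\<lambda>x :: real ^ 'n. \<chi> i. x $ \<sigma> i"
  have s: "\<And>x. \<sigma> (inv \<sigma> x) = x" "\<And>x. inv \<sigma> (\<sigma> x) = x"
    using assms by (auto simp: bij_is_inj bij_is_surj surj_f_inv_f)
  have L: "?L \<in> borel \<rightarrow>\<^sub>M borel"
    by (intro borel_measurable_continuous_onI continuous_intros)
  fix l u :: "real ^ 'm" assume le: "\<And>b. b \<in> Basis \<Longrightarrow> l \<bullet> b \<le> u \<bullet> b"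
  have le': "l $ i \<le> u $ i" for i
    using le[of "axis i 1"] by (auto simp: axis_in_Basis_iff inner_axis)
  have "?L -` box l u = box (\<chi> j. l $ inv \<sigma> j) (\<chi> j. u $ inv \<sigma> j)"
    by (auto simp: mem_box_cart) (metis s)+
  then have "emeasure (distr lborel borel ?L) (box l u)
      = emeasure lborel (box (\<chi> j. l $ inv \<sigma> j) (\<chi> j. u $ inv \<sigma> j) :: (real ^ 'n) set)"
    using L by (simp add: emeasure_distr)
  also have "\<dots> = (\<Prod>j\<in>UNIV. u $ inv \<sigma> j - l $ inv \<sigma> j)"
    using le' by (subst emeasure_lborel_box)
      (auto simp: Basis_vec_def axis_eq_axis inner_axis UNION_singleton_eq_range prod.reindex inj_on_def)
  also have "\<dots> = (\<Prod>i\<in>UNIV. u $ i - l $ i)"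
    using prod.reindex_bij_betw[OF bij_imp_bij_inv[OF assms], of "\<lambda>i. u $ i - l $ i"] by simp
  also have "\<dots> = (\<Prod>b\<in>Basis. (u - l) \<bullet> b)"
    by (auto simp: Basis_vec_def axis_eq_axis inner_axis UNION_singleton_eq_range prod.reindex inj_on_def)
  finally show "emeasure (distr lborel borel ?L) (box l u) = ennreal (\<Prod>b\<in>Basis. (u - l) \<bullet> b)" by simp
qed simp

text \<open>Translates the theorem on absolutely integrable vector-valued functions over Lebesgue
  measurable sets into Bochner integrals over \<open>lborel\<close>. The measurability assumption
  \<open>m\<close> allows the return from the completed measure.\<close>

lemma lborel_change_of_variables_wellorder:
  fixes g :: "real ^ 'n::{finite,wellorder} \<Rightarrow> real ^ 'n::{finite,wellorder}" and F :: "real ^ 'n::{finite,wellorder} \<Rightarrow> real"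
  assumes "open S" "open (g ` S)" "inj_on g S"
    and g': "\<And>x. x \<in> S \<Longrightarrow> (g has_derivative g' x) (at x)"
    and F: "integrable lborel (\<lambda>y. indicator (g ` S) y * F y)"
    and m: "(\<lambda>x. indicator S x * (\<bar>det (matrix (g' x))\<bar> * F (g x))) \<in> borel_measurable borel"
  shows "(LINT y|lborel. indicator (g ` S) y * F y)
       = (LINT x|lborel. indicator S x * (\<bar>det (matrix (g' x))\<bar> * F (g x)))"
proof -
  let ?G = "\<lambda>x. \<bar>det (matrix (g' x))\<bar> * F (g x)"
  \<comment> \<open>The theorem to be applied has integrands with values in some
    \<open>real ^ 'k\<close>; real functions are passed through \<open>real ^ 1\<close>.\<close>
  let ?v = "vec :: real \<Rightarrow> real ^ 1"
  have v: "bounded_linear ?v"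
    unfolding linear_conv_bounded_linear[symmetric] by (rule linearI) (auto simp: vec_eq_iff)
  have g'': "(g has_derivative g' x) (at x within S)" if "x \<in> S" for x
    using g'[OF that] has_derivative_at_withinI by blast
  have S: "S \<in> sets lebesgue" using assms(1) by simp
  have F': "F absolutely_integrable_on g ` S"
    using F integrable_completion[OF borel_measurable_integrable[OF F]]
    by (simp add: set_integrable_def)
  then have "(\<lambda>x. ?v (F x)) absolutely_integrable_on g ` S"
    using absolutely_integrable_linear[OF _ v] by (simp add: o_def)
  with has_absolute_integral_change_of_variables[OF S g'' assms(3), of "\<lambda>x. ?v (F x)"]
  have G: "(\<lambda>x. \<bar>det (matrix (g' x))\<bar> *\<^sub>R ?v (F (g x))) absolutely_integrable_on S"
    and eq: "integral S (\<lambda>x. \<bar>det (matrix (g' x))\<bar> *\<^sub>R ?v (F (g x))) = integral (g ` S) (\<lambda>x. ?v (F x))"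
    by auto
  have G': "?G absolutely_integrable_on S"
    using absolutely_integrable_linear[OF G bounded_linear_vec_nth[of 1]] by (simp add: o_def)
  have "integral S ?G = integral (g ` S) F"
    using arg_cong[OF eq, of "\<lambda>x. x $ 1"]
      integral_linear[OF absolutely_integrable_on_def[THEN iffD1, OF G, THEN conjunct1] bounded_linear_vec_nth[of 1]]
      integral_linear[OF absolutely_integrable_on_def[THEN iffD1, OF F', THEN conjunct1] v]
    by (simp add: o_def)
  moreover have "integral S ?G = (LINT x|lborel. indicator S x * ?G x)"
    using set_lebesgue_integral_eq_integral(2)[OF G'] integral_completion[of "\<lambda>x. indicator S x * ?G x" lborel] m
    by (simp add: set_lebesgue_integral_def)
  moreover have "integral (g ` S) F = (LINT x|lborel. indicator (g ` S) x * F x)"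
    using set_lebesgue_integral_eq_integral(2)[OF F'] integral_completion[OF borel_measurable_integrable[OF F]]
    by (simp add: set_lebesgue_integral_def)
  ultimately show ?thesis by simp
qed

text \<open>The change of variables theorem of the library is restricted to well-ordered index types;
  this is an isomorphic copy of a finite type that is well-ordered.\<close>

typedef 'n ordered_copy = "{..<CARD('n::finite)}"
  by (auto intro!: exI[of _ 0])

instantiation ordered_copy :: (finite) wellorder
begin

definition less_eq_ordered_copy :: "'a ordered_copy \<Rightarrow> 'a ordered_copy \<Rightarrow> bool" where
  "less_eq_ordered_copy x y \<longleftrightarrow> Rep_ordered_copy x \<le> Rep_ordered_copy y"

definition less_ordered_copy :: "'a ordered_copy \<Rightarrow> 'a ordered_copy \<Rightarrow> bool" where
  "less_ordered_copy x y \<longleftrightarrow> Rep_ordered_copy x < Rep_ordered_copy y"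

instance
proof
  fix P :: "'a ordered_copy \<Rightarrow> bool" and a :: "'a ordered_copy"
  assume step: "\<And>x. (\<And>y. y < x \<Longrightarrow> P y) \<Longrightarrow> P x"
  show "P a"
    by (induction a rule: measure_induct_rule[of Rep_ordered_copy])
      (auto intro: step simp: less_ordered_copy_def)
qed (auto simp: less_eq_ordered_copy_def less_ordered_copy_def Rep_ordered_copy_inject)

end

lemma ordered_copy_UNIV: "(UNIV :: 'n::finite ordered_copy set) = Abs_ordered_copy ` {..<CARD('n)}"
  by (metis type_definition.Abs_image type_definition_ordered_copy)

instance ordered_copy :: (finite) finite
  by standard (simp add: ordered_copy_UNIV)

lemma card_ordered_copy: "CARD('n::finite ordered_copy) = CARD('n)"
  by (simp add: ordered_copy_UNIV card_image Abs_ordered_copy_inject inj_on_def)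

text \<open>The map \<open>g\<close> is conjugated with the relabelling \<open>L\<close> of
  coordinates by the ordered copy of the index type. \<open>L\<close> preserves
  \<open>lborel\<close>, and the Jacobian determinant is unchanged by \<open>det_reindex\<close>, so
  both sides of the formula carry over.\<close>

lemma lborel_change_of_variables:
  fixes g :: "real ^ 'n \<Rightarrow> real ^ 'n" and F :: "real ^ 'n \<Rightarrow> real"
  assumes S: "open S" "open (g ` S)" "inj_on g S"
    and g': "\<And>x. x \<in> S \<Longrightarrow> (g has_derivative g' x) (at x)"
    and F: "integrable lborel (\<lambda>y. indicator (g ` S) y * F y)"
    and m: "(\<lambda>x. indicator S x * (\<bar>det (matrix (g' x))\<bar> * F (g x))) \<in> borel_measurable borel"
  shows "(LINT y|lborel. indicator (g ` S) y * F y)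
       = (LINT x|lborel. indicator S x * (\<bar>det (matrix (g' x))\<bar> * F (g x)))"
proof -
  obtain \<sigma> :: "'n ordered_copy \<Rightarrow> 'n" where \<sigma>: "bij \<sigma>"
    using card_ordered_copy[where 'n='n] finite_same_card_bij[OF finite finite] by metis
  have s: "\<And>x. \<sigma> (inv \<sigma> x) = x" "\<And>x. inv \<sigma> (\<sigma> x) = x"
    using \<sigma> by (auto simp: bij_is_inj bij_is_surj surj_f_inv_f)
  define L where "L = (\<lambda>x :: real ^ 'n. \<chi> i. x $ \<sigma> i)"
  define L' where "L' = (\<lambda>x :: real ^ 'n ordered_copy. \<chi> i. x $ inv \<sigma> i)"
  have L'L: "L' (L x) = x" and LL': "L (L' y) = y" for x y
    by (auto simp: L_def L'_def vec_eq_iff s)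
  have bl: "bounded_linear L" "bounded_linear L'"
    unfolding L_def L'_def linear_conv_bounded_linear[symmetric]
    by (auto simp: vec_eq_iff intro!: linearI)
  have cont: "continuous_on UNIV L" "continuous_on UNIV L'"
    using bl linear_continuous_on by auto
  then have Lm: "L \<in> borel \<rightarrow>\<^sub>M borel" "L' \<in> borel \<rightarrow>\<^sub>M borel"
    by (auto intro: borel_measurable_continuous_onI)
  have distr: "distr lborel borel L = lborel" "distr lborel borel L' = lborel"
    unfolding L_def L'_def by (intro lborel_distr_reindex \<sigma> bij_imp_bij_inv)+
  have img: "L ` A = L' -` A" for A
    using L'L LL' by (auto simp: image_iff) metis
  have opn: "open (L ` A)" if "open A" for A
    unfolding img using that cont(2) by (simp add: open_vimage)
  let ?g = "\<lambda>y. L (g (L' y))" and ?g' = "\<lambda>y v. L (g' (L' y) (L' v))"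
  have gimg: "?g ` (L ` S) = L ` (g ` S)"
    by (auto simp: L'L image_iff)
  have ind: "indicator (L ` A) y = (indicator A (L' y) :: real)" for A y
    unfolding img by (auto simp: indicator_def)
  have det: "det (matrix (?g' y)) = det (matrix (g' (L' y)))" if "y \<in> L ` S" for y
  proof -
    have ax: "L' (axis i 1) = axis (\<sigma> i) 1" for i
      by (auto simp: L'_def vec_eq_iff axis_def s)
    have "matrix (?g' y) = (\<chi> i j. matrix (g' (L' y)) $ \<sigma> i $ \<sigma> j)"
      by (simp add: matrix_def vec_eq_iff ax) (simp add: L_def)
    then show ?thesis using det_reindex[OF \<sigma>] by simp
  qed
  have der: "(?g has_derivative ?g' y) (at y)" if "y \<in> L ` S" for y
  proof -
    have "L' y \<in> S" using that by (auto simp: L'L)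
    from has_derivative_compose[OF bounded_linear_imp_has_derivative[OF bl(2)] g'[OF this]]
    show ?thesis by (rule bounded_linear.has_derivative[OF bl(1)])
  qed
  have rhs: "indicator (L ` S) y * (\<bar>det (matrix (?g' y))\<bar> * F (L' (?g y)))
      = indicator S (L' y) * (\<bar>det (matrix (g' (L' y)))\<bar> * F (g (L' y)))" for y
    using det[of y] by (auto simp: ind L'L indicator_def img)
  have "(LINT y|lborel. indicator (?g ` L ` S) y * F (L' y))
      = (LINT y|lborel. indicator (L ` S) y * (\<bar>det (matrix (?g' y))\<bar> * F (L' (?g y))))"
  proof (rule lborel_change_of_variables_wellorder)
    show "open (L ` S)" "open (?g ` L ` S)" unfolding gimg using S opn by auto
    show "inj_on ?g (L ` S)" using S(3) by (auto simp: inj_on_def L'L) (metis L'L)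
    show "integrable lborel (\<lambda>y. indicator (?g ` L ` S) y * F (L' y))"
      unfolding gimg ind using F integrable_distr_eq[of L' lborel borel "\<lambda>y. indicator (g ` S) y * F y"]
        distr Lm borel_measurable_integrable[OF F] by simp
    show "(\<lambda>y. indicator (L ` S) y * (\<bar>det (matrix (?g' y))\<bar> * F (L' (?g y)))) \<in> borel_measurable borel"
      unfolding rhs using measurable_compose[OF Lm(2) m] .
  qed (fact der)
  moreover have "(LINT y|lborel. indicator (g ` S) y * F y) = (LINT y|lborel. indicator (?g ` L ` S) y * F (L' y))"
    unfolding gimg ind using integral_distr[of L' lborel borel "\<lambda>y. indicator (g ` S) y * F y"]
      distr Lm borel_measurable_integrable[OF F] by simp
  moreover have "(LINT x|lborel. indicator S x * (\<bar>det (matrix (g' x))\<bar> * F (g x)))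
      = (LINT y|lborel. indicator (L ` S) y * (\<bar>det (matrix (?g' y))\<bar> * F (L' (?g y))))"
    unfolding rhs using integral_distr[of L' lborel borel "\<lambda>x. indicator S x * (\<bar>det (matrix (g' x))\<bar> * F (g x))"]
      distr Lm m by simp
  ultimately show ?thesis by simp
qed

lemma integrable_compact_support:
  fixes f :: "'a::euclidean_space \<Rightarrow> real"
  assumes "continuous_on UNIV f" "compact K" "\<And>x. x \<notin> K \<Longrightarrow> f x = 0"
  shows "integrable lborel f"
proof -
  have "(\<lambda>x. indicator K x *\<^sub>R f x) = f"
    using assms(3) by (auto simp: indicator_def fun_eq_iff)
  then show ?thesis
    using borel_integrable_compact[OF assms(2) continuous_on_subset[OF assms(1) subset_UNIV]] by simp
qed

text \<open>By translation invariance every difference quotient has integral \<open>0\<close>.\<close>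

lemma integral_directional_derivative_eq_0:
  fixes F :: "'a::euclidean_space \<Rightarrow> real"
  assumes F: "smooth_on UNIV F" and K: "compact K" "\<And>x. x \<notin> K \<Longrightarrow> F x = 0"
  shows "integrable lborel (\<lambda>x. frechet_derivative F (at x) v)"
    and "(LINT x|lborel. frechet_derivative F (at x) v) = 0"
proof -
  let ?D = "\<lambda>x. frechet_derivative F (at x) v"
  have contF: "continuous_on UNIV F" and contD: "continuous_on UNIV ?D"
    using F smooth_on_frechet_derivative smooth_on_continuous by blast+
  have D0: "?D x = 0" if "x \<notin> K" for x
  proof -
    have "open (- K)" using compact_imp_closed[OF K(1)] by auto
    then have "frechet_derivative F (at x) = frechet_derivative (\<lambda>_. 0) (at x)"
      using frechet_derivative_cong_open[of "- K" x F "\<lambda>_. 0"] that K(2) by auto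
    then show ?thesis by simp
  qed
  show intD: "integrable lborel ?D"
    using integrable_compact_support[OF contD K(1) D0] by simp
  have intF: "integrable lborel F"
    using integrable_compact_support[OF contF K] by simp
  have intF': "integrable lborel (\<lambda>x. F (t *\<^sub>R v + x))" "(LINT x|lborel. F (t *\<^sub>R v + x)) = (LINT x|lborel. F x)" for t
    using integrable_distr_eq[of "(+) (t *\<^sub>R v)" lborel borel F] integral_distr[of "(+) (t *\<^sub>R v)" lborel borel F]
      lborel_distr_plus[of "t *\<^sub>R v"] intF borel_measurable_integrable[OF intF] by simp_all
  have "compact (?D ` K)" using compact_continuous_image[OF continuous_on_subset[OF contD] K(1)] by simp
  then obtain B where B0: "\<And>x. x \<in> K \<Longrightarrow> norm (?D x) \<le> B" "B > 0"
    using compact_imp_bounded[of "?D ` K"] by (auto simp: bounded_pos)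
  then have B: "\<bar>?D x\<bar> \<le> B" for x using D0[of x] B0 by (cases "x \<in> K") auto
  obtain R where R: "\<And>x. x \<in> K \<Longrightarrow> norm x \<le> R"
    using K(1) compact_imp_bounded bounded_iff by metis
  \<comment> \<open>Since \<open>0 < ?t n \<le> 1\<close>, the translation moves points by at most
    \<open>norm v\<close>; off this ball both values of \<open>F\<close> in the quotient vanish, for
    every \<open>n\<close>.\<close>
  let ?C = "cball 0 (R + norm v) :: 'a set"
  let ?t = "\<lambda>n. inverse (real (Suc n))"
  let ?q = "\<lambda>n x. (F (?t n *\<^sub>R v + x) - F x) / ?t n"
  have "(\<lambda>n. LINT x|lborel. ?q n x) \<longlonglongrightarrow> (LINT x|lborel. ?D x)"
  \<comment> \<open>\<open>B\<close> bounds the derivative everywhere, hence by the mean value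
    theorem also every quotient.\<close>
  proof (rule integral_dominated_convergence[where w="\<lambda>x. indicator ?C x * B"])
    show "?D \<in> borel_measurable lborel" using borel_measurable_integrable[OF intD] .
    show "?q n \<in> borel_measurable lborel" for n
      using borel_measurable_integrable[OF intF] borel_measurable_integrable[OF intF'(1)] by simp
    show "integrable lborel (\<lambda>x. indicator ?C x * B)"
      using borel_integrable_compact[of ?C "\<lambda>_. B"] by (simp add: ac_simps)
    have der: "((\<lambda>s. F (s *\<^sub>R v + x)) has_real_derivative ?D (s *\<^sub>R v + x)) (at s)" for x s
    proof -
      let ?DF = "frechet_derivative F (at (s *\<^sub>R v + x))"
      have DF: "(F has_derivative ?DF) (at (s *\<^sub>R v + x))"
        using smooth_on_has_derivative[OF F] by simp
      have "((\<lambda>s. s *\<^sub>R v + x) has_derivative (\<lambda>h. h *\<^sub>R v)) (at s)"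
        by (auto intro!: derivative_eq_intros)
      from has_derivative_compose[OF this DF]
      have "((\<lambda>s. F (s *\<^sub>R v + x)) has_derivative (\<lambda>h. h * ?DF v)) (at s)"
        using linear_scale[OF has_derivative_linear[OF DF]] by simp
      then show ?thesis by (simp add: has_field_derivative_def mult.commute[of _ "?DF v"])
    qed
    show "AE x in lborel. (\<lambda>n. ?q n x) \<longlonglongrightarrow> ?D x"
    proof (rule AE_I2)
      fix x
      have "((\<lambda>h. (F (h *\<^sub>R v + x) - F x) / h) \<longlongrightarrow> ?D x) (at 0)"
        using der[of x 0] by (simp add: DERIV_def)
      moreover have "filterlim ?t (at 0) sequentially"
        unfolding filterlim_at using LIMSEQ_inverse_real_of_nat by auto
      ultimately show "(\<lambda>n. ?q n x) \<longlonglongrightarrow> ?D x"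
        by (rule filterlim_compose)
    qed
    show "AE x in lborel. norm (?q n x) \<le> indicator ?C x * B" for n
    proof (rule AE_I2)
      fix x
      have t: "0 < ?t n" "?t n \<le> 1" by (auto simp: field_simps)
      show "norm (?q n x) \<le> indicator ?C x * B"
      proof (cases "x \<in> ?C")
        case True
        obtain z where "F (?t n *\<^sub>R v + x) - F (0 *\<^sub>R v + x) = (?t n - 0) * ?D (z *\<^sub>R v + x)"
          using MVT2[OF t(1), of "\<lambda>s. F (s *\<^sub>R v + x)" "\<lambda>s. ?D (s *\<^sub>R v + x)"] der by metis
        then have "?q n x = ?D (z *\<^sub>R v + x)" using t by simp
        then show ?thesis using B True by simp
      next
        case False
        have "norm (?t n *\<^sub>R v) \<le> norm v"
          using t by (simp add: mult_left_le_one_le)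
        moreover have "norm x \<le> norm (?t n *\<^sub>R v + x) + norm (?t n *\<^sub>R v)"
          by (metis add.commute add_diff_cancel_right' norm_triangle_ineq4)
        ultimately have "R < norm (?t n *\<^sub>R v + x)" "R < norm x"
          using False norm_ge_zero[of v] by (simp_all only: mem_cball_0)
        then have "F (?t n *\<^sub>R v + x) = 0" "F x = 0" using R K(2) by (metis not_le)+
        then show ?thesis using B0(2) by simp
      qed
    qed
  qed
  moreover have "(LINT x|lborel. ?q n x) = 0" for n
    using intF intF' by simp
  ultimately show "(LINT x|lborel. ?D x) = 0"
    by (simp only: LIMSEQ_const_iff)
qed

text \<open>The set where \<open>f\<close> is nonzero is open by continuity and negligible by the
  vanishing integral, hence empty.\<close>

lemma integral_nonneg_eq_0_imp_eq_0:
  fixes f :: "'a::euclidean_space \<Rightarrow> real"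
  assumes f: "continuous_on UNIV f" "\<And>x. f x \<ge> 0" and "integrable lborel f" "(LINT x|lborel. f x) = 0"
  shows "f x = 0"
proof -
  have "AE x in lborel. f x = 0"
    using integral_nonneg_eq_0_iff_AE[OF assms(3)] assms by auto
  then have "{x. f x \<noteq> 0} \<in> null_sets lborel"
    using borel_measurable_integrable[OF assms(3)] by (subst (asm) AE_iff_null) auto
  then have "negligible {x. f x \<noteq> 0}"
    by (simp add: negligible_iff_null_sets null_sets_completionI)
  moreover have "open {x. f x \<noteq> 0}"
    by (intro open_Collect_neq f continuous_intros)
  ultimately show ?thesis
    using open_not_negligible by blast
qed


section \<open>Smooth functions on a manifold\<close>

locale smooth_mfd =
  fixes M :: "('m, 'n::finite) manifold"
  assumes smooth_manifold: "smooth_manifold M"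
begin

lemma Hausdorff: "Hausdorff_space (mtop M)"
  and chart_is_chart: "c \<in> atlas M \<Longrightarrow> is_chart (mtop M) c"
  and smooth_transition: "c \<in> atlas M \<Longrightarrow> d \<in> atlas M \<Longrightarrow> smooth_transition c d"
  using smooth_manifold by (auto simp: smooth_manifold_def)

lemma chart_open: "c \<in> atlas M \<Longrightarrow> openin (mtop M) (chart_dom c)"
  and chart_image_open: "c \<in> atlas M \<Longrightarrow> open (chart_map c ` chart_dom c)"
  and chart_homeomorphic: "c \<in> atlas M \<Longrightarrow>
    homeomorphic_map (subtopology (mtop M) (chart_dom c)) (top_of_set (chart_map c ` chart_dom c)) (chart_map c)"
  using chart_is_chart by (auto simp: is_chart_def)

lemma chart_dom_points: "c \<in> atlas M \<Longrightarrow> p \<in> chart_dom c \<Longrightarrow> p \<in> points M"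
  using chart_open openin_subset by blast

lemma chart_inj: "c \<in> atlas M \<Longrightarrow> inj_on (chart_map c) (chart_dom c)"
  using homeomorphic_imp_injective_map[OF chart_homeomorphic[of c]] openin_subset[OF chart_open[of c]]
  by (simp add: Int_absorb1)

lemma chart_inv_map: "c \<in> atlas M \<Longrightarrow> p \<in> chart_dom c \<Longrightarrow> chart_inv c (chart_map c p) = p"
  by (simp add: chart_inv_def chart_inj)

lemma chart_image_Int_open:
  assumes "c \<in> atlas M" "openin (mtop M) V"
  shows "open (chart_map c ` (chart_dom c \<inter> V))"
proof -
  have "openin (subtopology (mtop M) (chart_dom c)) (chart_dom c \<inter> V)"
    using assms(2) by (metis Int_commute openin_subtopology_Int)
  then have "openin (top_of_set (chart_map c ` chart_dom c)) (chart_map c ` (chart_dom c \<inter> V))"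
    using homeomorphic_imp_open_map[OF chart_homeomorphic[OF assms(1)]] by (simp add: open_map_def)
  then show ?thesis
    using openin_open_trans chart_image_open[OF assms(1)] by blast
qed

lemma chart_vimage_open:
  assumes "c \<in> atlas M" "open S"
  shows "openin (mtop M) {p \<in> chart_dom c. chart_map c p \<in> S}"
proof -
  have "continuous_map (subtopology (mtop M) (chart_dom c)) euclidean (chart_map c)"
    using homeomorphic_imp_continuous_map[OF chart_homeomorphic[OF assms(1)]]
    by (simp add: continuous_map_in_subtopology)
  then have "openin (subtopology (mtop M) (chart_dom c))
      {p \<in> topspace (subtopology (mtop M) (chart_dom c)). chart_map c p \<in> S}"
    using assms(2) by (intro openin_continuous_map_preimage) auto
  moreover have "topspace (subtopology (mtop M) (chart_dom c)) = chart_dom c"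
    using openin_subset[OF chart_open[OF assms(1)]] by auto
  ultimately show ?thesis
    using openin_trans_full chart_open[OF assms(1)] by fastforce
qed

lemma chart_at:
  assumes "p \<in> points M"
  shows "chart_at M p \<in> atlas M" "p \<in> chart_dom (chart_at M p)"
proof -
  have "(\<Union>c\<in>atlas M. chart_dom c) = points M"
    using smooth_manifold by (simp add: smooth_manifold_def)
  then have "\<exists>c. c \<in> atlas M \<and> p \<in> chart_dom c" using assms by blast
  from someI_ex[OF this] show "chart_at M p \<in> atlas M" "p \<in> chart_dom (chart_at M p)"
    by (auto simp: chart_at_def)
qed

lemma smooth_funD:
  "smooth_fun M U F \<Longrightarrow> c \<in> atlas M \<Longrightarrow> smooth_on (chart_map c ` (chart_dom c \<inter> U)) (F \<circ> chart_inv c)"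
  and smooth_fun_open: "smooth_fun M U F \<Longrightarrow> openin (mtop M) U"
  by (auto simp: smooth_fun_def)

text \<open>\<open>smooth_fun\<close> asks for all charts of the atlas. As transition maps are
  smooth, a single chart around each point suffices.\<close>

lemma smooth_funI:
  assumes U: "openin (mtop M) U"
    and ex: "\<And>p. p \<in> U \<Longrightarrow> \<exists>V. \<exists>c\<in>atlas M. openin (mtop M) V \<and> p \<in> V \<and> p \<in> chart_dom c \<and>
      smooth_on (chart_map c ` (chart_dom c \<inter> V)) (F \<circ> chart_inv c)"
  shows "smooth_fun M U F"
  unfolding smooth_fun_def
proof (intro conjI U ballI smooth_on_local)
  fix e x assume e: "e \<in> atlas M" and "x \<in> chart_map e ` (chart_dom e \<inter> U)"
  then obtain p where p: "p \<in> chart_dom e" "p \<in> U" and x: "x = chart_map e p" by auto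
  from ex[OF p(2)] obtain V c where V: "openin (mtop M) V" "p \<in> V" and c: "c \<in> atlas M" "p \<in> chart_dom c"
    and F: "smooth_on (chart_map c ` (chart_dom c \<inter> V)) (F \<circ> chart_inv c)" by blast
  let ?O = "chart_map e ` (chart_dom e \<inter> (chart_dom c \<inter> V))"
  have O: "open ?O"
    using chart_image_Int_open[OF e] openin_Int[OF chart_open[OF c(1)] V(1)] by blast
  have inv: "\<And>q. q \<in> chart_dom e \<Longrightarrow> chart_inv e (chart_map e q) = q"
    "\<And>q. q \<in> chart_dom c \<Longrightarrow> chart_inv c (chart_map c q) = q"
    using chart_inv_map e c by auto
  have "smooth_on ?O (\<lambda>x. (F \<circ> chart_inv c) ((chart_map c \<circ> chart_inv e) x))"
  proof (rule smooth_on_compose[OF O chart_image_Int_open[OF c(1) V(1)] _ F])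
    show "smooth_on ?O (chart_map c \<circ> chart_inv e)"
      using smooth_transition[OF e c(1)] by (auto simp: smooth_transition_def elim: smooth_on_subset)
  qed (auto simp: inv)
  then have "smooth_on ?O (F \<circ> chart_inv e)"
    by (rule smooth_on_cong[OF O]) (auto simp: inv)
  then show "\<exists>U. open U \<and> x \<in> U \<and> smooth_on U (F \<circ> chart_inv e)"
    using O p x c(2) V(2) by blast
qed

lemma smooth_fun_local:
  assumes "openin (mtop M) U" "\<And>p. p \<in> U \<Longrightarrow> \<exists>V. p \<in> V \<and> smooth_fun M V F"
  shows "smooth_fun M U F"
proof (rule smooth_funI[OF assms(1)])
  fix p assume p: "p \<in> U"
  then have "p \<in> points M" using assms(1) openin_subset by blast
  then show "\<exists>V. \<exists>c\<in>atlas M. openin (mtop M) V \<and> p \<in> V \<and> p \<in> chart_dom c \<and>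
      smooth_on (chart_map c ` (chart_dom c \<inter> V)) (F \<circ> chart_inv c)"
    using assms(2)[OF p] chart_at[of p] smooth_funD smooth_fun_open by metis
qed

lemma smooth_fun_subset:
  "smooth_fun M U F \<Longrightarrow> openin (mtop M) V \<Longrightarrow> V \<subseteq> U \<Longrightarrow> smooth_fun M V F"
  unfolding smooth_fun_def by (meson Int_mono image_mono order_refl smooth_on_subset)

text \<open>Schema behind the closure properties below: it reduces them to the corresponding facts
  on open subsets of the coordinate space.\<close>

lemma smooth_fun_lift:
  assumes "smooth_fun M U F" and
    "\<And>c. c \<in> atlas M \<Longrightarrow> open (chart_map c ` (chart_dom c \<inter> U)) \<Longrightarrow>
      smooth_on (chart_map c ` (chart_dom c \<inter> U)) (F \<circ> chart_inv c) \<Longrightarrow>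
      smooth_on (chart_map c ` (chart_dom c \<inter> U)) (G \<circ> chart_inv c)"
  shows "smooth_fun M U G"
  using assms chart_image_Int_open smooth_fun_def by metis

lemma smooth_fun_cong:
  "smooth_fun M U F \<Longrightarrow> (\<And>p. p \<in> U \<Longrightarrow> F p = G p) \<Longrightarrow> smooth_fun M U G"
proof (erule smooth_fun_lift)
  fix c :: "('m, 'n) chart"
  let ?O = "chart_map c ` (chart_dom c \<inter> U)"
  assume eq: "\<And>p. p \<in> U \<Longrightarrow> F p = G p" and c: "c \<in> atlas M"
    and O: "open ?O" "smooth_on ?O (F \<circ> chart_inv c)"
  show "smooth_on ?O (G \<circ> chart_inv c)"
    by (rule smooth_on_cong[OF O]) (auto simp: eq chart_inv_map[OF c])
qed

lemma smooth_fun_const: "openin (mtop M) U \<Longrightarrow> smooth_fun M U (\<lambda>p. a)"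
  by (simp add: smooth_fun_def o_def smooth_on_const)

lemma smooth_fun_bounded_linear:
  "bounded_linear L \<Longrightarrow> smooth_fun M U F \<Longrightarrow> smooth_fun M U (\<lambda>p. L (F p))"
  by (erule smooth_fun_lift) (auto simp: o_def intro: smooth_on_bounded_linear_comp)

lemma smooth_fun_nth:
  fixes F :: "'m \<Rightarrow> real ^ 'k"
  shows "smooth_fun M U F \<Longrightarrow> smooth_fun M U (\<lambda>p. F p $ j)"
  by (rule smooth_fun_bounded_linear[OF bounded_linear_vec_nth])

lemma smooth_fun_add:
  "smooth_fun M U F \<Longrightarrow> smooth_fun M U G \<Longrightarrow> smooth_fun M U (\<lambda>p. F p + G p)"
proof (erule smooth_fun_lift)
  fix c :: "('m, 'n) chart"
  let ?O = "chart_map c ` (chart_dom c \<inter> U)"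
  assume G: "smooth_fun M U G" and c: "c \<in> atlas M" and O: "open ?O" "smooth_on ?O (F \<circ> chart_inv c)"
  show "smooth_on ?O ((\<lambda>p. F p + G p) \<circ> chart_inv c)"
    using smooth_on_add[OF O smooth_funD[OF G c]] by (simp add: o_def)
qed

lemma smooth_fun_scaleR:
  "smooth_fun M U F \<Longrightarrow> smooth_fun M U G \<Longrightarrow> smooth_fun M U (\<lambda>p. F p *\<^sub>R G p)"
proof (erule smooth_fun_lift)
  fix c :: "('m, 'n) chart"
  let ?O = "chart_map c ` (chart_dom c \<inter> U)"
  assume G: "smooth_fun M U G" and c: "c \<in> atlas M" and O: "open ?O" "smooth_on ?O (F \<circ> chart_inv c)"
  show "smooth_on ?O ((\<lambda>p. F p *\<^sub>R G p) \<circ> chart_inv c)"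
    using smooth_on_scaleR[OF O smooth_funD[OF G c]] by (simp add: o_def)
qed

lemma smooth_fun_mult:
  fixes F G :: "'m \<Rightarrow> real"
  shows "smooth_fun M U F \<Longrightarrow> smooth_fun M U G \<Longrightarrow> smooth_fun M U (\<lambda>p. F p * G p)"
  using smooth_fun_scaleR[of U F G] by simp

lemma smooth_fun_sum:
  assumes "openin (mtop M) U" "\<And>i. i \<in> I \<Longrightarrow> smooth_fun M U (F i)"
  shows "smooth_fun M U (\<lambda>p. \<Sum>i\<in>I. F i p)"
  using assms(2)
  by (induction I rule: infinite_finite_induct) (auto intro: smooth_fun_const smooth_fun_add assms(1))

lemma smooth_fun_compose:
  fixes F :: "'m \<Rightarrow> 'b::euclidean_space"
  assumes "smooth_fun M U F" "smooth_on T g" "open T" "F ` U \<subseteq> T"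
  shows "smooth_fun M U (\<lambda>p. g (F p))"
  using assms(1)
proof (rule smooth_fun_lift)
  fix c :: "('m, 'n) chart"
  let ?O = "chart_map c ` (chart_dom c \<inter> U)"
  assume c: "c \<in> atlas M" and "open ?O" "smooth_on ?O (F \<circ> chart_inv c)"
  then have "smooth_on ?O (\<lambda>x. g ((F \<circ> chart_inv c) x))"
    using assms(4) by (intro smooth_on_compose[OF _ assms(3) _ assms(2)]) (auto simp: chart_inv_map o_def)
  then show "smooth_on ?O ((\<lambda>p. g (F p)) \<circ> chart_inv c)" by (simp add: o_def)
qed

lemma smooth_fun_chart: "c \<in> atlas M \<Longrightarrow> smooth_fun M (chart_dom c) (chart_map c)"
  using smooth_transition by (auto simp: smooth_fun_def smooth_transition_def chart_open)

lemma smooth_fun_vimage_open: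
  fixes F :: "'m \<Rightarrow> 'b::real_normed_vector"
  assumes F: "smooth_fun M U F" and S: "open S"
  shows "openin (mtop M) {p \<in> U. F p \<in> S}"
proof (subst openin_subopen, safe)
  fix p assume p: "p \<in> U" "F p \<in> S"
  then have "p \<in> points M" using smooth_fun_open[OF F] openin_subset by blast
  note c = chart_at[OF this]
  let ?c = "chart_at M p"
  let ?O = "chart_map ?c ` (chart_dom ?c \<inter> U)"
  have cont: "continuous_on ?O (F \<circ> chart_inv ?c)" and O: "open ?O"
    using smooth_on_continuous[OF smooth_funD[OF F c(1)]] chart_image_Int_open[OF c(1) smooth_fun_open[OF F]] .
  then have "open (?O \<inter> (F \<circ> chart_inv ?c) -` S)"
    using S cont continuous_on_open_vimage[OF O] by (metis Int_commute)
  then have "openin (mtop M) {q \<in> chart_dom ?c. chart_map ?c q \<in> ?O \<inter> (F \<circ> chart_inv ?c) -` S}" (is "openin _ ?V")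
    by (rule chart_vimage_open[OF c(1)])
  moreover have "q \<in> U" "F q \<in> S" if "q \<in> ?V" for q
    using that chart_inv_map[OF c(1)] by (auto; metis)+
  moreover have "p \<in> ?V" using p c by (auto simp: chart_inv_map)
  ultimately show "\<exists>T. openin (mtop M) T \<and> p \<in> T \<and> T \<subseteq> {p \<in> U. F p \<in> S}" by blast
qed

text \<open>Here the Hausdorff property enters: the set is compact, as a homeomorphic image of
  \<open>K\<close>, and therefore closed in all of \<open>M\<close> and not just in the chart. This
  is what makes extension by zero beyond a chart smooth.\<close>

lemma chart_compact_closed:
  assumes c: "c \<in> atlas M" and K: "compact K" "K \<subseteq> chart_map c ` chart_dom c"
  shows "closedin (mtop M) {p \<in> chart_dom c. chart_map c p \<in> K}"
proof -
  let ?T = "subtopology (mtop M) (chart_dom c)" and ?O = "top_of_set (chart_map c ` chart_dom c)"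
  have top: "topspace ?T = chart_dom c"
    using openin_subset[OF chart_open[OF c]] by auto
  obtain h where h: "homeomorphic_maps ?T ?O (chart_map c) h"
    using chart_homeomorphic[OF c] homeomorphic_map_maps by blast
  have "compactin ?O K" using K by (simp add: compactin_subtopology)
  then have "compactin ?T (h ` K)"
    using h image_compactin by (auto simp: homeomorphic_maps_def)
  then have "compactin (mtop M) (h ` K)"
    by (simp add: compactin_subtopology)
  moreover have "h ` K = {p \<in> chart_dom c. chart_map c p \<in> K}"
    using h K(2) top by (force simp: homeomorphic_maps_def continuous_map_def image_iff)
  ultimately show ?thesis
    using compactin_imp_closedin[OF Hausdorff] by simp
qed

lemma smooth_bump:
  assumes c: "c \<in> atlas M" and p: "p \<in> chart_dom c"
  obtains \<beta> :: "'m \<Rightarrow> real" and K where "smooth_fun M (points M) \<beta>" "\<And>q. \<beta> q \<ge> 0" "\<beta> p > 0"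
    "compact K" "K \<subseteq> chart_map c ` chart_dom c"
    "\<And>q. \<not> (q \<in> chart_dom c \<and> chart_map c q \<in> K) \<Longrightarrow> \<beta> q = 0"
proof -
  obtain r where r: "r > 0" "cball (chart_map c p) r \<subseteq> chart_map c ` chart_dom c"
    using open_contains_cball[THEN iffD1, OF chart_image_open[OF c]] p by blast
  obtain \<psi> :: "real ^ 'n \<Rightarrow> real" where \<psi>: "smooth_on UNIV \<psi>" "\<And>x. \<psi> x \<ge> 0" "\<psi> (chart_map c p) > 0"
    "\<And>x. x \<notin> cball (chart_map c p) r \<Longrightarrow> \<psi> x = 0"
    using bump_function[OF r(1)] by blast
  define \<beta> where "\<beta> q = (if q \<in> chart_dom c then \<psi> (chart_map c q) else 0)" for q
  let ?C = "{q \<in> chart_dom c. chart_map c q \<in> cball (chart_map c p) r}"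
  have C: "closedin (mtop M) ?C"
    using chart_compact_closed[OF c _ r(2)] by simp
  \<comment> \<open>The chart domain and the complement of \<open>?C\<close> are open and cover
    \<open>M\<close>; on the first, \<open>\<beta>\<close> is a smooth function of the coordinates,
    on the second it is zero.\<close>
  have "smooth_fun M (points M) \<beta>"
  proof (rule smooth_fun_local[OF openin_topspace])
    fix q assume q: "q \<in> points M"
    have "smooth_fun M (chart_dom c) (\<lambda>q. \<psi> (chart_map c q))"
      using smooth_fun_compose[OF smooth_fun_chart[OF c] \<psi>(1)] by simp
    then have 1: "smooth_fun M (chart_dom c) \<beta>"
      by (rule smooth_fun_cong) (simp add: \<beta>_def)
    have "smooth_fun M (points M - ?C) (\<lambda>q. 0 :: real)"
      using C by (intro smooth_fun_const) (simp add: openin_diff)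
    then have 2: "smooth_fun M (points M - ?C) \<beta>"
      by (rule smooth_fun_cong) (auto simp: \<beta>_def \<psi>(4))
    show "\<exists>V. q \<in> V \<and> smooth_fun M V \<beta>"
    proof (cases "q \<in> chart_dom c")
      case False
      then have "q \<in> points M - ?C" using q by simp
      with 2 show ?thesis by (intro exI conjI)
    next
      case True
      with 1 show ?thesis by (intro exI conjI)
    qed
  qed
  then show ?thesis
    using that[of \<beta> "cball (chart_map c p) r"] \<psi> r p by (auto simp: \<beta>_def)
qed


section \<open>Tangent vectors in coordinates\<close>

definition chart_deriv :: "('m, 'n) chart \<Rightarrow> 'm \<Rightarrow> real ^ 'n \<Rightarrow> ('m \<Rightarrow> 'b::real_normed_vector) \<Rightarrow> 'b" where
  "chart_deriv c p v F = frechet_derivative (F \<circ> chart_inv c) (at (chart_map c p)) v"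

text \<open>The coordinate field with constant components \<open>v\<close> in the chart
  \<open>c\<close>, written as a tangent vector in the sense of \<open>chart_at M p\<close>. For
  each \<open>p\<close> in the chart, \<open>comps c p\<close> is the inverse operation.\<close>

definition chart_vec :: "('m, 'n) chart \<Rightarrow> real ^ 'n \<Rightarrow> 'm \<Rightarrow> real ^ 'n" where
  "chart_vec c v p = chart_deriv c p v (chart_map (chart_at M p))"

definition comps :: "('m, 'n) chart \<Rightarrow> 'm \<Rightarrow> real ^ 'n \<Rightarrow> real ^ 'n" where
  "comps c p u = dir_deriv M p u (chart_map c)"

text \<open>\<open>dir_deriv\<close> is total and arbitrary where no derivative exists, so
  differentiability at a point is tracked separately.\<close>

definition diff_at :: "'m \<Rightarrow> ('m \<Rightarrow> 'b::real_normed_vector) \<Rightarrow> bool" where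
  "diff_at p F \<longleftrightarrow> (F \<circ> chart_inv (chart_at M p)) differentiable (at (chart_map (chart_at M p) p))"

lemma dir_deriv_chart_at: "dir_deriv M p v F = chart_deriv (chart_at M p) p v F"
  by (simp add: dir_deriv_def chart_deriv_def)

text \<open>Near the point, \<open>F \<circ> chart_inv c\<close> is
  \<open>F \<circ> chart_inv e\<close> after the transition map, so this is the chain rule. It is
  the source of all conversions between charts below.\<close>

lemma transition_has_derivative:
  assumes c: "c \<in> atlas M" "p \<in> chart_dom c" and e: "e \<in> atlas M" "p \<in> chart_dom e"
    and F: "(F \<circ> chart_inv e has_derivative D) (at (chart_map e p))"
  shows "(F \<circ> chart_inv c has_derivative (\<lambda>v. D (chart_deriv c p v (chart_map e)))) (at (chart_map c p))"
proof -
  let ?O = "chart_map c ` (chart_dom c \<inter> chart_dom e)"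
  have O: "open ?O" "chart_map c p \<in> ?O"
    using chart_image_Int_open[OF c(1) chart_open[OF e(1)]] c e by auto
  have inv: "\<And>q. q \<in> chart_dom e \<Longrightarrow> chart_inv e (chart_map e q) = q"
    "\<And>q. q \<in> chart_dom c \<Longrightarrow> chart_inv c (chart_map c q) = q"
    using chart_inv_map e c by auto
  have "smooth_on ?O (chart_map e \<circ> chart_inv c)"
    using smooth_transition[OF c(1) e(1)] by (simp add: smooth_transition_def)
  from smooth_on_has_derivative[OF this O(2)]
  have "(chart_map e \<circ> chart_inv c has_derivative (\<lambda>v. chart_deriv c p v (chart_map e))) (at (chart_map c p))"
    by (simp add: chart_deriv_def)
  from diff_chain_at[OF this, of "F \<circ> chart_inv e" D] F
  have "((F \<circ> chart_inv e) \<circ> (chart_map e \<circ> chart_inv c) has_derivative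
      (\<lambda>v. D (chart_deriv c p v (chart_map e)))) (at (chart_map c p))"
    by (simp add: inv c(2) o_def)
  then show ?thesis
    by (rule has_derivative_cong_open[OF O, THEN iffD1, rotated]) (auto simp: inv)
qed

lemma diff_at_chart:
  assumes c: "c \<in> atlas M" "p \<in> chart_dom c"
  shows "diff_at p F \<longleftrightarrow> (F \<circ> chart_inv c) differentiable (at (chart_map c p))"
  using transition_has_derivative[OF c chart_at[OF chart_dom_points[OF c]]]
    transition_has_derivative[OF chart_at[OF chart_dom_points[OF c]] c]
  unfolding diff_at_def differentiable_def by metis

lemma diff_at_has_derivative:
  assumes "c \<in> atlas M" "p \<in> chart_dom c" "diff_at p F"
  shows "(F \<circ> chart_inv c has_derivative (\<lambda>v. chart_deriv c p v F)) (at (chart_map c p))"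
  using assms by (simp add: diff_at_chart chart_deriv_def frechet_derivative_works)

lemma smooth_fun_diff_at: "smooth_fun M U F \<Longrightarrow> p \<in> U \<Longrightarrow> diff_at p F"
  unfolding diff_at_def using chart_at[of p] smooth_funD smooth_fun_open[of U F] openin_subset
  by (intro smooth_on_differentiable[of "chart_map (chart_at M p) ` (chart_dom (chart_at M p) \<inter> U)"]) blast+

lemma chart_deriv_trans:
  assumes c: "c \<in> atlas M" "p \<in> chart_dom c" and e: "e \<in> atlas M" "p \<in> chart_dom e" and F: "diff_at p F"
  shows "chart_deriv e p (chart_deriv c p v (chart_map e)) F = chart_deriv c p v F"
  using transition_has_derivative[OF c e diff_at_has_derivative[OF e F]] diff_at_has_derivative[OF c F]
    has_derivative_unique by metis

lemma chart_deriv_chart: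
  assumes c: "c \<in> atlas M" "p \<in> chart_dom c"
  shows "chart_deriv c p v (chart_map c) = v"
proof -
  have "((\<lambda>x. x) has_derivative (\<lambda>v. v)) (at (chart_map c p))" by (rule has_derivative_ident)
  then have "(chart_map c \<circ> chart_inv c has_derivative (\<lambda>v. v)) (at (chart_map c p))"
    by (rule has_derivative_cong_open[THEN iffD1, rotated -1, OF _ chart_image_open[OF c(1)]])
      (use c in \<open>auto simp: chart_inv_map[OF c(1)]\<close>)
  then show ?thesis by (metis chart_deriv_def frechet_derivative_at)
qed

lemma diff_at_chart_map: "c \<in> atlas M \<Longrightarrow> p \<in> chart_dom c \<Longrightarrow> diff_at p (chart_map c)"
  using smooth_fun_diff_at smooth_fun_chart by blast

context
  fixes c p
  assumes c: "c \<in> atlas M" and p: "p \<in> chart_dom c"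
begin

lemmas cat = chart_at[OF chart_dom_points[OF c p]]

lemma dir_deriv_chart_vec: "diff_at p F \<Longrightarrow> dir_deriv M p (chart_vec c v p) F = chart_deriv c p v F"
  using chart_deriv_trans[OF c p cat] by (simp add: dir_deriv_chart_at chart_vec_def)

lemma dir_deriv_comps: "diff_at p F \<Longrightarrow> dir_deriv M p u F = chart_deriv c p (comps c p u) F"
  unfolding dir_deriv_chart_at comps_def by (rule chart_deriv_trans[OF cat c p, symmetric])

lemma comps_chart_vec: "comps c p (chart_vec c v p) = v"
  using dir_deriv_chart_vec[OF diff_at_chart_map[OF c p]] chart_deriv_chart[OF c p] by (simp add: comps_def)

lemma chart_vec_comps: "chart_vec c (comps c p u) p = u"
  using dir_deriv_comps[OF diff_at_chart_map[OF cat], of u] chart_deriv_chart[OF cat]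
  by (simp add: chart_vec_def dir_deriv_chart_at)

lemma linear_chart_deriv: "diff_at p F \<Longrightarrow> linear (\<lambda>v. chart_deriv c p v F)"
  using diff_at_has_derivative[OF c p] has_derivative_linear by blast

lemma linear_chart_vec: "linear (\<lambda>v. chart_vec c v p)"
proof -
  have "diff_at p (chart_map (chart_at M p))" using diff_at_chart_map[OF cat] .
  then show ?thesis unfolding chart_vec_def by (rule linear_chart_deriv)
qed

end

context
  fixes p
  assumes p: "p \<in> points M"
begin

lemma linear_dir_deriv: "diff_at p F \<Longrightarrow> linear (\<lambda>u. dir_deriv M p u F)"
  using linear_chart_deriv[OF chart_at[OF p]] by (simp add: dir_deriv_chart_at)

lemma dir_deriv_eqI:
  "(F \<circ> chart_inv (chart_at M p) has_derivative D) (at (chart_map (chart_at M p) p)) \<Longrightarrow> dir_deriv M p u F = D u"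
  by (metis dir_deriv_def frechet_derivative_at)

lemma dir_deriv_works:
  "diff_at p F \<Longrightarrow> ((\<lambda>x. F (chart_inv (chart_at M p) x)) has_derivative (\<lambda>u. dir_deriv M p u F)) (at (chart_map (chart_at M p) p))"
  using diff_at_has_derivative[OF chart_at[OF p]] by (simp add: dir_deriv_chart_at o_def)

lemma dir_deriv_cong:
  assumes "openin (mtop M) V" "p \<in> V" "\<And>q. q \<in> V \<Longrightarrow> F q = G q"
  shows "dir_deriv M p u F = dir_deriv M p u G"
proof -
  let ?c = "chart_at M p"
  note c = chart_at[OF p]
  have "frechet_derivative (F \<circ> chart_inv ?c) (at (chart_map ?c p)) =
    frechet_derivative (G \<circ> chart_inv ?c) (at (chart_map ?c p))"
    by (rule frechet_derivative_cong_open[OF chart_image_Int_open[OF c(1) assms(1)]])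
      (use assms c chart_inv_map[OF c(1)] in auto)
  then show ?thesis by (simp add: dir_deriv_def)
qed

lemma dir_deriv_const: "dir_deriv M p u (\<lambda>q. a) = 0"
  by (rule dir_deriv_eqI) (simp add: o_def)

lemma dir_deriv_sum:
  "(\<And>i. i \<in> I \<Longrightarrow> diff_at p (F i)) \<Longrightarrow> dir_deriv M p u (\<lambda>q. \<Sum>i\<in>I. F i q) = (\<Sum>i\<in>I. dir_deriv M p u (F i))"
  by (rule dir_deriv_eqI) (auto simp: o_def intro!: derivative_eq_intros dir_deriv_works)

lemma dir_deriv_mult:
  fixes F G :: "'m \<Rightarrow> real"
  shows "diff_at p F \<Longrightarrow> diff_at p G \<Longrightarrow>
    dir_deriv M p u (\<lambda>q. F q * G q) = dir_deriv M p u F * G p + F p * dir_deriv M p u G"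
  by (rule dir_deriv_eqI)
    (auto simp: o_def chart_inv_map chart_at[OF p] intro!: derivative_eq_intros dir_deriv_works)

lemma dir_deriv_bounded_linear:
  "bounded_linear L \<Longrightarrow> diff_at p F \<Longrightarrow> dir_deriv M p u (\<lambda>q. L (F q)) = L (dir_deriv M p u F)"
  by (rule dir_deriv_eqI) (auto simp: o_def intro: bounded_linear.has_derivative dir_deriv_works)

end

lemma linear_comps: "c \<in> atlas M \<Longrightarrow> p \<in> chart_dom c \<Longrightarrow> linear (comps c p)"
  unfolding comps_def[abs_def] using linear_dir_deriv chart_dom_points diff_at_chart_map by blast

lemma comps_inject:
  assumes "c \<in> atlas M" "p \<in> chart_dom c" "comps c p u = comps c p v"
  shows "u = v"
  using assms chart_vec_comps by metis

lemma linear_expand: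
  fixes f :: "real ^ 'n \<Rightarrow> 'b::real_vector"
  assumes "linear f"
  shows "f v = (\<Sum>i\<in>UNIV. v $ i *\<^sub>R f (axis i 1))"
proof -
  have "f v = f (\<Sum>i\<in>UNIV. v $ i *\<^sub>R axis i 1)"
    using basis_expansion[of v] by (simp add: scalar_mult_eq_scaleR)
  then show ?thesis by (simp only: linear_sum[OF assms] linear_scale[OF assms])
qed

lemma tangent_expand:
  assumes "c \<in> atlas M" "p \<in> chart_dom c"
  shows "u = (\<Sum>i\<in>UNIV. comps c p u $ i *\<^sub>R chart_vec c (axis i 1) p)"
  using linear_expand[OF linear_chart_vec[OF assms], of "comps c p u"] chart_vec_comps[OF assms] by simp

end


section \<open>Sections along a smooth map\<close>

locale smooth_mfd_map = M: smooth_mfd M + N: smooth_mfd N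
  for M :: "('m, 'n::finite) manifold" and N :: "('q, 'k::finite) manifold" +
  fixes \<phi> :: "'m \<Rightarrow> 'q"
  assumes smooth_map: "smooth_map M N \<phi>"
begin

lemma map_points: "p \<in> points M \<Longrightarrow> \<phi> p \<in> points N"
  using smooth_map by (auto simp: smooth_map_def continuous_map_def)

lemma vimage_open: "openin (mtop N) W \<Longrightarrow> openin (mtop M) {p \<in> points M. \<phi> p \<in> W}"
  using smooth_map by (auto simp: smooth_map_def intro: openin_continuous_map_preimage)

lemma vimage_Int_open:
  assumes "openin (mtop M) U" "openin (mtop N) W"
  shows "openin (mtop M) {p \<in> U. \<phi> p \<in> W}"
proof -
  have "{p \<in> U. \<phi> p \<in> W} = U \<inter> {p \<in> points M. \<phi> p \<in> W}"
    using openin_subset[OF assms(1)] by auto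
  then show ?thesis using openin_Int[OF assms(1) vimage_open[OF assms(2)]] by simp
qed

lemma smooth_fun_chart_map:
  "d \<in> atlas N \<Longrightarrow> smooth_fun M {p \<in> points M. \<phi> p \<in> chart_dom d} (\<lambda>p. chart_map d (\<phi> p))"
  using smooth_map by (simp add: smooth_map_def o_def)

lemma smooth_fun_pullback:
  assumes F: "smooth_fun N W F"
  shows "smooth_fun M {p \<in> points M. \<phi> p \<in> W} (\<lambda>p. F (\<phi> p))"
proof (rule M.smooth_fun_local[OF vimage_open[OF N.smooth_fun_open[OF F]]])
  fix p assume "p \<in> {p \<in> points M. \<phi> p \<in> W}"
  then have p: "p \<in> points M" "\<phi> p \<in> W" by auto
  note d = N.chart_at[OF map_points[OF p(1)]]
  let ?d = "chart_at N (\<phi> p)"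
  let ?V = "{q \<in> points M. \<phi> q \<in> chart_dom ?d \<inter> W}"
  have V: "openin (mtop M) ?V"
    using vimage_open openin_Int N.chart_open[OF d(1)] N.smooth_fun_open[OF F] by blast
  have "smooth_fun M ?V (\<lambda>q. chart_map ?d (\<phi> q))"
    by (rule M.smooth_fun_subset[OF smooth_fun_chart_map[OF d(1)] V]) auto
  then have "smooth_fun M ?V (\<lambda>q. (F \<circ> chart_inv ?d) (chart_map ?d (\<phi> q)))"
    by (rule M.smooth_fun_compose[OF _ N.smooth_funD[OF F d(1)]
          N.chart_image_Int_open[OF d(1) N.smooth_fun_open[OF F]]]) auto
  then have "smooth_fun M ?V (\<lambda>p. F (\<phi> p))"
    by (rule M.smooth_fun_cong) (auto simp: N.chart_inv_map[OF d(1)])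
  moreover have "p \<in> ?V" using p d by auto
  ultimately show "\<exists>V. p \<in> V \<and> smooth_fun M V (\<lambda>p. F (\<phi> p))" by (intro exI conjI)
qed

lemma diff_at_pullback:
  assumes p: "p \<in> points M" and F: "N.diff_at (\<phi> p) F"
  shows "M.diff_at p (\<lambda>q. F (\<phi> q))"
    and dir_deriv_pullback: "dir_deriv M p v (\<lambda>q. F (\<phi> q)) = dir_deriv N (\<phi> p) (differential M N \<phi> p v) F"
proof -
  note c = M.chart_at[OF p] and d = N.chart_at[OF map_points[OF p]]
  let ?c = "chart_at M p" and ?d = "chart_at N (\<phi> p)"
  let ?V = "{q \<in> points M. \<phi> q \<in> chart_dom ?d}"
  have V: "openin (mtop M) ?V" by (rule vimage_open[OF N.chart_open[OF d(1)]])
  have inv: "chart_inv ?c (chart_map ?c p) = p" using M.chart_inv_map c .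
  have "M.diff_at p (chart_map ?d \<circ> \<phi>)"
    using M.smooth_fun_diff_at[OF smooth_fun_chart_map[OF d(1)], of p] p d by (simp add: o_def)
  from M.dir_deriv_works[OF p this]
  have "((\<lambda>x. chart_map ?d (\<phi> (chart_inv ?c x))) has_derivative (\<lambda>v. differential M N \<phi> p v)) (at (chart_map ?c p))"
    by (simp add: differential_def o_def)
  from has_derivative_compose[OF this, of "F \<circ> chart_inv ?d" "\<lambda>v. dir_deriv N (\<phi> p) v F"]
    N.dir_deriv_works[OF map_points[OF p] F]
  have "((\<lambda>x. (F \<circ> chart_inv ?d) (chart_map ?d (\<phi> (chart_inv ?c x)))) has_derivative
      (\<lambda>v. dir_deriv N (\<phi> p) (differential M N \<phi> p v) F)) (at (chart_map ?c p))"
    by (simp add: o_def inv)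
  then have der: "((\<lambda>q. F (\<phi> q)) \<circ> chart_inv ?c has_derivative
      (\<lambda>v. dir_deriv N (\<phi> p) (differential M N \<phi> p v) F)) (at (chart_map ?c p))"
    by (rule has_derivative_cong_open[OF M.chart_image_Int_open[OF c(1) V], THEN iffD1, rotated 2])
      (use c d p in \<open>auto simp: M.chart_inv_map[OF c(1)] N.chart_inv_map[OF d(1)]\<close>)
  then show "M.diff_at p (\<lambda>q. F (\<phi> q))"
    by (auto simp: M.diff_at_def differentiable_def)
  show "dir_deriv M p v (\<lambda>q. F (\<phi> q)) = dir_deriv N (\<phi> p) (differential M N \<phi> p v) F"
    by (rule M.dir_deriv_eqI[OF p der])
qed

lemma linear_differential: "p \<in> points M \<Longrightarrow> linear (differential M N \<phi> p)"
  unfolding differential_def[abs_def] o_def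
  by (intro M.linear_dir_deriv diff_at_pullback(1) N.diff_at_chart_map[OF N.chart_at] map_points)

lemma comps_differential:
  assumes "p \<in> points M" "d \<in> atlas N" "\<phi> p \<in> chart_dom d"
  shows "N.comps d (\<phi> p) (differential M N \<phi> p v) = dir_deriv M p v (\<lambda>q. chart_map d (\<phi> q))"
  using dir_deriv_pullback[OF assms(1) N.diff_at_chart_map[OF assms(2,3)]] by (simp add: N.comps_def)

lemma section_open: "smooth_section M N \<phi> U V \<Longrightarrow> openin (mtop M) U"
  and section_comps: "smooth_section M N \<phi> U V \<Longrightarrow> d \<in> atlas N \<Longrightarrow>
    smooth_fun M {p \<in> U. \<phi> p \<in> chart_dom d} (\<lambda>p. N.comps d (\<phi> p) (V p))"
  by (auto simp: smooth_section_def N.comps_def)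

lemma sectionI:
  assumes "openin (mtop M) U"
    "\<And>d. d \<in> atlas N \<Longrightarrow> smooth_fun M {p \<in> U. \<phi> p \<in> chart_dom d} (\<lambda>p. N.comps d (\<phi> p) (V p))"
  shows "smooth_section M N \<phi> U V"
  using assms by (auto simp: smooth_section_def N.comps_def)

lemma section_subset:
  assumes "smooth_section M N \<phi> U V" "openin (mtop M) U'" "U' \<subseteq> U"
  shows "smooth_section M N \<phi> U' V"
  using assms by (intro sectionI M.smooth_fun_subset[OF section_comps[OF assms(1)]] vimage_Int_open N.chart_open) auto

lemma section_local:
  assumes U: "openin (mtop M) U" and "\<And>p. p \<in> U \<Longrightarrow> \<exists>W. p \<in> W \<and> smooth_section M N \<phi> W V"
  shows "smooth_section M N \<phi> U V"
proof (rule sectionI[OF U])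
  fix d assume d: "d \<in> atlas N"
  show "smooth_fun M {p \<in> U. \<phi> p \<in> chart_dom d} (\<lambda>p. N.comps d (\<phi> p) (V p))"
  proof (rule M.smooth_fun_local[OF vimage_Int_open[OF U N.chart_open[OF d]]])
    fix p assume p: "p \<in> {p \<in> U. \<phi> p \<in> chart_dom d}"
    then obtain W where W: "p \<in> W" "smooth_section M N \<phi> W V" using assms(2) by auto
    have "p \<in> {p \<in> W. \<phi> p \<in> chart_dom d}" using p W by auto
    with section_comps[OF W(2) d] show "\<exists>V'. p \<in> V' \<and> smooth_fun M V' (\<lambda>p. N.comps d (\<phi> p) (V p))"
      by (intro exI conjI)
  qed
qed

lemma section_cong:
  assumes "smooth_section M N \<phi> U V" "\<And>p. p \<in> U \<Longrightarrow> V p = W p"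
  shows "smooth_section M N \<phi> U W"
  by (rule sectionI[OF section_open[OF assms(1)]])
    (auto intro: M.smooth_fun_cong[OF section_comps[OF assms(1)]] simp: assms(2))

lemma section_points: "smooth_section M N \<phi> U V \<Longrightarrow> p \<in> U \<Longrightarrow> p \<in> points M"
  using section_open openin_subset by blast

lemma section_add:
  assumes "smooth_section M N \<phi> U V" "smooth_section M N \<phi> U W"
  shows "smooth_section M N \<phi> U (\<lambda>p. V p + W p)"
proof (rule sectionI[OF section_open[OF assms(1)]])
  fix d assume d: "d \<in> atlas N"
  show "smooth_fun M {p \<in> U. \<phi> p \<in> chart_dom d} (\<lambda>p. N.comps d (\<phi> p) (V p + W p))"
    by (rule M.smooth_fun_cong[OF M.smooth_fun_add[OF section_comps[OF assms(1) d] section_comps[OF assms(2) d]]])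
      (auto simp: linear_add[OF N.linear_comps[OF d]])
qed

lemma section_scaleR:
  assumes "smooth_fun M U F" "smooth_section M N \<phi> U V"
  shows "smooth_section M N \<phi> U (\<lambda>p. F p *\<^sub>R V p)"
proof (rule sectionI[OF section_open[OF assms(2)]])
  fix d assume d: "d \<in> atlas N"
  have "smooth_fun M {p \<in> U. \<phi> p \<in> chart_dom d} F"
    by (rule M.smooth_fun_subset[OF assms(1) vimage_Int_open[OF section_open[OF assms(2)] N.chart_open[OF d]]]) auto
  from M.smooth_fun_scaleR[OF this section_comps[OF assms(2) d]]
  show "smooth_fun M {p \<in> U. \<phi> p \<in> chart_dom d} (\<lambda>p. N.comps d (\<phi> p) (F p *\<^sub>R V p))"
    by (rule M.smooth_fun_cong) (auto simp: linear_scale[OF N.linear_comps[OF d]])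
qed

lemma section_zero:
  assumes "openin (mtop M) U"
  shows "smooth_section M N \<phi> U (\<lambda>p. 0)"
proof (rule sectionI[OF assms])
  fix d assume d: "d \<in> atlas N"
  have "smooth_fun M {p \<in> U. \<phi> p \<in> chart_dom d} (\<lambda>p. 0 :: real ^ 'k)"
    by (intro M.smooth_fun_const vimage_Int_open assms N.chart_open d)
  then show "smooth_fun M {p \<in> U. \<phi> p \<in> chart_dom d} (\<lambda>p. N.comps d (\<phi> p) 0)"
    by (rule M.smooth_fun_cong) (auto simp: linear_0[OF N.linear_comps[OF d]])
qed

lemma section_sum:
  assumes "openin (mtop M) U" "\<And>i. i \<in> I \<Longrightarrow> smooth_section M N \<phi> U (V i)"
  shows "smooth_section M N \<phi> U (\<lambda>p. \<Sum>i\<in>I. V i p)"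
  using assms(2)
  by (induction I rule: infinite_finite_induct) (auto intro: section_zero section_add assms(1))

text \<open>When \<open>\<phi>\<close> maps \<open>U\<close> into one chart \<open>d\<close>, the
  components in \<open>d\<close> decide. Those in another chart \<open>e\<close> arise by applying
  the Jacobian of the transition map, whose columns \<open>?G j\<close> are smooth functions of the
  coordinates of \<open>\<phi> p\<close>.\<close>

lemma section_chartI:
  assumes U: "openin (mtop M) U" and d: "d \<in> atlas N" "\<And>p. p \<in> U \<Longrightarrow> \<phi> p \<in> chart_dom d"
    and V: "smooth_fun M U (\<lambda>p. N.comps d (\<phi> p) (V p))"
  shows "smooth_section M N \<phi> U V"
proof (rule sectionI[OF U])
  fix e assume e: "e \<in> atlas N"
  let ?U = "{p \<in> U. \<phi> p \<in> chart_dom e}"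
  let ?G = "\<lambda>j y. frechet_derivative (chart_map e \<circ> chart_inv d) (at y) (axis j 1)"
  have opn: "openin (mtop M) ?U" by (rule vimage_Int_open[OF U N.chart_open[OF e]])
  have pts: "p \<in> points M" if "p \<in> U" for p using U that openin_subset by blast
  have G: "smooth_on (chart_map d ` (chart_dom d \<inter> chart_dom e)) (?G j)" for j
    using N.smooth_transition[OF d(1) e] by (auto simp: smooth_transition_def intro: smooth_on_frechet_derivative)
  have "smooth_fun M ?U (\<lambda>p. chart_map d (\<phi> p))"
    by (rule M.smooth_fun_subset[OF smooth_fun_chart_map[OF d(1)] opn]) (auto simp: d pts)
  then have "smooth_fun M ?U (\<lambda>p. ?G j (chart_map d (\<phi> p)))" for j
    by (rule M.smooth_fun_compose[OF _ G N.chart_image_Int_open[OF d(1) N.chart_open[OF e]]]) (auto simp: d)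
  then have "smooth_fun M ?U (\<lambda>p. \<Sum>j\<in>UNIV. N.comps d (\<phi> p) (V p) $ j *\<^sub>R ?G j (chart_map d (\<phi> p)))"
    by (intro M.smooth_fun_sum M.smooth_fun_scaleR opn M.smooth_fun_nth M.smooth_fun_subset[OF V opn]) auto
  then show "smooth_fun M ?U (\<lambda>p. N.comps e (\<phi> p) (V p))"
  proof (rule M.smooth_fun_cong)
    fix p assume p: "p \<in> ?U"
    then have dp: "\<phi> p \<in> chart_dom d" and ep: "\<phi> p \<in> chart_dom e" using d by auto
    have diff: "N.diff_at (\<phi> p) (chart_map e)" by (rule N.diff_at_chart_map[OF e ep])
    have "N.comps e (\<phi> p) (V p) = N.chart_deriv d (\<phi> p) (N.comps d (\<phi> p) (V p)) (chart_map e)"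
      unfolding N.comps_def[of e] by (rule N.dir_deriv_comps[OF d(1) dp diff])
    also have "\<dots> = (\<Sum>j\<in>UNIV. N.comps d (\<phi> p) (V p) $ j *\<^sub>R N.chart_deriv d (\<phi> p) (axis j 1) (chart_map e))"
      by (rule N.linear_expand[OF N.linear_chart_deriv[OF d(1) dp diff]])
    finally show "(\<Sum>j\<in>UNIV. N.comps d (\<phi> p) (V p) $ j *\<^sub>R ?G j (chart_map d (\<phi> p))) = N.comps e (\<phi> p) (V p)"
      by (simp add: N.chart_deriv_def)
  qed
qed

lemma section_expand:
  assumes "smooth_section M N \<phi> U V" "d \<in> atlas N" "\<And>p. p \<in> U \<Longrightarrow> \<phi> p \<in> chart_dom d"
  shows "smooth_fun M U (\<lambda>p. N.comps d (\<phi> p) (V p) $ j)"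
    and "p \<in> U \<Longrightarrow> V p = (\<Sum>j\<in>UNIV. N.comps d (\<phi> p) (V p) $ j *\<^sub>R N.chart_vec d (axis j 1) (\<phi> p))"
proof -
  have "{p \<in> U. \<phi> p \<in> chart_dom d} = U" using assms(3) by auto
  then show "smooth_fun M U (\<lambda>p. N.comps d (\<phi> p) (V p) $ j)"
    using M.smooth_fun_nth[OF section_comps[OF assms(1,2)]] by simp
  show "V p = (\<Sum>j\<in>UNIV. N.comps d (\<phi> p) (V p) $ j *\<^sub>R N.chart_vec d (axis j 1) (\<phi> p))" if "p \<in> U"
    by (rule N.tangent_expand[OF assms(2) assms(3)[OF that]])
qed

end

section \<open>Vector fields as sections along the identity\<close>

context smooth_mfd
begin

text \<open>Makes every result on sections along a map available for vector fields.\<close>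

lemma map_id: "smooth_mfd_map M M id"
proof
  show "smooth_map M M id"
    unfolding smooth_map_def
  proof (intro conjI ballI)
    fix d assume d: "d \<in> atlas M"
    then have "{p \<in> points M. id p \<in> chart_dom d} = chart_dom d"
      using chart_dom_points[OF d] by auto
    then show "smooth_fun M {p \<in> points M. id p \<in> chart_dom d} (chart_map d \<circ> id)"
      using smooth_fun_chart[OF d] by simp
  qed simp
qed

lemmas field_open = smooth_mfd_map.section_open[OF map_id]
  and field_subset = smooth_mfd_map.section_subset[OF map_id]
  and field_local = smooth_mfd_map.section_local[OF map_id]
  and field_cong = smooth_mfd_map.section_cong[OF map_id]
  and field_points = smooth_mfd_map.section_points[OF map_id]
  and field_add = smooth_mfd_map.section_add[OF map_id]
  and field_scaleR = smooth_mfd_map.section_scaleR[OF map_id]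
  and field_zero = smooth_mfd_map.section_zero[OF map_id]
  and field_sum = smooth_mfd_map.section_sum[OF map_id]
  and field_chartI = smooth_mfd_map.section_chartI[OF map_id, simplified id_apply]

lemma field_comps:
  assumes "smooth_vector_field M U X" "c \<in> atlas M"
  shows "smooth_fun M (chart_dom c \<inter> U) (\<lambda>p. comps c p (X p))"
  using smooth_mfd_map.section_comps[OF map_id assms] by (simp add: Int_def conj_commute)

lemma chart_field:
  assumes "c \<in> atlas M"
  shows "smooth_vector_field M (chart_dom c) (chart_vec c v)"
proof (rule field_chartI[OF chart_open[OF assms] assms])
  have "smooth_fun M (chart_dom c) (\<lambda>p. v)" by (rule smooth_fun_const[OF chart_open[OF assms]])
  then show "smooth_fun M (chart_dom c) (\<lambda>p. comps c p (chart_vec c v p))"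
    by (rule smooth_fun_cong) (simp add: comps_chart_vec[OF assms])
qed simp

lemma smooth_fun_chart_deriv:
  assumes F: "smooth_fun M U F" and c: "c \<in> atlas M"
  shows "smooth_fun M (chart_dom c \<inter> U) (\<lambda>p. chart_deriv c p v F)"
proof -
  let ?O = "chart_map c ` (chart_dom c \<inter> U)"
  have U: "openin (mtop M) (chart_dom c \<inter> U)"
    using openin_Int chart_open[OF c] smooth_fun_open[OF F] by blast
  have "smooth_on ?O (\<lambda>x. frechet_derivative (F \<circ> chart_inv c) (at x) v)"
    by (rule smooth_on_frechet_derivative[OF smooth_funD[OF F c]])
  from smooth_fun_compose[OF smooth_fun_subset[OF smooth_fun_chart[OF c] U Int_lower1] this]
  have "smooth_fun M (chart_dom c \<inter> U) (\<lambda>p. frechet_derivative (F \<circ> chart_inv c) (at (chart_map c p)) v)"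
    by (auto simp: chart_image_Int_open[OF c smooth_fun_open[OF F]])
  then show ?thesis by (simp add: chart_deriv_def)
qed

lemma smooth_fun_dir_deriv:
  assumes F: "smooth_fun M U F" and X: "smooth_vector_field M U X"
  shows "smooth_fun M U (\<lambda>p. dir_deriv M p (X p) F)"
proof (rule smooth_fun_local[OF field_open[OF X]])
  fix p assume p: "p \<in> U"
  note c = chart_at[OF field_points[OF X p]]
  let ?c = "chart_at M p"
  have U: "openin (mtop M) (chart_dom ?c \<inter> U)"
    using openin_Int chart_open[OF c(1)] smooth_fun_open[OF F] by blast
  have "smooth_fun M (chart_dom ?c \<inter> U) (\<lambda>q. \<Sum>i\<in>UNIV. comps ?c q (X q) $ i *\<^sub>R chart_deriv ?c q (axis i 1) F)"
    by (intro smooth_fun_sum U smooth_fun_scaleR smooth_fun_nth field_comps X smooth_fun_chart_deriv F c)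
  then have "smooth_fun M (chart_dom ?c \<inter> U) (\<lambda>p. dir_deriv M p (X p) F)"
  proof (rule smooth_fun_cong)
    fix q assume q: "q \<in> chart_dom ?c \<inter> U"
    then have qc: "q \<in> chart_dom ?c" and d: "diff_at q F" using smooth_fun_diff_at[OF F] by auto
    show "(\<Sum>i\<in>UNIV. comps ?c q (X q) $ i *\<^sub>R chart_deriv ?c q (axis i 1) F) = dir_deriv M q (X q) F"
      unfolding dir_deriv_comps[OF c(1) qc d]
      by (rule linear_expand[OF linear_chart_deriv[OF c(1) qc d], symmetric])
  qed
  moreover have "p \<in> chart_dom ?c \<inter> U" using p c by auto
  ultimately show "\<exists>V. p \<in> V \<and> smooth_fun M V (\<lambda>p. dir_deriv M p (X p) F)" by (intro exI conjI)
qed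

text \<open>Tensorial identities are only assumed for globally defined fields.\<close>

lemma global_field:
  assumes "p \<in> points M"
  obtains X a where "smooth_vector_field M (points M) X" "X p = a *\<^sub>R u" "a > (0 :: real)"
proof -
  note c = chart_at[OF assms]
  let ?c = "chart_at M p"
  obtain \<beta> :: "'m \<Rightarrow> real" and K where \<beta>: "smooth_fun M (points M) \<beta>" "\<And>q. \<beta> q \<ge> 0" "\<beta> p > 0"
    and K: "compact K" "K \<subseteq> chart_map ?c ` chart_dom ?c"
    "\<And>q. \<not> (q \<in> chart_dom ?c \<and> chart_map ?c q \<in> K) \<Longrightarrow> \<beta> q = 0"
    using smooth_bump[OF c] by blast
  let ?C = "{q \<in> chart_dom ?c. chart_map ?c q \<in> K}"
  \<comment> \<open>A cut-off coordinate field, equal to \<open>\<beta> p *\<^sub>R u\<close> at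
    \<open>p\<close>. The bump is not normalised: in homogeneous identities the positive factor
    cancels.\<close>
  let ?X = "\<lambda>q. \<beta> q *\<^sub>R chart_vec ?c (comps ?c p u) q"
  have "smooth_vector_field M (points M) ?X"
  proof (rule field_local[OF openin_topspace])
    fix q assume q: "q \<in> points M"
    show "\<exists>W. q \<in> W \<and> smooth_vector_field M W ?X"
    proof (cases "q \<in> chart_dom ?c")
      case True
      have "smooth_vector_field M (chart_dom ?c) ?X"
        by (intro field_scaleR chart_field c smooth_fun_subset[OF \<beta>(1)] chart_open)
          (use chart_dom_points[OF c(1)] in auto)
      with True show ?thesis by (intro exI conjI)
    next
      case False
      have "smooth_vector_field M (points M - ?C) (\<lambda>q. 0)"
        by (intro field_zero openin_diff openin_topspace chart_compact_closed[OF c(1) K(1,2)])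
      then have "smooth_vector_field M (points M - ?C) ?X"
        by (rule field_cong) (simp add: K(3))
      moreover have "q \<in> points M - ?C" using False q by auto
      ultimately show ?thesis by (intro exI conjI)
    qed
  qed
  then show ?thesis
    using that[of ?X "\<beta> p"] \<beta>(3) chart_vec_comps[OF c] by simp
qed

end

context smooth_mfd_map
begin

lemma section_pullback:
  assumes Y: "smooth_vector_field N W Y"
  shows "smooth_section M N \<phi> {p \<in> points M. \<phi> p \<in> W} (\<lambda>p. Y (\<phi> p))"
proof (rule sectionI[OF vimage_open[OF N.field_open[OF Y]]])
  fix d assume d: "d \<in> atlas N"
  show "smooth_fun M {p \<in> {p \<in> points M. \<phi> p \<in> W}. \<phi> p \<in> chart_dom d} (\<lambda>p. N.comps d (\<phi> p) (Y (\<phi> p)))"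
    using smooth_fun_pullback[OF N.field_comps[OF Y d]] by (simp add: Int_def conj_ac)
qed

lemma section_differential:
  assumes X: "smooth_vector_field M U X"
  shows "smooth_section M N \<phi> U (\<lambda>p. differential M N \<phi> p (X p))"
proof (rule sectionI[OF M.field_open[OF X]])
  fix d assume d: "d \<in> atlas N"
  let ?U = "{p \<in> U. \<phi> p \<in> chart_dom d}"
  have U: "openin (mtop M) ?U" by (rule vimage_Int_open[OF M.field_open[OF X] N.chart_open[OF d]])
  have "smooth_fun M ?U (\<lambda>p. chart_map d (\<phi> p))"
    by (rule M.smooth_fun_subset[OF smooth_fun_chart_map[OF d] U]) (use M.field_points[OF X] in auto)
  moreover have "smooth_vector_field M ?U X"
    by (rule M.field_subset[OF X U]) auto
  ultimately have "smooth_fun M ?U (\<lambda>p. dir_deriv M p (X p) (\<lambda>q. chart_map d (\<phi> q)))"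
    by (rule M.smooth_fun_dir_deriv)
  then show "smooth_fun M ?U (\<lambda>p. N.comps d (\<phi> p) (differential M N \<phi> p (X p)))"
    by (rule M.smooth_fun_cong) (use M.field_points[OF X] comps_differential d in auto)
qed

end


section \<open>Riemannian metrics in coordinates\<close>

text \<open>The functionals \<open>l i\<close> are coefficients with respect to \<open>b\<close>;
  expanding unit vectors in \<open>b\<close> and images in unit vectors yields the same double sum.
  Applied to orthonormal frames and to coordinate frames, it links the two expressions for the
  divergence.\<close>

lemma trace_eq_sum_dual_basis:
  fixes L :: "real ^ 'n \<Rightarrow> real ^ 'n" and l :: "'i \<Rightarrow> real ^ 'n \<Rightarrow> real"
  assumes L: "linear L" and l: "\<And>i. i \<in> I \<Longrightarrow> linear (l i)"
    and expand: "\<And>v. v = (\<Sum>i\<in>I. l i v *\<^sub>R b i)"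
  shows "(\<Sum>i\<in>I. l i (L (b i))) = trace (matrix L)"
proof -
  have expand_axis: "u = (\<Sum>j\<in>UNIV. u $ j *\<^sub>R axis j 1)" for u :: "real ^ 'n"
    using basis_expansion[of u] by (simp add: scalar_mult_eq_scaleR)
  have "L (axis j 1) $ j = (\<Sum>i\<in>I. l i (axis j 1) * L (b i) $ j)" for j
  proof -
    have "L (axis j 1) = L (\<Sum>i\<in>I. l i (axis j 1) *\<^sub>R b i)" by (rule arg_cong[OF expand])
    also have "\<dots> = (\<Sum>i\<in>I. l i (axis j 1) *\<^sub>R L (b i))"
      by (simp add: linear_sum[OF L] linear_scale[OF L])
    finally show ?thesis by simp
  qed
  then have "trace (matrix L) = (\<Sum>j\<in>UNIV. \<Sum>i\<in>I. l i (axis j 1) * L (b i) $ j)"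
    by (simp add: trace_def matrix_def)
  also have "\<dots> = (\<Sum>i\<in>I. \<Sum>j\<in>UNIV. l i (axis j 1) * L (b i) $ j)"
    by (rule sum.swap)
  also have "\<dots> = (\<Sum>i\<in>I. l i (L (b i)))"
  proof (rule sum.cong[OF refl])
    fix i assume i: "i \<in> I"
    have "l i (L (b i)) = l i (\<Sum>j\<in>UNIV. L (b i) $ j *\<^sub>R axis j 1)" by (rule arg_cong[OF expand_axis])
    also have "\<dots> = (\<Sum>j\<in>UNIV. l i (axis j 1) * L (b i) $ j)"
      by (simp add: linear_sum[OF l[OF i]] linear_scale[OF l[OF i]] mult.commute)
    finally show "(\<Sum>j\<in>UNIV. l i (axis j 1) * L (b i) $ j) = l i (L (b i))" ..
  qed
  finally show ?thesis ..
qed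

lemma bounded_linear_axis: "bounded_linear (axis i :: 'b::euclidean_space \<Rightarrow> 'b ^ 'n)"
  unfolding linear_conv_bounded_linear[symmetric] by (rule linearI) (auto simp: axis_def vec_eq_iff)

context smooth_mfd
begin

lemma smooth_fun_vec:
  fixes F :: "'m \<Rightarrow> 'b::euclidean_space ^ 'i"
  assumes "\<And>i. smooth_fun M U (\<lambda>p. F p $ i)"
  shows "smooth_fun M U F"
proof (rule smooth_fun_cong)
  show "smooth_fun M U (\<lambda>p. \<Sum>i\<in>UNIV. axis i (F p $ i))"
    using smooth_fun_open[OF assms] by (intro smooth_fun_sum smooth_fun_bounded_linear[OF bounded_linear_axis] assms)
  show "(\<Sum>i\<in>UNIV. axis i (F p $ i)) = F p" for p
    by (auto simp: vec_eq_iff axis_def if_distrib cong: if_cong)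
qed

lemma dir_deriv_compose:
  assumes p: "p \<in> points M" and F: "diff_at p F" and g: "(g has_derivative D) (at (F p))"
  shows "diff_at p (\<lambda>q. g (F q))" and "dir_deriv M p u (\<lambda>q. g (F q)) = D (dir_deriv M p u F)"
proof -
  let ?c = "chart_at M p"
  have "F (chart_inv ?c (chart_map ?c p)) = F p" using chart_inv_map chart_at[OF p] by simp
  with has_derivative_compose[OF dir_deriv_works[OF p F], of g D] g
  have *: "((\<lambda>q. g (F q)) \<circ> chart_inv ?c has_derivative (\<lambda>u. D (dir_deriv M p u F))) (at (chart_map ?c p))"
    by (simp add: o_def)
  then show "diff_at p (\<lambda>q. g (F q))" by (auto simp: diff_at_def differentiable_def)
  show "dir_deriv M p u (\<lambda>q. g (F q)) = D (dir_deriv M p u F)" by (rule dir_deriv_eqI[OF p *])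
qed

end

section \<open>Orthonormal frames and the Riemannian density\<close>

locale riemannian = smooth_mfd M for M :: "('m, 'n::finite) manifold" +
  fixes g :: "('m, 'n) metric"
  assumes metric: "riemannian_metric M g"
begin

lemma metric_bilinear: "p \<in> points M \<Longrightarrow> bilinear (g p)"
  and metric_sym: "p \<in> points M \<Longrightarrow> g p u v = g p v u"
  and metric_pos: "p \<in> points M \<Longrightarrow> u \<noteq> 0 \<Longrightarrow> g p u u > 0"
  and metric_smooth: "smooth_vector_field M U X \<Longrightarrow> smooth_vector_field M U Y \<Longrightarrow>
    smooth_fun M U (\<lambda>p. g p (X p) (Y p))"
  using metric by (auto simp: riemannian_metric_def)

lemma metric_linear: "p \<in> points M \<Longrightarrow> linear (g p u)" "p \<in> points M \<Longrightarrow> linear (\<lambda>u. g p u v)"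
  using metric_bilinear by (auto simp: bilinear_def)

lemma metric_sum:
  assumes "p \<in> points M"
  shows metric_sum_left: "g p (\<Sum>i\<in>I. a i *\<^sub>R u i) v = (\<Sum>i\<in>I. a i * g p (u i) v)"
    and metric_sum_right: "g p v (\<Sum>i\<in>I. a i *\<^sub>R u i) = (\<Sum>i\<in>I. a i * g p v (u i))"
  by (simp_all add: linear_sum[OF metric_linear(2)[OF assms]] linear_scale[OF metric_linear(2)[OF assms]]
    linear_sum[OF metric_linear(1)[OF assms]] linear_scale[OF metric_linear(1)[OF assms]])

lemma metric_eqI:
  assumes p: "p \<in> points M" and eq: "\<And>w. g p u w = g p v w"
  shows "u = v"
proof -
  have "g p (u - v) (u - v) = 0"
    using linear_diff[OF metric_linear(2)[OF p]] eq by simp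
  then show ?thesis using metric_pos[OF p, of "u - v"] by force
qed

text \<open>Being \<open>g p\<close>-orthogonal to \<open>e i\<close> means being
  Euclidean-orthogonal to the vector \<open>?w i\<close> that represents the functional
  \<open>\<lambda>v. g p v (e i)\<close>; fewer than \<open>CARD('n)\<close> of these span a proper
  subspace.\<close>

lemma orthogonal_vector_exists:
  assumes p: "p \<in> points M" and S: "finite S" "card S < CARD('n)"
  obtains v where "v \<noteq> 0" "\<And>i. i \<in> S \<Longrightarrow> g p v (e i) = 0"
proof -
  let ?w = "\<lambda>i. \<chi> j. g p (axis j 1) (e i)"
  have "dim (?w ` S) \<le> card (?w ` S)" using S by (intro dim_le_card') auto
  also have "\<dots> \<le> card S" by (rule card_image_le[OF S(1)])
  finally have "dim (?w ` S) < DIM(real ^ 'n)" using S by simp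
  then obtain v where v: "v \<noteq> 0" "\<And>y. y \<in> span (?w ` S) \<Longrightarrow> orthogonal v y"
    using orthogonal_to_subspace_exists by blast
  have "g p v (e i) = 0" if i: "i \<in> S" for i
  proof -
    have "orthogonal v (?w i)" using v(2) i span_base by blast
    moreover have "g p v (e i) = (\<Sum>j\<in>UNIV. v $ j *\<^sub>R g p (axis j 1) (e i))"
      by (rule linear_expand[OF metric_linear(2)[OF p]])
    ultimately show ?thesis by (simp add: orthogonal_def inner_vec_def)
  qed
  with v(1) that show ?thesis by blast
qed

text \<open>Gram-Schmidt, where each new vector is only chosen orthogonal to the previous ones at the
  single point \<open>p\<close> and corrected nearby.\<close>

lemma partial_orthonormal_frame:
  fixes S :: "'n set"
  assumes p: "p \<in> points M"
  shows "\<exists>U e. openin (mtop M) U \<and> p \<in> U \<and> (\<forall>i\<in>S. smooth_vector_field M U (e i)) \<and>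
    (\<forall>q\<in>U. \<forall>i\<in>S. \<forall>j\<in>S. g q (e i q) (e j q) = (if i = j then 1 else 0))"
  using finite[of S]
proof (induction S)
  case empty
  show ?case using p by (auto intro!: exI[of _ "points M"])
next
  case (insert k S)
  then obtain U e where U: "openin (mtop M) U" "p \<in> U"
    and e: "\<And>i. i \<in> S \<Longrightarrow> smooth_vector_field M U (e i)"
      "\<And>q i j. q \<in> U \<Longrightarrow> i \<in> S \<Longrightarrow> j \<in> S \<Longrightarrow> g q (e i q) (e j q) = (if i = j then 1 else 0)"
    by blast
  have "card S < CARD('n)"
    using insert.hyps by (intro psubset_card_mono) auto
  then obtain v where v: "v \<noteq> 0" "\<And>i. i \<in> S \<Longrightarrow> g p v (e i p) = 0"
    using orthogonal_vector_exists[OF p insert.hyps(1), of "\<lambda>i. e i p"] by blast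
  note c = chart_at[OF p]
  let ?c = "chart_at M p"
  let ?U1 = "U \<inter> chart_dom ?c"
  have U1: "openin (mtop M) ?U1" using U chart_open[OF c(1)] by (simp add: openin_Int)
  define Y where "Y = chart_vec ?c (comps ?c p v)"
  \<comment> \<open>Projections onto the earlier frame fields are removed. At \<open>p\<close> they
    vanish by the choice of \<open>v\<close>, so \<open>X p = v\<close> is nonzero and
    \<open>X\<close> has positive length near \<open>p\<close>.\<close>
  define X where "X q = Y q + (\<Sum>i\<in>S. (- g q (Y q) (e i q)) *\<^sub>R e i q)" for q
  have Y: "smooth_vector_field M ?U1 Y"
    unfolding Y_def by (rule field_subset[OF chart_field[OF c(1)] U1]) auto
  have e1: "smooth_vector_field M ?U1 (e i)" if "i \<in> S" for i
    by (rule field_subset[OF e(1)[OF that] U1]) auto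
  have "smooth_fun M ?U1 (\<lambda>q. (-1) *\<^sub>R g q (Y q) (e i q))" if "i \<in> S" for i
    by (intro smooth_fun_scaleR smooth_fun_const U1 metric_smooth Y e1 that)
  then have X: "smooth_vector_field M ?U1 X"
    unfolding X_def[abs_def] by (intro field_add field_sum field_scaleR Y e1 U1) auto
  have "Y p = v" unfolding Y_def by (rule chart_vec_comps[OF c])
  then have Xp: "X p = v" using v by (simp add: X_def)
  define s where "s q = g q (X q) (X q)" for q
  have s: "smooth_fun M ?U1 s" unfolding s_def[abs_def] by (rule metric_smooth[OF X X])
  let ?U2 = "{q \<in> ?U1. s q \<in> {0<..}}"
  have U2: "openin (mtop M) ?U2" by (rule smooth_fun_vimage_open[OF s]) simp
  have pts: "q \<in> points M" if "q \<in> ?U1" for q using U1 that openin_subset by blast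
  have "smooth_fun M ?U2 (\<lambda>q. inverse (sqrt (s q)))"
    by (rule smooth_fun_compose[OF smooth_fun_subset[OF s U2] smooth_on_inverse_sqrt]) auto
  then have ek: "smooth_vector_field M ?U2 (\<lambda>q. inverse (sqrt (s q)) *\<^sub>R X q)" (is "smooth_vector_field M _ ?ek")
    by (rule field_scaleR) (rule field_subset[OF X U2], auto)
  have orth: "g q (X q) (e j q) = 0" if q: "q \<in> ?U1" and j: "j \<in> S" for q j
  proof -
    have "g q (X q) (e j q) = g q (Y q) (e j q) + (\<Sum>i\<in>S. (- g q (Y q) (e i q)) * g q (e i q) (e j q))"
      unfolding X_def linear_add[OF metric_linear(2)[OF pts[OF q]]] metric_sum_left[OF pts[OF q]] ..
    also have "(\<Sum>i\<in>S. (- g q (Y q) (e i q)) * g q (e i q) (e j q)) = (\<Sum>i\<in>S. if i = j then - g q (Y q) (e i q) else 0)"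
      using e(2) q j by (intro sum.cong) auto
    finally show ?thesis using insert.hyps(1) j by simp
  qed
  have gk: "g q (?ek q) (e j q) = 0" "g q (e j q) (?ek q) = 0" if q: "q \<in> ?U2" and j: "j \<in> S" for q j
    using orth[OF _ j, of q] q metric_sym[OF pts, of q "e j q" "?ek q"] linear_scale[OF metric_linear(2)[OF pts], of q]
    by auto
  have gkk: "g q (?ek q) (?ek q) = 1" if q: "q \<in> ?U2" for q
  proof -
    have "g q (?ek q) (?ek q) = inverse (sqrt (s q)) * inverse (sqrt (s q)) * s q"
      using q bilinear_lmul[OF metric_bilinear[OF pts]] bilinear_rmul[OF metric_bilinear[OF pts]] by (simp add: s_def)
    also have "inverse (sqrt (s q)) * inverse (sqrt (s q)) = inverse (sqrt (s q) * sqrt (s q))"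
      by (rule inverse_mult_distrib[symmetric])
    also have "\<dots> * s q = 1" using q by simp
    finally show ?thesis .
  qed
  let ?e = "\<lambda>i. if i = k then ?ek else e i"
  have "openin (mtop M) ?U2 \<and> p \<in> ?U2 \<and> (\<forall>i\<in>insert k S. smooth_vector_field M ?U2 (?e i)) \<and>
    (\<forall>q\<in>?U2. \<forall>i\<in>insert k S. \<forall>j\<in>insert k S. g q (?e i q) (?e j q) = (if i = j then 1 else 0))"
  proof (intro conjI ballI)
    show "p \<in> ?U2" using U(2) c(2) metric_pos[OF p v(1)] by (simp add: s_def Xp)
    show "smooth_vector_field M ?U2 (?e i)" if "i \<in> insert k S" for i
      using that ek field_subset[OF e1 U2, of i] by auto
    show "g q (?e i q) (?e j q) = (if i = j then 1 else 0)"
      if "q \<in> ?U2" "i \<in> insert k S" "j \<in> insert k S" for q i j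
    proof (cases "i = k"; cases "j = k")
      assume "i \<noteq> k" "j \<noteq> k"
      then show ?thesis using that e(2)[of q i j] by auto
    qed (use that gk[of q] gkk[of q] in auto)
  qed (rule U2)
  then show ?case by (intro exI)
qed

lemma orthonormal_frame_exists:
  assumes "p \<in> points M"
  shows "\<exists>e U. p \<in> U \<and> orthonormal_frame M g U e"
proof -
  from partial_orthonormal_frame[OF assms, of UNIV] show ?thesis
  proof (elim exE)
    fix U and e :: "'n \<Rightarrow> 'm \<Rightarrow> real ^ 'n"
    assume "openin (mtop M) U \<and> p \<in> U \<and> (\<forall>i\<in>UNIV. smooth_vector_field M U (e i)) \<and>
      (\<forall>q\<in>U. \<forall>i\<in>UNIV. \<forall>j\<in>UNIV. g q (e i q) (e j q) = (if i = j then 1 else 0))"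
    then have "p \<in> U \<and> orthonormal_frame M g U e" unfolding orthonormal_frame_def by simp
    then show ?thesis by (intro exI)
  qed
qed

text \<open>The metric recovers the coefficients of a combination of the \<open>e i\<close>, so the
  combination map is injective; being an endomorphism of \<open>real ^ 'n\<close>, it is
  surjective.\<close>

lemma orthonormal_expand:
  fixes e :: "'n \<Rightarrow> real ^ 'n"
  assumes p: "p \<in> points M" and e: "\<And>i j. g p (e i) (e j) = (if i = j then 1 else 0)"
  shows "v = (\<Sum>i\<in>UNIV. g p v (e i) *\<^sub>R e i)"
proof -
  let ?T = "\<lambda>a :: real ^ 'n. \<Sum>i\<in>UNIV. a $ i *\<^sub>R e i"
  have T: "g p (?T a) (e j) = a $ j" for a j
    by (simp add: metric_sum_left[OF p] e if_distrib cong: if_cong)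
  have lin: "linear ?T"
    by (rule linearI) (auto simp: sum.distrib scaleR_add_left scaleR_sum_right)
  have "inj ?T"
  proof (rule injI)
    fix a b assume "?T a = ?T b"
    then have "a $ j = b $ j" for j using T[of a j] T[of b j] by simp
    then show "a = b" by (simp add: vec_eq_iff)
  qed
  then have "surj ?T" by (intro linear_injective_imp_surjective lin refl)
  from surjD[OF this, of v] obtain a where "v = ?T a" ..
  then show ?thesis using T by simp
qed

definition gram :: "('m, 'n) chart \<Rightarrow> 'm \<Rightarrow> real ^ 'n ^ 'n" where
  "gram c p = (\<chi> i j. g p (chart_vec c (axis i 1) p) (chart_vec c (axis j 1) p))"

definition density :: "('m, 'n) chart \<Rightarrow> 'm \<Rightarrow> real" where
  "density c p = sqrt (det (gram c p))"

text \<open>With \<open>?P\<close> the inner products of coordinate and orthonormal frame vectors,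
  the Gram matrix is \<open>?P\<close> times its transpose. The components \<open>?Q\<close> of the
  orthonormal frame satisfy \<open>?Q ** ?P = mat 1\<close>, so \<open>det ?P\<close> is
  nonzero.\<close>

lemma gram_det_pos:
  assumes c: "c \<in> atlas M" "p \<in> chart_dom c"
  shows "det (gram c p) > 0"
proof -
  have p: "p \<in> points M" by (rule chart_dom_points[OF c])
  obtain e U where "p \<in> U" "orthonormal_frame M g U e"
    using orthonormal_frame_exists[OF p] by blast
  then have e: "g p (e i p) (e j p) = (if i = j then 1 else 0)" for i j
    by (auto simp: orthonormal_frame_def)
  note ex = orthonormal_expand[OF p e]
  let ?E = "\<lambda>k. chart_vec c (axis k 1) p"
  let ?P = "\<chi> k i. g p (?E k) (e i p)" and ?Q = "\<chi> i k. comps c p (e i p) $ k"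
  have "g p (?E k) (?E l) = (\<Sum>i\<in>UNIV. g p (?E k) (e i p) * g p (?E l) (e i p))" for k l
    by (subst ex[of "?E l"]) (simp add: metric_sum_right[OF p] mult.commute)
  then have "gram c p = ?P ** transpose ?P"
    by (simp add: gram_def vec_eq_iff matrix_matrix_mult_def transpose_def)
  then have "det (gram c p) = (det ?P)\<^sup>2"
    by (simp add: det_mul power2_eq_square)
  moreover have "(\<Sum>k\<in>UNIV. comps c p (e i p) $ k * g p (?E k) (e j p)) = g p (e i p) (e j p)" for i j
    by (subst (4) tangent_expand[OF c]) (simp add: metric_sum_left[OF p])
  then have "?Q ** ?P = mat 1"
    by (simp add: vec_eq_iff matrix_matrix_mult_def mat_def e)
  then have "det ?Q * det ?P = 1" by (metis det_mul det_I)
  ultimately show ?thesis by (metis mult_zero_right zero_less_power2 zero_neq_one)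
qed

lemma density_pos: "c \<in> atlas M \<Longrightarrow> p \<in> chart_dom c \<Longrightarrow> density c p > 0"
  using gram_det_pos by (simp add: density_def)

lemma smooth_fun_gram: "c \<in> atlas M \<Longrightarrow> smooth_fun M (chart_dom c) (gram c)"
  by (intro smooth_fun_vec) (simp add: gram_def metric_smooth chart_field)

lemma smooth_fun_density:
  assumes c: "c \<in> atlas M"
  shows "smooth_fun M (chart_dom c) (density c)"
proof -
  have "smooth_fun M (chart_dom c) (\<lambda>p. det (gram c p))"
    using smooth_fun_compose[OF smooth_fun_gram[OF c] smooth_on_det_UNIV] by simp
  then have "smooth_fun M (chart_dom c) (\<lambda>p. sqrt (det (gram c p)))"
    by (rule smooth_fun_compose[OF _ smooth_on_sqrt]) (use gram_det_pos[OF c] in auto)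
  then show ?thesis by (simp add: density_def[abs_def])
qed

text \<open>The Gram matrices are congruent through the Jacobian \<open>?J\<close> of the transition
  map, so their determinants differ by \<open>(det ?J)\<^sup>2\<close>; the square root leaves the
  absolute value that the change of variables formula calls for.\<close>

lemma density_transition:
  assumes a: "a \<in> atlas M" "p \<in> chart_dom a" and b: "b \<in> atlas M" "p \<in> chart_dom b"
  shows "density a p = \<bar>det (matrix (\<lambda>v. chart_deriv a p v (chart_map b)))\<bar> * density b p"
proof -
  have p: "p \<in> points M" by (rule chart_dom_points[OF a])
  let ?J = "matrix (\<lambda>v. chart_deriv a p v (chart_map b))"
  have J: "?J $ l $ i = comps b p (chart_vec a (axis i 1) p) $ l" for l i
    using dir_deriv_chart_vec[OF a diff_at_chart_map[OF b]] by (simp add: matrix_def comps_def)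
  have "g p (chart_vec a (axis i 1) p) (chart_vec a (axis j 1) p) =
    (\<Sum>k\<in>UNIV. (\<Sum>l\<in>UNIV. ?J $ l $ i * gram b p $ l $ k) * ?J $ k $ j)" for i j
    by (subst (1 2) tangent_expand[OF b])
      (simp add: metric_sum_left[OF p] metric_sum_right[OF p] J gram_def sum_distrib_right mult_ac)
  then have "gram a p = transpose ?J ** gram b p ** ?J"
    by (simp add: gram_def[of a] vec_eq_iff matrix_matrix_mult_def transpose_def)
  then have "det (gram a p) = (det ?J)\<^sup>2 * det (gram b p)"
    by (simp add: det_mul power2_eq_square)
  then show ?thesis by (simp add: density_def real_sqrt_mult)
qed

end


section \<open>Connections and divergence\<close>

context smooth_mfd_map
begin

context
  fixes D
  assumes conn: "is_connection M N \<phi> D"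
begin

lemmas connD = conn[unfolded is_connection_def, THEN spec, THEN spec, THEN mp]

lemma conn_linear: "smooth_section M N \<phi> U V \<Longrightarrow> p \<in> U \<Longrightarrow> linear (\<lambda>v. D p v V)"
  by (rule connD[THEN conjunct1, rule_format])

lemma conn_cong:
  "smooth_section M N \<phi> U V \<Longrightarrow> p \<in> U \<Longrightarrow> (\<And>q. q \<in> U \<Longrightarrow> W q = V q) \<Longrightarrow> D p v W = D p v V"
  by (rule connD[THEN conjunct2, THEN conjunct1, rule_format])

lemma conn_add:
  "smooth_section M N \<phi> U V \<Longrightarrow> smooth_section M N \<phi> U W \<Longrightarrow> p \<in> U \<Longrightarrow>
    D p v (\<lambda>q. V q + W q) = D p v V + D p v W"
  by (rule connD[THEN conjunct2, THEN conjunct2, THEN conjunct1, rule_format])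

lemma conn_scaleR:
  "smooth_section M N \<phi> U V \<Longrightarrow> smooth_fun M U F \<Longrightarrow> p \<in> U \<Longrightarrow>
    D p v (\<lambda>q. F q *\<^sub>R V q) = dir_deriv M p v F *\<^sub>R V p + F p *\<^sub>R D p v V"
  by (rule connD[THEN conjunct2, THEN conjunct2, THEN conjunct2, THEN conjunct1, rule_format])

lemma conn_smooth:
  "smooth_section M N \<phi> U V \<Longrightarrow> smooth_vector_field M U X \<Longrightarrow> smooth_section M N \<phi> U (\<lambda>p. D p (X p) V)"
  by (rule connD[THEN conjunct2, THEN conjunct2, THEN conjunct2, THEN conjunct2, rule_format])

lemma conn_zero:
  assumes "openin (mtop M) U" "p \<in> U"
  shows "D p v (\<lambda>q. 0) = 0"
  using conn_add[OF section_zero[OF assms(1)] section_zero[OF assms(1)] assms(2), of v] by simp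

lemma conn_sum:
  assumes U: "openin (mtop M) U" "p \<in> U" and V: "\<And>i. i \<in> I \<Longrightarrow> smooth_section M N \<phi> U (V i)"
  shows "D p v (\<lambda>q. \<Sum>i\<in>I. V i q) = (\<Sum>i\<in>I. D p v (V i))"
  using V
proof (induction I rule: infinite_finite_induct)
  case (insert i I)
  then show ?case
    using conn_add[of U "V i" "\<lambda>q. \<Sum>i\<in>I. V i q" p v] section_sum[OF U(1), of I V] U(2) by simp
qed (simp_all add: conn_zero[OF U])

lemma conn_sum_scaleR:
  assumes U: "openin (mtop M) U" "p \<in> U"
    and F: "\<And>i. i \<in> I \<Longrightarrow> smooth_fun M U (F i)" and V: "\<And>i. i \<in> I \<Longrightarrow> smooth_section M N \<phi> U (V i)"
  shows "D p v (\<lambda>q. \<Sum>i\<in>I. F i q *\<^sub>R V i q) = (\<Sum>i\<in>I. dir_deriv M p v (F i) *\<^sub>R V i p + F i p *\<^sub>R D p v (V i))"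
  using conn_sum[OF U, of I "\<lambda>i q. F i q *\<^sub>R V i q" v] section_scaleR[OF F V] conn_scaleR[OF V F U(2)] by simp

end

end

section \<open>The Levi-Civita connection and the divergence in coordinates\<close>

locale levi_civita_mfd = riemannian M g for M :: "('m, 'n::finite) manifold" and g :: "('m, 'n) metric" +
  fixes D :: "'m \<Rightarrow> real ^ 'n \<Rightarrow> ('m \<Rightarrow> real ^ 'n) \<Rightarrow> real ^ 'n"
  assumes levi_civita: "levi_civita M g D"
begin

lemma connection: "is_connection M M id D"
  using levi_civita by (simp add: levi_civita_def)

lemmas lc_linear = smooth_mfd_map.conn_linear[OF map_id connection]
  and lc_cong = smooth_mfd_map.conn_cong[OF map_id connection]
  and lc_smooth = smooth_mfd_map.conn_smooth[OF map_id connection]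
  and lc_zero = smooth_mfd_map.conn_zero[OF map_id connection]
  and lc_sum = smooth_mfd_map.conn_sum[OF map_id connection]
  and lc_sum_scaleR = smooth_mfd_map.conn_sum_scaleR[OF map_id connection]

lemma lc_metric:
  assumes "smooth_vector_field M U X" "smooth_vector_field M U Y" "p \<in> U"
  shows "dir_deriv M p v (\<lambda>q. g q (X q) (Y q)) = g p (D p v X) (Y p) + g p (X p) (D p v Y)"
  using levi_civita[unfolded levi_civita_def, THEN conjunct2, THEN spec, THEN spec, THEN spec, THEN mp,
      OF conjI[OF assms(1,2)]] assms(3) by blast

lemma lc_torsion:
  fixes f :: "'m \<Rightarrow> real"
  assumes "smooth_vector_field M U X" "smooth_vector_field M U Y" "smooth_fun M U f" "p \<in> U"
  shows "dir_deriv M p (D p (X p) Y - D p (Y p) X) f =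
    dir_deriv M p (X p) (\<lambda>q. dir_deriv M q (Y q) f) - dir_deriv M p (Y p) (\<lambda>q. dir_deriv M q (X q) f)"
  using levi_civita[unfolded levi_civita_def, THEN conjunct2, THEN spec, THEN spec, THEN spec, THEN mp,
      OF conjI[OF assms(1,2)]] assms(3,4) by blast

text \<open>Symmetry of the Christoffel symbols. The torsion identity is tested on the coordinate
  functions: their derivatives along coordinate fields are constant, so the bracket side vanishes,
  and a tangent vector killing all coordinate functions is zero.\<close>

lemma lc_chart_symmetric:
  assumes c: "c \<in> atlas M" "p \<in> chart_dom c"
  shows "D p (chart_vec c u p) (chart_vec c v) = D p (chart_vec c v p) (chart_vec c u)"
proof -
  let ?w = "D p (chart_vec c u p) (chart_vec c v) - D p (chart_vec c v p) (chart_vec c u)"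
  have p: "p \<in> points M" by (rule chart_dom_points[OF c])
  have nth: "dir_deriv M q w (\<lambda>q. chart_map c q $ l) = comps c q w $ l" if "q \<in> chart_dom c" for q w l
    unfolding comps_def
    by (rule dir_deriv_bounded_linear[OF chart_dom_points[OF c(1) that] bounded_linear_vec_nth
          diff_at_chart_map[OF c(1) that]])
  have zero: "dir_deriv M p w (\<lambda>q. dir_deriv M q (chart_vec c z q) (\<lambda>q. chart_map c q $ l)) = 0" for w z l
  proof -
    have "dir_deriv M p w (\<lambda>q. dir_deriv M q (chart_vec c z q) (\<lambda>q. chart_map c q $ l)) = dir_deriv M p w (\<lambda>q. z $ l)"
      by (rule dir_deriv_cong[OF p chart_open[OF c(1)] c(2)]) (simp add: nth comps_chart_vec[OF c(1)])
    then show ?thesis by (simp add: dir_deriv_const[OF p])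
  qed
  have "smooth_fun M (chart_dom c) (\<lambda>q. chart_map c q $ l)" for l
    by (rule smooth_fun_nth[OF smooth_fun_chart[OF c(1)]])
  then have "dir_deriv M p ?w (\<lambda>q. chart_map c q $ l) = 0" for l
    using lc_torsion[OF chart_field[OF c(1)] chart_field[OF c(1)] _ c(2)] by (simp add: zero)
  then have "comps c p ?w = comps c p 0"
    by (simp add: nth[OF c(2)] vec_eq_iff linear_0[OF linear_comps[OF c]])
  from comps_inject[OF c this] show ?thesis by simp
qed

text \<open>The matrix is formed in the coordinates of the arbitrary chart
  \<open>chart_at M p\<close>; as a trace does not depend on the basis, the value may be computed in
  any frame at \<open>p\<close>.\<close>

definition divergence :: "('m \<Rightarrow> real ^ 'n) \<Rightarrow> 'm \<Rightarrow> real" where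
  "divergence Z p = trace (matrix (\<lambda>v. D p v Z))"

lemma divergence_frame:
  fixes e :: "'n \<Rightarrow> real ^ 'n"
  assumes "smooth_vector_field M U Z" "p \<in> U" "\<And>i j. g p (e i) (e j) = (if i = j then 1 else 0)"
  shows "divergence Z p = (\<Sum>i\<in>UNIV. g p (D p (e i) Z) (e i))"
  unfolding divergence_def
  by (rule trace_eq_sum_dual_basis[symmetric])
    (rule lc_linear assms metric_linear(2) orthonormal_expand field_points[OF assms(1,2)])+

lemma divergence_chart:
  assumes "smooth_vector_field M U Z" "p \<in> U" and c: "c \<in> atlas M" "p \<in> chart_dom c"
  shows "divergence Z p = (\<Sum>k\<in>UNIV. comps c p (D p (chart_vec c (axis k 1) p) Z) $ k)"
proof -
  have "linear (\<lambda>v. comps c p v $ k)" for k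
    using linear_compose[OF linear_comps[OF c] bounded_linear.linear[OF bounded_linear_vec_nth]] by (simp add: o_def)
  from trace_eq_sum_dual_basis[OF lc_linear[OF assms(1,2)] this tangent_expand[OF c]]
  show ?thesis by (simp add: divergence_def)
qed

lemma smooth_fun_divergence:
  assumes Z: "smooth_vector_field M U Z"
  shows "smooth_fun M U (divergence Z)"
proof (rule smooth_fun_local[OF field_open[OF Z]])
  fix p assume p: "p \<in> U"
  note c = chart_at[OF field_points[OF Z p]]
  let ?c = "chart_at M p"
  let ?U = "chart_dom ?c \<inter> U"
  have U: "openin (mtop M) ?U" using chart_open[OF c(1)] field_open[OF Z] by (rule openin_Int)
  have Z': "smooth_vector_field M ?U Z" by (rule field_subset[OF Z U]) auto
  have E: "smooth_vector_field M ?U (chart_vec ?c (axis k 1))" for k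
    by (rule field_subset[OF chart_field[OF c(1)] U]) auto
  have "smooth_fun M ?U (\<lambda>q. comps ?c q (D q (chart_vec ?c (axis k 1) q) Z))" for k
    using field_comps[OF lc_smooth[OF Z' E] c(1)] by (simp add: Int_absorb1 Int_left_absorb)
  then have "smooth_fun M ?U (\<lambda>q. \<Sum>k\<in>UNIV. comps ?c q (D q (chart_vec ?c (axis k 1) q) Z) $ k)"
    by (intro smooth_fun_sum smooth_fun_nth U)
  then have "smooth_fun M ?U (divergence Z)"
    by (rule smooth_fun_cong) (auto simp: divergence_chart[OF Z _ c(1)])
  moreover have "p \<in> ?U" using p c by auto
  ultimately show "\<exists>V. p \<in> V \<and> smooth_fun M V (divergence Z)" by (intro exI conjI)
qed

text \<open>Compatibility with the metric gives \<open>transpose ?A ** ?G + ?G ** ?A\<close> as the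
  derivative of the Gram matrix \<open>?G\<close>. Jacobi's formula turns this into
  \<open>2 * trace ?A * det ?G\<close>, and the square root halves the factor.\<close>

lemma dir_deriv_density:
  fixes l :: 'n
  assumes c: "c \<in> atlas M" "p \<in> chart_dom c"
  defines "E \<equiv> \<lambda>k. chart_vec c (axis k 1)"
  shows "dir_deriv M p (E l p) (density c) = density c p * (\<Sum>k\<in>UNIV. comps c p (D p (E l p) (E k)) $ k)"
proof -
  have p: "p \<in> points M" by (rule chart_dom_points[OF c])
  \<comment> \<open>The entries of \<open>?A\<close> are the Christoffel symbols with upper index
    \<open>k\<close> and lower indices \<open>l\<close>, \<open>i\<close>.\<close>
  let ?A = "\<chi> k i. comps c p (D p (E l p) (E i)) $ k" and ?G = "gram c p"
  have ex: "D p (E l p) (E i) = (\<Sum>k\<in>UNIV. ?A $ k $ i *\<^sub>R E k p)" for i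
    using tangent_expand[OF c, of "D p (E l p) (E i)"] by (simp add: E_def)
  have G: "gram c q $ i $ j = g q (E i q) (E j q)" for q i j by (simp add: gram_def E_def)
  have diffG: "diff_at p (gram c)" by (rule smooth_fun_diff_at[OF smooth_fun_gram[OF c(1)] c(2)])
  have "dir_deriv M p (E l p) (gram c) $ i $ j = dir_deriv M p (E l p) (\<lambda>q. gram c q $ i $ j)" for i j
    by (rule dir_deriv_bounded_linear[OF p _ diffG, symmetric])
      (rule bounded_linear_compose[OF bounded_linear_vec_nth bounded_linear_vec_nth])
  also have "dir_deriv M p (E l p) (\<lambda>q. gram c q $ i $ j)
      = g p (D p (E l p) (E i)) (E j p) + g p (E i p) (D p (E l p) (E j))" for i j
    unfolding G E_def by (rule lc_metric[OF chart_field[OF c(1)] chart_field[OF c(1)] c(2)])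
  also have "g p (D p (E l p) (E i)) (E j p) + g p (E i p) (D p (E l p) (E j))
      = (transpose ?A ** ?G + ?G ** ?A) $ i $ j" for i j
    unfolding ex[of i] ex[of j] metric_sum[OF p]
    by (simp add: matrix_matrix_mult_def transpose_def G mult.commute)
  finally have "dir_deriv M p (E l p) (gram c) = transpose ?A ** ?G + ?G ** ?A"
    by (simp add: vec_eq_iff)
  moreover have det: "(det has_derivative frechet_derivative det (at ?G)) (at ?G)"
    by (rule smooth_on_has_derivative[OF smooth_on_det_UNIV]) simp
  ultimately have "dir_deriv M p (E l p) (\<lambda>q. det (gram c q)) = 2 * trace ?A * det ?G"
    using dir_deriv_compose(2)[OF p diffG det, of "E l p"] linear_add[OF has_derivative_linear[OF det]]
    by (simp add: frechet_derivative_det trace_transpose)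
  moreover have "(sqrt has_derivative (*) (inverse (density c p) / 2)) (at (det ?G))"
    using DERIV_real_sqrt[OF gram_det_pos[OF c]]
    by (simp add: has_field_derivative_def density_def)
  then have "dir_deriv M p (E l p) (\<lambda>q. sqrt (det (gram c q)))
      = inverse (density c p) / 2 * dir_deriv M p (E l p) (\<lambda>q. det (gram c q))"
    by (rule dir_deriv_compose(2)[OF p dir_deriv_compose(1)[OF p diffG det]])
  ultimately have "dir_deriv M p (E l p) (density c) = trace ?A * (det ?G * inverse (density c p))"
    by (simp add: density_def[abs_def])
  also have "det ?G = density c p * density c p"
    using gram_det_pos[OF c] by (simp add: density_def)
  also have "density c p * density c p * inverse (density c p) = density c p"
    using density_pos[OF c] by simp
  finally show ?thesis by (simp add: trace_def mult.commute)
qed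

text \<open>Both sides consist of the derivatives of the components of \<open>Z\<close> and a term
  linear in these components. The linear term comes from the derivative of the density on the left
  and from contracted Christoffel symbols on the right; their symmetry identifies the two.\<close>

theorem divergence_density:
  fixes c :: "('m, 'n) chart"
  assumes U: "smooth_vector_field M U Z" "p \<in> U" and c: "c \<in> atlas M" "U \<subseteq> chart_dom c"
  defines "E \<equiv> \<lambda>k. chart_vec c (axis k 1)"
  shows "(\<Sum>k\<in>UNIV. dir_deriv M p (E k p) (\<lambda>q. density c q * comps c q (Z q) $ k)) = density c p * divergence Z p"
proof -
  let ?w = "density c"
  have pc: "p \<in> chart_dom c" using U c by auto
  have p: "p \<in> points M" by (rule chart_dom_points[OF c(1) pc])
  define z where "z k q = comps c q (Z q) $ k" for k q
  have z: "smooth_fun M U (z k)" for k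
    using smooth_fun_nth[OF field_comps[OF U(1) c(1)]] c(2) by (simp add: z_def[abs_def] Int_absorb1)
  have E: "smooth_vector_field M U (E k)" for k
    unfolding E_def by (rule field_subset[OF chart_field[OF c(1)] field_open[OF U(1)] c(2)])
  have w: "diff_at p ?w" by (rule smooth_fun_diff_at[OF smooth_fun_density[OF c(1)] pc])
  have DZ: "D p v Z = (\<Sum>l\<in>UNIV. dir_deriv M p v (z l) *\<^sub>R E l p + z l p *\<^sub>R D p v (E l))" for v
  proof -
    have "Z q = (\<Sum>l\<in>UNIV. z l q *\<^sub>R E l q)" if "q \<in> U" for q
      using tangent_expand[OF c(1), of q "Z q"] that c(2) by (auto simp: z_def E_def)
    then have "D p v Z = D p v (\<lambda>q. \<Sum>l\<in>UNIV. z l q *\<^sub>R E l q)"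
      by (intro lc_cong[OF field_sum[OF field_open[OF U(1)]] U(2)] field_scaleR z E) auto
    also have "\<dots> = (\<Sum>l\<in>UNIV. dir_deriv M p v (z l) *\<^sub>R E l p + z l p *\<^sub>R D p v (E l))"
      by (rule lc_sum_scaleR[OF field_open[OF U(1)] U(2) z E])
    finally show ?thesis .
  qed
  have comps_E: "comps c p (E l p) $ k = (if k = l then 1 else 0)" for k l
    by (simp add: E_def comps_chart_vec[OF c(1) pc] axis_def)
  let ?\<Gamma> = "\<lambda>l k. comps c p (D p (E k p) (E l)) $ k"
  have "comps c p (D p (E k p) Z) $ k = dir_deriv M p (E k p) (z k) + (\<Sum>l\<in>UNIV. z l p * ?\<Gamma> l k)" for k
  proof -
    have "comps c p (D p (E k p) Z) $ k
        = (\<Sum>l\<in>UNIV. dir_deriv M p (E k p) (z l) * comps c p (E l p) $ k + z l p * ?\<Gamma> l k)"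
      unfolding DZ
      by (simp add: linear_sum[OF linear_comps[OF c(1) pc]] linear_add[OF linear_comps[OF c(1) pc]]
          linear_scale[OF linear_comps[OF c(1) pc]])
    then show ?thesis unfolding sum.distrib comps_E by (simp add: if_distrib cong: if_cong)
  qed
  then have "divergence Z p = (\<Sum>k\<in>UNIV. dir_deriv M p (E k p) (z k)) + (\<Sum>k\<in>UNIV. \<Sum>l\<in>UNIV. z l p * ?\<Gamma> l k)"
    using divergence_chart[OF U c(1) pc] by (simp add: E_def sum.distrib)
  also have "(\<Sum>k\<in>UNIV. \<Sum>l\<in>UNIV. z l p * ?\<Gamma> l k) = (\<Sum>l\<in>UNIV. z l p * (\<Sum>k\<in>UNIV. ?\<Gamma> l k))"
    by (subst sum.swap) (simp add: sum_distrib_left)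
  \<comment> \<open>Exchanging the lower indices produces the contraction that occurs in
    \<open>dir_deriv_density\<close>.\<close>
  also have "\<dots> = (\<Sum>l\<in>UNIV. z l p * (\<Sum>k\<in>UNIV. comps c p (D p (E l p) (E k)) $ k))"
    unfolding E_def
    by (intro sum.cong refl arg_cong[of _ _ "(*) _"]) (subst lc_chart_symmetric[OF c(1) pc], rule refl)
  finally have "?w p * divergence Z p
      = (\<Sum>k\<in>UNIV. dir_deriv M p (E k p) ?w * z k p + ?w p * dir_deriv M p (E k p) (z k))"
    using dir_deriv_density[OF c(1) pc]
    by (simp add: E_def sum.distrib distrib_left sum_distrib_left mult_ac)
  also have "\<dots> = (\<Sum>k\<in>UNIV. dir_deriv M p (E k p) (\<lambda>q. ?w q * z k q))"
    by (simp add: dir_deriv_mult[OF p w smooth_fun_diff_at[OF z U(2)]])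
  finally show ?thesis by (simp add: z_def)
qed

end


section \<open>Integration of functions supported in a chart\<close>

context smooth_mfd
begin

text \<open>The compact set lives in the coordinate space, where integration takes place. Vanishing
  is required on \<open>points M\<close> only, as functions are unconstrained elsewhere in the
  type.\<close>

definition chart_supported :: "('m, 'n) chart \<Rightarrow> ('m \<Rightarrow> 'b::zero) \<Rightarrow> bool" where
  "chart_supported c F \<longleftrightarrow> (\<exists>K. compact K \<and> K \<subseteq> chart_map c ` chart_dom c \<and>
    (\<forall>q\<in>points M. \<not> (q \<in> chart_dom c \<and> chart_map c q \<in> K) \<longrightarrow> F q = 0))"

definition chart_ext :: "('m, 'n) chart \<Rightarrow> ('m \<Rightarrow> real) \<Rightarrow> real ^ 'n \<Rightarrow> real" where
  "chart_ext c F x = (if x \<in> chart_map c ` chart_dom c then F (chart_inv c x) else 0)"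

lemma chart_supported_mono:
  "chart_supported c F \<Longrightarrow> (\<And>q. q \<in> points M \<Longrightarrow> F q = 0 \<Longrightarrow> G q = 0) \<Longrightarrow> chart_supported c G"
  unfolding chart_supported_def by meson

lemma chart_supported_outside:
  "chart_supported c F \<Longrightarrow> q \<in> points M \<Longrightarrow> q \<notin> chart_dom c \<Longrightarrow> F q = 0"
  unfolding chart_supported_def by blast

text \<open>For local operators: an operator applied to \<open>F\<close> gives zero on the open set
  \<open>W\<close> where \<open>F\<close> vanishes, and the last conclusion turns this back into a
  support statement.\<close>

lemma chart_supported_complement:
  assumes "c \<in> atlas M" "chart_supported c F"
  obtains W where "openin (mtop M) W" "\<And>q. q \<in> W \<Longrightarrow> F q = 0"
    "\<And>G. (\<And>q. q \<in> W \<Longrightarrow> G q = 0) \<Longrightarrow> chart_supported c (G :: 'm \<Rightarrow> real)"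
proof -
  obtain K where K: "compact K" "K \<subseteq> chart_map c ` chart_dom c"
    "\<And>q. q \<in> points M \<Longrightarrow> \<not> (q \<in> chart_dom c \<and> chart_map c q \<in> K) \<Longrightarrow> F q = 0"
    using assms(2) unfolding chart_supported_def by blast
  let ?W = "points M - {q \<in> chart_dom c. chart_map c q \<in> K}"
  have "openin (mtop M) ?W" by (intro openin_diff openin_topspace chart_compact_closed assms K)
  moreover have "chart_supported c G" if "\<And>q. q \<in> ?W \<Longrightarrow> G q = 0" for G :: "'m \<Rightarrow> real"
    unfolding chart_supported_def using K(1,2) that by (intro exI[of _ K]) auto
  ultimately show ?thesis using that[of ?W] K(3) by auto
qed

lemma chart_ext_chart: "c \<in> atlas M \<Longrightarrow> p \<in> chart_dom c \<Longrightarrow> chart_ext c F (chart_map c p) = F p"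
  by (simp add: chart_ext_def chart_inv_map)

text \<open>The chart image and the complement of the compact set \<open>K\<close> are open and
  cover the space; the extension is smooth on the first and zero on the second.\<close>

lemma chart_ext_smooth:
  assumes c: "c \<in> atlas M" and F: "smooth_fun M (chart_dom c) F" "chart_supported c F"
  obtains K where "smooth_on UNIV (chart_ext c F)" "compact K" "\<And>x. x \<notin> K \<Longrightarrow> chart_ext c F x = 0"
    "K \<subseteq> chart_map c ` chart_dom c"
proof -
  obtain K where K: "compact K" "K \<subseteq> chart_map c ` chart_dom c"
    "\<And>q. q \<in> points M \<Longrightarrow> \<not> (q \<in> chart_dom c \<and> chart_map c q \<in> K) \<Longrightarrow> F q = 0"
    using F(2) unfolding chart_supported_def by blast
  have zero: "chart_ext c F x = 0" if "x \<notin> K" for x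
  proof (cases "x \<in> chart_map c ` chart_dom c")
    case True
    then obtain q where q: "q \<in> chart_dom c" "x = chart_map c q" by auto
    with K(3)[OF chart_dom_points[OF c q(1)]] that show ?thesis by (simp add: chart_ext_chart[OF c])
  qed (simp add: chart_ext_def)
  have "smooth_on (chart_map c ` chart_dom c) (F \<circ> chart_inv c)"
    using smooth_funD[OF F(1) c] by simp
  then have 1: "smooth_on (chart_map c ` chart_dom c) (chart_ext c F)"
    by (rule smooth_on_cong[OF chart_image_open[OF c]]) (simp add: chart_ext_def)
  have "smooth_on (- K) (\<lambda>x :: real ^ 'n. 0 :: real)" by (rule smooth_on_const)
  then have 2: "smooth_on (- K) (chart_ext c F)"
    using compact_imp_closed[OF K(1)] by (elim smooth_on_cong[rotated]) (auto simp: zero)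
  have "smooth_on UNIV (chart_ext c F)"
  proof (rule smooth_on_local)
    fix x
    show "\<exists>U. open U \<and> x \<in> U \<and> smooth_on U (chart_ext c F)"
    proof (cases "x \<in> K")
      case True
      then have "x \<in> chart_map c ` chart_dom c" using K(2) by auto
      with 1 chart_image_open[OF c] show ?thesis by (intro exI conjI)
    next
      case False
      then have "x \<in> - K" "open (- K)" using compact_imp_closed[OF K(1)] by auto
      with 2 show ?thesis by (intro exI conjI)
    qed
  qed
  from that[OF this K(1) zero K(2)] show ?thesis .
qed

end

section \<open>Chart integrals against the Riemannian density\<close>

context riemannian
begin

definition chart_integral :: "('m, 'n) chart \<Rightarrow> ('m \<Rightarrow> real) \<Rightarrow> real" where
  "chart_integral c F = (LINT x|lborel. chart_ext c (\<lambda>p. density c p * F p) x)"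

lemma density_mult:
  assumes c: "c \<in> atlas M" and F: "smooth_fun M (points M) F" "chart_supported c F"
  shows "smooth_fun M (chart_dom c) (\<lambda>p. density c p * F p)" "chart_supported c (\<lambda>p. density c p * F p)"
    "integrable lborel (chart_ext c (\<lambda>p. density c p * F p))"
    "continuous_on UNIV (chart_ext c (\<lambda>p. density c p * F p))"
proof -
  show smooth: "smooth_fun M (chart_dom c) (\<lambda>p. density c p * F p)"
    using openin_subset[OF chart_open[OF c]]
    by (intro smooth_fun_mult smooth_fun_density c smooth_fun_subset[OF F(1)] chart_open)
  show supp: "chart_supported c (\<lambda>p. density c p * F p)"
    by (rule chart_supported_mono[OF F(2)]) simp
  obtain K where K: "smooth_on UNIV (chart_ext c (\<lambda>p. density c p * F p))" "compact K"
    "\<And>x. x \<notin> K \<Longrightarrow> chart_ext c (\<lambda>p. density c p * F p) x = 0" "K \<subseteq> chart_map c ` chart_dom c"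
    by (rule chart_ext_smooth[OF c smooth supp]) (rule that)
  show "continuous_on UNIV (chart_ext c (\<lambda>p. density c p * F p))"
    by (rule smooth_on_continuous[OF K(1)])
  then show "integrable lborel (chart_ext c (\<lambda>p. density c p * F p))"
    by (rule integrable_compact_support[OF _ K(2,3)])
qed

lemma chart_integral_cong:
  assumes "c \<in> atlas M" "\<And>p. p \<in> points M \<Longrightarrow> F p = G p"
  shows "chart_integral c F = chart_integral c G"
proof -
  have "chart_ext c (\<lambda>p. density c p * F p) x = chart_ext c (\<lambda>p. density c p * G p) x" for x
    using assms(2) chart_dom_points[OF assms(1)] by (auto simp: chart_ext_def chart_inv_map[OF assms(1)])
  then show ?thesis by (simp add: chart_integral_def)
qed

lemma chart_integral_sum:
  assumes c: "c \<in> atlas M"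
    and F: "\<And>i. i \<in> I \<Longrightarrow> smooth_fun M (points M) (F i)" "\<And>i. i \<in> I \<Longrightarrow> chart_supported c (F i)"
  shows "chart_integral c (\<lambda>p. \<Sum>i\<in>I. F i p) = (\<Sum>i\<in>I. chart_integral c (F i))"
proof -
  have "chart_ext c (\<lambda>p. density c p * (\<Sum>i\<in>I. F i p)) = (\<lambda>x. \<Sum>i\<in>I. chart_ext c (\<lambda>p. density c p * F i p) x)"
    by (auto simp: chart_ext_def fun_eq_iff sum_distrib_left)
  then show ?thesis
    unfolding chart_integral_def using Bochner_Integration.integral_sum[of I lborel "\<lambda>i. chart_ext c (\<lambda>p. density c p * F i p)"]
      density_mult(3)[OF c F] by simp
qed

lemma chart_integral_nonneg:
  assumes c: "c \<in> atlas M" and "\<And>p. p \<in> points M \<Longrightarrow> F p \<ge> 0"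
  shows "chart_ext c (\<lambda>p. density c p * F p) x \<ge> 0" "chart_integral c F \<ge> 0"
proof -
  show "chart_ext c (\<lambda>p. density c p * F p) x \<ge> 0" for x
    using assms(2) chart_dom_points[OF c] density_pos[OF c]
    by (auto simp: chart_ext_def chart_inv_map[OF c] less_imp_le)
  then show "chart_integral c F \<ge> 0"
    unfolding chart_integral_def by (intro integral_nonneg_AE AE_I2)
qed

lemma chart_integral_eq_0_imp:
  assumes c: "c \<in> atlas M" and F: "smooth_fun M (points M) F" "chart_supported c F"
    and nonneg: "\<And>p. p \<in> points M \<Longrightarrow> F p \<ge> 0" and "chart_integral c F = 0" and p: "p \<in> points M"
  shows "F p = 0"
proof (cases "p \<in> chart_dom c")
  case True
  have "chart_ext c (\<lambda>p. density c p * F p) (chart_map c p) = 0"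
    by (rule integral_nonneg_eq_0_imp_eq_0[OF density_mult(4)[OF c F] chart_integral_nonneg(1)[OF c nonneg]
          density_mult(3)[OF c F]]) (use assms(5) in \<open>simp_all add: chart_integral_def\<close>)
  then show ?thesis using density_pos[OF c True] by (simp add: chart_ext_chart[OF c True])
qed (rule chart_supported_outside[OF F(2) p])

text \<open>The change of variables formula is applied to the transition map on the overlap; its
  Jacobian is absorbed by \<open>density_transition\<close>. Being supported in both charts,
  \<open>F\<close> vanishes on the rest of either chart, so nothing is lost by restricting to the
  overlap.\<close>

lemma chart_integral_independent:
  assumes a: "a \<in> atlas M" and b: "b \<in> atlas M" and F: "smooth_fun M (points M) F"
    and supp: "chart_supported a F" "chart_supported b F"
  shows "chart_integral a F = chart_integral b F"
proof -
  let ?V = "chart_dom a \<inter> chart_dom b"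
  let ?S = "chart_map a ` ?V" and ?T = "chart_map b ` ?V"
  let ?h = "chart_map b \<circ> chart_inv a"
  let ?A = "chart_ext a (\<lambda>p. density a p * F p)" and ?B = "chart_ext b (\<lambda>p. density b p * F p)"
  have inv: "\<And>p. p \<in> chart_dom a \<Longrightarrow> chart_inv a (chart_map a p) = p"
    "\<And>p. p \<in> chart_dom b \<Longrightarrow> chart_inv b (chart_map b p) = p"
    using chart_inv_map a b by auto
  have img: "?h ` ?S = ?T" by (force simp: inv image_iff)
  have S: "open ?S" "open ?T"
    using chart_image_Int_open[OF a chart_open[OF b]] chart_image_Int_open[OF b chart_open[OF a]]
    by (simp_all add: Int_commute)
  let ?h' = "\<lambda>x. frechet_derivative ?h (at x)"
  have B: "indicator (?h ` ?S) y * ?B y = ?B y" for y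
  proof (cases "y \<in> chart_map b ` chart_dom b")
    case True
    then obtain q where q: "q \<in> chart_dom b" "y = chart_map b q" by auto
    have "F q = 0" if "q \<notin> chart_dom a"
      by (rule chart_supported_outside[OF supp(1) chart_dom_points[OF b q(1)] that])
    then show ?thesis unfolding img using q by (auto simp: chart_ext_chart[OF b] indicator_def)
  qed (simp add: chart_ext_def)
  have A: "indicator ?S x * (\<bar>det (matrix (?h' x))\<bar> * ?B (?h x)) = ?A x" for x
  proof (cases "x \<in> ?S")
    case True
    then obtain q where q: "q \<in> chart_dom a" "q \<in> chart_dom b" "x = chart_map a q" by auto
    have "density a q = \<bar>det (matrix (?h' x))\<bar> * density b q"
      using density_transition[OF a q(1) b q(2)] by (simp add: chart_deriv_def q(3))
    moreover have "?h x = chart_map b q" using q inv by simp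
    ultimately show ?thesis
      using True q(1,2) by (simp add: chart_ext_chart[OF b] chart_ext_chart[OF a] q(3))
  next
    case False
    have "?A x = 0"
    proof (cases "x \<in> chart_map a ` chart_dom a")
      case True
      then obtain q where q: "q \<in> chart_dom a" "x = chart_map a q" by auto
      then have "q \<notin> chart_dom b" using False by auto
      with chart_supported_outside[OF supp(2) chart_dom_points[OF a q(1)]] q show ?thesis
        by (simp add: chart_ext_chart[OF a])
    qed (simp add: chart_ext_def)
    then show ?thesis using False by simp
  qed
  have "(LINT y|lborel. indicator (?h ` ?S) y * ?B y)
      = (LINT x|lborel. indicator ?S x * (\<bar>det (matrix (?h' x))\<bar> * ?B (?h x)))"
  proof (rule lborel_change_of_variables)
    show "open ?S" "open (?h ` ?S)" unfolding img using S by auto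
    show "inj_on ?h ?S"
      using chart_inj[OF b] by (auto simp: inj_on_def inv)
    show "(?h has_derivative ?h' x) (at x)" if "x \<in> ?S" for x
      using smooth_on_has_derivative[OF _ that] smooth_transition[OF a b] by (simp add: smooth_transition_def)
    show "integrable lborel (\<lambda>y. indicator (?h ` ?S) y * ?B y)"
      unfolding B by (rule density_mult(3)[OF b F supp(2)])
    show "(\<lambda>x. indicator ?S x * (\<bar>det (matrix (?h' x))\<bar> * ?B (?h x))) \<in> borel_measurable borel"
      unfolding A using borel_measurable_integrable[OF density_mult(3)[OF a F supp(1)]] by simp
  qed
  then show ?thesis unfolding A B chart_integral_def by simp
qed

end

section \<open>The divergence theorem by a partition of unity\<close>

context levi_civita_mfd
begin

text \<open>A connection is local, so on an open set where \<open>Z\<close> vanishes its covariant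
  derivative is that of the zero field.\<close>

lemma chart_supported_divergence:
  assumes c: "c \<in> atlas M" and Z: "smooth_vector_field M (points M) Z" "chart_supported c Z"
  shows "chart_supported c (divergence Z)"
proof -
  obtain W where W: "openin (mtop M) W" "\<And>q. q \<in> W \<Longrightarrow> Z q = 0"
    "\<And>G. (\<And>q. q \<in> W \<Longrightarrow> G q = 0) \<Longrightarrow> chart_supported c (G :: 'm \<Rightarrow> real)"
    by (rule chart_supported_complement[OF c Z(2)]) blast
  have "divergence Z q = 0" if q: "q \<in> W" for q
  proof -
    have "D q v Z = 0" for v
      using lc_cong[OF field_zero[OF W(1)] q, of Z v] lc_zero[OF W(1) q] W(2) by simp
    then show ?thesis by (simp add: divergence_def trace_def matrix_def)
  qed
  then show ?thesis by (rule W(3))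
qed

lemma chart_integral_divergence:
  assumes c: "c \<in> atlas M" and Z: "smooth_vector_field M (points M) Z" "chart_supported c Z"
  shows "chart_integral c (divergence Z) = 0"
proof -
  let ?E = "\<lambda>k. chart_vec c (axis k 1)"
  \<comment> \<open>Off the chart \<open>comps c q\<close> is meaningless; the default 0 ensures
    that \<open>z k\<close> vanishes wherever \<open>Z\<close> does, which gives it support in the
    chart.\<close>
  define z where "z k q = (if q \<in> chart_dom c then density c q * comps c q (Z q) $ k else 0)" for k q
  have Zc: "smooth_vector_field M (chart_dom c) Z"
    using openin_subset[OF chart_open[OF c]] by (intro field_subset[OF Z(1)] chart_open c)
  have z: "smooth_fun M (chart_dom c) (z k)" for k
  proof (rule smooth_fun_cong)
    show "smooth_fun M (chart_dom c) (\<lambda>q. density c q * comps c q (Z q) $ k)"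
      using field_comps[OF Zc c] by (intro smooth_fun_mult smooth_fun_nth smooth_fun_density c) simp
  qed (simp add: z_def)
  have supp: "chart_supported c (z k)" for k
    by (rule chart_supported_mono[OF Z(2)]) (simp add: z_def linear_0[OF linear_comps[OF c]])
  have der: "chart_ext c (\<lambda>p. density c p * divergence Z p) x
      = (\<Sum>k\<in>UNIV. frechet_derivative (chart_ext c (z k)) (at x) (axis k 1))" for x
  proof (cases "x \<in> chart_map c ` chart_dom c")
    case True
    then obtain p where p: "p \<in> chart_dom c" "x = chart_map c p" by auto
    have "frechet_derivative (chart_ext c (z k)) (at x) = frechet_derivative (z k \<circ> chart_inv c) (at x)" for k
      by (rule frechet_derivative_cong_open[OF chart_image_open[OF c] True]) (simp add: chart_ext_def)
    then have "(\<Sum>k\<in>UNIV. frechet_derivative (chart_ext c (z k)) (at x) (axis k 1))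
        = (\<Sum>k\<in>UNIV. dir_deriv M p (?E k p) (z k))"
      using dir_deriv_chart_vec[OF c p(1) smooth_fun_diff_at[OF z p(1)]] by (simp add: chart_deriv_def p(2))
    also have "\<dots> = (\<Sum>k\<in>UNIV. dir_deriv M p (?E k p) (\<lambda>q. density c q * comps c q (Z q) $ k))"
      by (intro sum.cong refl dir_deriv_cong[OF chart_dom_points[OF c p(1)] chart_open[OF c] p(1)]) (simp add: z_def)
    also have "\<dots> = density c p * divergence Z p"
      by (rule divergence_density[OF Zc p(1) c subset_refl])
    finally show ?thesis by (simp add: p(2) chart_ext_chart[OF c p(1)])
  next
    case False
    \<comment> \<open>A point outside the chart image lies in the open complement of
      \<open>K\<close>, so the extension vanishes near it, even if it is a boundary point of the
      image.\<close>
    have "frechet_derivative (chart_ext c (z k)) (at x) (axis k 1) = 0" for k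
    proof -
      obtain K where K: "smooth_on UNIV (chart_ext c (z k))" "compact K"
        "\<And>x. x \<notin> K \<Longrightarrow> chart_ext c (z k) x = 0" "K \<subseteq> chart_map c ` chart_dom c"
        by (rule chart_ext_smooth[OF c z[of k] supp[of k]]) (rule that)
      then have "x \<in> - K" "open (- K)" using False compact_imp_closed[OF K(2)] by auto
      then have "frechet_derivative (chart_ext c (z k)) (at x) = frechet_derivative (\<lambda>x. 0) (at x)"
        by (intro frechet_derivative_cong_open) (auto simp: K(3))
      then show ?thesis by simp
    qed
    then show ?thesis using False by (simp add: chart_ext_def)
  qed
  have "integrable lborel (\<lambda>x. frechet_derivative (chart_ext c (z k)) (at x) (axis k 1)) \<and>
    (LINT x|lborel. frechet_derivative (chart_ext c (z k)) (at x) (axis k 1)) = 0" for k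
  proof -
    obtain K where K: "smooth_on UNIV (chart_ext c (z k))" "compact K"
      "\<And>x. x \<notin> K \<Longrightarrow> chart_ext c (z k) x = 0" "K \<subseteq> chart_map c ` chart_dom c"
      by (rule chart_ext_smooth[OF c z[of k] supp[of k]]) (rule that)
    from integral_directional_derivative_eq_0[OF K(1-3)] show ?thesis by simp
  qed
  then show ?thesis
    unfolding chart_integral_def der by simp
qed

theorem nonneg_divergence_eq_0:
  assumes "compact_space (mtop M)" and Z: "smooth_vector_field M (points M) Z"
    and nonneg: "\<And>p. p \<in> points M \<Longrightarrow> divergence Z p \<ge> 0" and p: "p \<in> points M"
  shows "divergence Z p = 0"
proof -
  have "\<exists>\<beta> :: 'm \<Rightarrow> real. smooth_fun M (points M) \<beta> \<and> (\<forall>q. \<beta> q \<ge> 0) \<and> \<beta> a > 0 \<and> chart_supported (chart_at M a) \<beta>"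
    if a: "a \<in> points M" for a
  proof -
    obtain \<beta> :: "'m \<Rightarrow> real" and K where \<beta>: "smooth_fun M (points M) \<beta>" "\<And>q. \<beta> q \<ge> 0" "\<beta> a > 0"
      "compact K" "K \<subseteq> chart_map (chart_at M a) ` chart_dom (chart_at M a)"
      "\<And>q. \<not> (q \<in> chart_dom (chart_at M a) \<and> chart_map (chart_at M a) q \<in> K) \<Longrightarrow> \<beta> q = 0"
      by (rule smooth_bump[OF chart_at[OF a]]) (rule that)
    then have "chart_supported (chart_at M a) \<beta>" unfolding chart_supported_def by blast
    with \<beta>(1-3) show ?thesis by blast
  qed
  then obtain \<beta> where \<beta>: "\<And>a. a \<in> points M \<Longrightarrow> smooth_fun M (points M) (\<beta> a)"
    "\<And>a q. a \<in> points M \<Longrightarrow> \<beta> a q \<ge> 0" "\<And>a. a \<in> points M \<Longrightarrow> \<beta> a a > (0 :: real)"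
    "\<And>a. a \<in> points M \<Longrightarrow> chart_supported (chart_at M a) (\<beta> a)"
    by metis
  \<comment> \<open>The positivity sets of the bumps cover \<open>M\<close>. Finitely many suffice
    by compactness, which makes their sum \<open>s\<close> positive and allows
    normalisation.\<close>
  let ?O = "\<lambda>a. {q \<in> points M. \<beta> a q \<in> {0<..}}"
  have "\<exists>P\<subseteq>points M. finite P \<and> points M \<subseteq> (\<Union>a\<in>P. ?O a)"
  proof -
    have "openin (mtop M) (?O a)" if "a \<in> points M" for a
      by (rule smooth_fun_vimage_open[OF \<beta>(1)[OF that]]) simp
    moreover have "points M \<subseteq> \<Union> (?O ` points M)" using \<beta>(3) by auto
    ultimately obtain \<F> where "finite \<F>" "\<F> \<subseteq> ?O ` points M" "points M \<subseteq> \<Union> \<F>"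
      using assms(1) unfolding compact_space_alt by (metis (no_types, lifting) imageE)
    then show ?thesis by (metis (no_types, lifting) finite_subset_image)
  qed
  then obtain P where P: "P \<subseteq> points M" "finite P" and cover: "points M \<subseteq> (\<Union>a\<in>P. ?O a)" by blast
  have c: "chart_at M a \<in> atlas M" if "a \<in> P" for a using chart_at(1) P(1) that by blast
  define s where "s q = (\<Sum>a\<in>P. \<beta> a q)" for q
  have s_pos: "s q > 0" if q: "q \<in> points M" for q
  proof -
    obtain a where "a \<in> P" "\<beta> a q > 0" using cover q by auto
    then show ?thesis unfolding s_def using P \<beta>(2) by (intro sum_pos2[of _ a]) auto
  qed
  have s: "smooth_fun M (points M) s"
    unfolding s_def[abs_def] using P \<beta>(1) by (intro smooth_fun_sum openin_topspace) auto
  define \<rho> where "\<rho> a q = inverse (s q) * \<beta> a q" for a q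
  have inv_s: "smooth_fun M (points M) (\<lambda>q. inverse (s q))"
    by (rule smooth_fun_compose[OF s smooth_on_inverse]) (use s_pos in auto)
  have \<rho>: "smooth_fun M (points M) (\<rho> a)" "chart_supported (chart_at M a) (\<rho> a)" if "a \<in> P" for a
    unfolding \<rho>_def[abs_def] using that P
    by (auto intro!: smooth_fun_mult inv_s \<beta>(1) chart_supported_mono[OF \<beta>(4)])
  have \<rho>_nonneg: "\<rho> a q \<ge> 0" if "a \<in> P" "q \<in> points M" for a q
    unfolding \<rho>_def using that P \<beta>(2) s_pos by (auto intro!: mult_nonneg_nonneg simp: less_imp_le)
  have \<rho>_sum: "(\<Sum>a\<in>P. \<rho> a q) = 1" if "q \<in> points M" for q
    unfolding \<rho>_def sum_distrib_left[symmetric] using s_pos[OF that] by (simp add: s_def)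
  have \<rho>Z: "smooth_vector_field M (points M) (\<lambda>q. \<rho> a q *\<^sub>R Z q)"
    "chart_supported (chart_at M a) (\<lambda>q. \<rho> a q *\<^sub>R Z q)" if "a \<in> P" for a
    using \<rho>[OF that] by (auto intro: field_scaleR Z chart_supported_mono)
  \<comment> \<open>Each divergence is kept whole: the gradient of \<open>\<rho> a\<close> is never
    isolated, only the sum over \<open>a\<close> is evaluated.\<close>
  let ?F = "\<lambda>a. divergence (\<lambda>q. \<rho> a q *\<^sub>R Z q)"
  have F: "smooth_fun M (points M) (?F a)" "chart_supported (chart_at M a) (?F a)"
    "chart_integral (chart_at M a) (?F a) = 0" if "a \<in> P" for a
    using smooth_fun_divergence chart_supported_divergence chart_integral_divergence \<rho>Z[OF that] c[OF that] by auto
  have F_sum: "(\<Sum>a\<in>P. ?F a q) = divergence Z q" if q: "q \<in> points M" for q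
  proof -
    have "D q v Z = (\<Sum>a\<in>P. D q v (\<lambda>q. \<rho> a q *\<^sub>R Z q))" for v
    proof -
      have "D q v Z = D q v (\<lambda>q. \<Sum>a\<in>P. \<rho> a q *\<^sub>R Z q)"
        by (rule lc_cong[OF field_sum[OF openin_topspace \<rho>Z(1)] q])
          (simp_all add: scaleR_sum_left[symmetric] \<rho>_sum)
      also have "\<dots> = (\<Sum>a\<in>P. D q v (\<lambda>q. \<rho> a q *\<^sub>R Z q))"
        by (rule lc_sum[OF openin_topspace q \<rho>Z(1)])
      finally show ?thesis .
    qed
    then show ?thesis
      by (simp add: divergence_def trace_def matrix_def) (rule sum.swap)
  qed
  \<comment> \<open>One factor confines the product to chart \<open>b\<close>, the other to chart
    \<open>a\<close>; both supports are required for changing the chart of integration.\<close>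
  have \<rho>F: "smooth_fun M (points M) (\<lambda>q. \<rho> b q * ?F a q)" "chart_supported (chart_at M a) (\<lambda>q. \<rho> b q * ?F a q)"
    "chart_supported (chart_at M b) (\<lambda>q. \<rho> b q * ?F a q)" if "a \<in> P" "b \<in> P" for a b
    using F[OF that(1)] \<rho>[OF that(2)] by (auto intro: smooth_fun_mult chart_supported_mono)
  let ?G = "\<lambda>b q. \<rho> b q * divergence Z q"
  have G: "smooth_fun M (points M) (?G b)" "chart_supported (chart_at M b) (?G b)"
    "\<And>q. q \<in> points M \<Longrightarrow> ?G b q \<ge> 0" if "b \<in> P" for b
    using \<rho>[OF that] \<rho>_nonneg[OF that] nonneg
    by (auto intro: smooth_fun_mult smooth_fun_divergence Z chart_supported_mono)
  have "(\<Sum>b\<in>P. chart_integral (chart_at M b) (?G b)) = (\<Sum>b\<in>P. \<Sum>a\<in>P. chart_integral (chart_at M b) (\<lambda>q. \<rho> b q * ?F a q))"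
  proof (rule sum.cong[OF refl])
    fix b assume b: "b \<in> P"
    have "chart_integral (chart_at M b) (?G b) = chart_integral (chart_at M b) (\<lambda>q. \<Sum>a\<in>P. \<rho> b q * ?F a q)"
      by (rule chart_integral_cong[OF c[OF b]]) (simp add: sum_distrib_left[symmetric] F_sum)
    also have "\<dots> = (\<Sum>a\<in>P. chart_integral (chart_at M b) (\<lambda>q. \<rho> b q * ?F a q))"
      by (rule chart_integral_sum[OF c[OF b] \<rho>F(1,3)[OF _ b]])
    finally show "chart_integral (chart_at M b) (?G b) = (\<Sum>a\<in>P. chart_integral (chart_at M b) (\<lambda>q. \<rho> b q * ?F a q))" .
  qed
  also have "\<dots> = (\<Sum>a\<in>P. \<Sum>b\<in>P. chart_integral (chart_at M b) (\<lambda>q. \<rho> b q * ?F a q))"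
    by (rule sum.swap)
  also have "\<dots> = (\<Sum>a\<in>P. \<Sum>b\<in>P. chart_integral (chart_at M a) (\<lambda>q. \<rho> b q * ?F a q))"
    by (intro sum.cong refl chart_integral_independent c \<rho>F)
  also have "\<dots> = (\<Sum>a\<in>P. chart_integral (chart_at M a) (?F a))"
  proof (rule sum.cong[OF refl])
    fix a assume a: "a \<in> P"
    have "chart_integral (chart_at M a) (?F a) = chart_integral (chart_at M a) (\<lambda>q. \<Sum>b\<in>P. \<rho> b q * ?F a q)"
      by (rule chart_integral_cong[OF c[OF a]]) (simp add: sum_distrib_right[symmetric] \<rho>_sum)
    also have "\<dots> = (\<Sum>b\<in>P. chart_integral (chart_at M a) (\<lambda>q. \<rho> b q * ?F a q))"
      by (rule chart_integral_sum[OF c[OF a] \<rho>F(1,2)[OF a]])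
    finally show "(\<Sum>b\<in>P. chart_integral (chart_at M a) (\<lambda>q. \<rho> b q * ?F a q)) = chart_integral (chart_at M a) (?F a)" ..
  qed
  also have "\<dots> = 0" using F(3) by simp
  finally have "chart_integral (chart_at M b) (?G b) = 0" if "b \<in> P" for b
    using that sum_nonneg_eq_0_iff[OF P(2), of "\<lambda>b. chart_integral (chart_at M b) (?G b)"]
      chart_integral_nonneg(2)[OF c G(3)] by simp
  \<comment> \<open>A nonnegative continuous integrand with vanishing integral is zero, and the
    density is positive.\<close>
  then have "?G b p = 0" if "b \<in> P" for b
    using chart_integral_eq_0_imp[OF c[OF that] G[OF that] _ p] that by blast
  then have "(\<Sum>b\<in>P. \<rho> b p * divergence Z p) = 0" by (intro sum.neutral ballI)
  then show ?thesis by (simp add: sum_distrib_right[symmetric] \<rho>_sum[OF p])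
qed

end


section \<open>Harmonic maps\<close>

context smooth_mfd_map
begin

text \<open>The coordinate expression of \<open>\<phi>\<close> has zero derivative, so
  \<open>\<phi>\<close> is constant near every point. Its level sets are then open and closed, and
  connectedness of \<open>M\<close> finishes.\<close>

lemma constant_if_differential_eq_0:
  assumes zero: "\<And>p v. p \<in> points M \<Longrightarrow> differential M N \<phi> p v = 0"
  shows "\<exists>q\<in>points N. \<forall>p\<in>points M. \<phi> p = q"
proof -
  have local: "\<exists>V. openin (mtop M) V \<and> p \<in> V \<and> (\<forall>q\<in>V. \<phi> q = \<phi> p)" if p: "p \<in> points M" for p
  proof -
    note c = M.chart_at[OF p] and d = N.chart_at[OF map_points[OF p]]
    let ?c = "chart_at M p" and ?d = "chart_at N (\<phi> p)"
    let ?U = "{q \<in> points M. \<phi> q \<in> chart_dom ?d}"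
    let ?G = "(\<lambda>q. chart_map ?d (\<phi> q)) \<circ> chart_inv ?c"
    have U: "openin (mtop M) ?U" by (rule vimage_open[OF N.chart_open[OF d(1)]])
    \<comment> \<open>A coordinate ball is convex, as the zero-derivative argument requires; it is
      kept small enough for \<phi> to stay in one chart of \<open>N\<close>.\<close>
    obtain r where r: "r > 0" "ball (chart_map ?c p) r \<subseteq> chart_map ?c ` (chart_dom ?c \<inter> ?U)"
      using M.chart_image_Int_open[OF c(1) U] c d p open_contains_ball by (metis (no_types, lifting) IntI imageI mem_Collect_eq)
    have der: "(?G has_derivative (\<lambda>v. 0)) (at x within ball (chart_map ?c p) r)"
      if x: "x \<in> ball (chart_map ?c p) r" for x
    proof -
      obtain q where q: "q \<in> chart_dom ?c" "q \<in> ?U" "x = chart_map ?c q" using r x by auto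
      then have qM: "q \<in> points M" by simp
      have diff: "M.diff_at q (\<lambda>q. chart_map ?d (\<phi> q))"
        by (rule M.smooth_fun_diff_at[OF smooth_fun_chart_map[OF d(1)] q(2)])
      have "M.chart_deriv ?c q v (\<lambda>q. chart_map ?d (\<phi> q)) = 0" for v
      proof -
        have "M.chart_deriv ?c q v (\<lambda>q. chart_map ?d (\<phi> q))
            = N.comps ?d (\<phi> q) (differential M N \<phi> q (M.chart_vec ?c v q))"
          using M.dir_deriv_chart_vec[OF c(1) q(1) diff] comps_differential[OF qM d(1)] q(2) by simp
        also have "\<dots> = 0" using zero[OF qM] linear_0[OF N.linear_comps[OF d(1)]] q(2) by simp
        finally show ?thesis .
      qed
      with M.diff_at_has_derivative[OF c(1) q(1) diff] show ?thesis
        by (simp add: q(3) has_derivative_at_withinI)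
    qed
    let ?V = "{q \<in> chart_dom ?c. chart_map ?c q \<in> ball (chart_map ?c p) r}"
    have "\<phi> q = \<phi> p" if q: "q \<in> ?V" for q
    proof -
      have "?G (chart_map ?c q) = ?G (chart_map ?c p)"
        by (rule has_derivative_zero_unique[OF convex_ball der]) (use q r(1) in auto)
      then have eq: "chart_map ?d (\<phi> q) = chart_map ?d (\<phi> p)"
        using q c by (simp add: M.chart_inv_map[OF c(1)])
      obtain q' where "q' \<in> chart_dom ?c" "q' \<in> ?U" "chart_map ?c q = chart_map ?c q'" using r q by auto
      then have "\<phi> q \<in> chart_dom ?d" using q M.chart_inj[OF c(1)] by (auto dest: inj_onD)
      with eq d(2) N.chart_inj[OF d(1)] show ?thesis by (auto dest: inj_onD)
    qed
    moreover have "openin (mtop M) ?V" by (rule M.chart_vimage_open[OF c(1) open_ball])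
    moreover have "p \<in> ?V" using c r(1) by simp
    ultimately show ?thesis by (intro exI conjI ballI)
  qed
  have "points M \<noteq> {}" and conn: "connected_space (mtop M)"
    using M.smooth_manifold unfolding smooth_manifold_def by blast+
  then obtain p where p: "p \<in> points M" by blast
  \<comment> \<open>Stated for arbitrary \<open>P\<close>, so that it serves the level set and its
    complement alike.\<close>
  have opn: "openin (mtop M) {q \<in> points M. P (\<phi> q)}" for P
  proof (subst openin_subopen, safe)
    fix q assume "q \<in> points M" "P (\<phi> q)"
    then obtain V where V: "openin (mtop M) V" "q \<in> V" "\<forall>q'\<in>V. \<phi> q' = \<phi> q" using local by blast
    then have "V \<subseteq> {q \<in> points M. P (\<phi> q)}" using openin_subset \<open>P (\<phi> q)\<close> by fastforce
    with V show "\<exists>T. openin (mtop M) T \<and> q \<in> T \<and> T \<subseteq> {q \<in> points M. P (\<phi> q)}" by blast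
  qed
  let ?T = "{q \<in> points M. \<phi> q = \<phi> p}"
  have "points M - ?T = {q \<in> points M. \<phi> q \<noteq> \<phi> p}" by auto
  then have "closedin (mtop M) ?T" using opn[of "\<lambda>y. y \<noteq> \<phi> p"] by (simp add: closedin_def)
  then have "?T = points M"
    using opn[of "\<lambda>y. y = \<phi> p"] conn p unfolding connected_space_clopen_in by blast
  then show ?thesis using map_points[OF p] by blast
qed

end

text \<open>Conformality is assumed for global fields. The vector \<open>u\<close> extends to one up
  to a positive factor \<open>a\<close>; taking \<open>X = Y\<close> merges the two covariant terms,
  and \<open>a\<close> cancels quadratically.\<close>

lemma (in levi_civita_mfd) conformal_field_pointwise:
  assumes "conformal_field M g D \<xi> f" and p: "p \<in> points M"
  shows "g p (D p u \<xi>) u = f p * g p u u"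
proof -
  obtain X a where X: "smooth_vector_field M (points M) X" "X p = a *\<^sub>R u" "a > (0 :: real)"
    by (rule global_field[OF p]) (rule that)
  have \<xi>: "smooth_vector_field M (points M) \<xi>"
    using assms(1) by (simp add: conformal_field_def)
  have "2 * g p (D p (X p) \<xi>) (X p) = 2 * f p * g p (X p) (X p)"
    using assms(1)[unfolded conformal_field_def, THEN conjunct2, THEN conjunct2, THEN spec[of _ X], THEN spec[of _ X]]
      X(1) p by auto
  then have "a * (a * g p (D p u \<xi>) u) = a * (a * (f p * g p u u))"
    by (simp add: X(2) linear_scale[OF lc_linear[OF \<xi> p]] bilinear_lmul[OF metric_bilinear[OF p]]
        bilinear_rmul[OF metric_bilinear[OF p]] mult_ac)
  then show ?thesis using X(3) by simp
qed

section \<open>The pull-back connection and the divergence of the dual field\<close>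

locale pullback_setup = M: levi_civita_mfd M g DM + N: levi_civita_mfd N h DN + smooth_mfd_map M N \<phi>
  for M :: "('m, 'n::finite) manifold" and g DM
    and N :: "('q, 'k::finite) manifold" and h DN and \<phi> +
  fixes D\<phi> :: "'m \<Rightarrow> real ^ 'n \<Rightarrow> ('m \<Rightarrow> real ^ 'k) \<Rightarrow> real ^ 'k"
  assumes pullback: "pullback_connection M N \<phi> DN D\<phi>"
begin

lemma pullback_is_connection: "is_connection M N \<phi> D\<phi>"
  using pullback by (simp add: pullback_connection_def)

lemma pullback_field:
  assumes "smooth_vector_field N W Y" "p \<in> points M" "\<phi> p \<in> W"
  shows "D\<phi> p v (\<lambda>q. Y (\<phi> q)) = DN (\<phi> p) (differential M N \<phi> p v) Y"
  using pullback[unfolded pullback_connection_def, THEN conjunct2, rule_format, OF assms] by (simp add: o_def)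

text \<open>Compatibility of the pull-back connection with \<open>h\<close>, for one pulled-back
  argument. The connection is prescribed on pulled-back fields only, so \<open>V\<close> is expanded
  in the pulled-back coordinate frame; the Leibniz rule and compatibility on \<open>N\<close> then
  give the formula.\<close>

lemma pullback_metric:
  assumes Y: "smooth_vector_field N (points N) Y" and V: "smooth_section M N \<phi> U V"
  shows "smooth_fun M U (\<lambda>q. h (\<phi> q) (Y (\<phi> q)) (V q))" (is ?A)
    and "p \<in> U \<Longrightarrow> dir_deriv M p v (\<lambda>q. h (\<phi> q) (Y (\<phi> q)) (V q))
      = h (\<phi> p) (DN (\<phi> p) (differential M N \<phi> p v) Y) (V p) + h (\<phi> p) (Y (\<phi> p)) (D\<phi> p v V)"
proof -
  have *: "(\<exists>U'. p \<in> U' \<and> smooth_fun M U' (\<lambda>q. h (\<phi> q) (Y (\<phi> q)) (V q))) \<and>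
    (\<forall>v. dir_deriv M p v (\<lambda>q. h (\<phi> q) (Y (\<phi> q)) (V q))
      = h (\<phi> p) (DN (\<phi> p) (differential M N \<phi> p v) Y) (V p) + h (\<phi> p) (Y (\<phi> p)) (D\<phi> p v V))"
    if p: "p \<in> U" for p
  proof -
    have pM: "p \<in> points M" by (rule section_points[OF V p])
    have pN: "\<phi> p \<in> points N" by (rule map_points[OF pM])
    note d = N.chart_at[OF pN]
    let ?d = "chart_at N (\<phi> p)"
    let ?U = "{q \<in> U. \<phi> q \<in> chart_dom ?d}"
    have U: "openin (mtop M) ?U" by (rule vimage_Int_open[OF section_open[OF V] N.chart_open[OF d(1)]])
    have pU: "p \<in> ?U" using p d by simp
    have V': "smooth_section M N \<phi> ?U V" by (rule section_subset[OF V U]) auto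
    \<comment> \<open>Along \<open>\<phi>\<close>, the section is
      \<open>V = \<Sum>j. F j *\<^sub>R E j\<close>, and \<open>H j\<close> is the inner product of
      \<open>Y\<close> with \<open>E j\<close>, a function on \<open>N\<close>.\<close>
    define E where "E j = N.chart_vec ?d (axis j 1)" for j
    define F where "F j q = N.comps ?d (\<phi> q) (V q) $ j" for j q
    define H where "H j y = h y (Y y) (E j y)" for j y
    have F: "smooth_fun M ?U (F j)" for j
      unfolding F_def[abs_def] by (rule section_expand(1)[OF V' d(1)]) simp
    have VE: "V q = (\<Sum>j\<in>UNIV. F j q *\<^sub>R E j (\<phi> q))" if "q \<in> ?U" for q
      unfolding F_def E_def by (rule section_expand(2)[OF V' d(1) _ that]) simp
    have E: "smooth_vector_field N (chart_dom ?d) (E j)" for j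
      unfolding E_def by (rule N.chart_field[OF d(1)])
    have Y': "smooth_vector_field N (chart_dom ?d) Y"
      using openin_subset[OF N.chart_open[OF d(1)]] by (intro N.field_subset[OF Y] N.chart_open d)
    have H: "smooth_fun N (chart_dom ?d) (H j)" for j
      unfolding H_def[abs_def] by (rule N.metric_smooth[OF Y' E])
    have sub: "?U \<subseteq> {p \<in> points M. \<phi> p \<in> chart_dom ?d}" using section_points[OF V] by auto
    have H\<phi>: "smooth_fun M ?U (\<lambda>q. H j (\<phi> q))" for j
      by (rule M.smooth_fun_subset[OF smooth_fun_pullback[OF H] U sub])
    have E\<phi>: "smooth_section M N \<phi> ?U (\<lambda>q. E j (\<phi> q))" for j
      by (rule section_subset[OF section_pullback[OF E] U sub])
    have hV: "h (\<phi> q) (Y (\<phi> q)) (V q) = (\<Sum>j\<in>UNIV. F j q * H j (\<phi> q))" if "q \<in> ?U" for q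
      using N.metric_sum_right[OF map_points, of q] section_points[OF V] that by (simp add: VE[OF that] H_def)
    have FH: "smooth_fun M ?U (\<lambda>q. F j q * H j (\<phi> q))" for j
      by (rule M.smooth_fun_mult[OF F H\<phi>])
    have "smooth_fun M ?U (\<lambda>q. \<Sum>j\<in>UNIV. F j q * H j (\<phi> q))"
      by (rule M.smooth_fun_sum[OF U FH])
    then have "smooth_fun M ?U (\<lambda>q. h (\<phi> q) (Y (\<phi> q)) (V q))"
      by (rule M.smooth_fun_cong) (rule hV[symmetric])
    moreover have "dir_deriv M p v (\<lambda>q. h (\<phi> q) (Y (\<phi> q)) (V q))
      = h (\<phi> p) (DN (\<phi> p) (differential M N \<phi> p v) Y) (V p) + h (\<phi> p) (Y (\<phi> p)) (D\<phi> p v V)" for v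
    proof -
      let ?w = "differential M N \<phi> p v"
      have "dir_deriv M p v (\<lambda>q. h (\<phi> q) (Y (\<phi> q)) (V q)) = dir_deriv M p v (\<lambda>q. \<Sum>j\<in>UNIV. F j q * H j (\<phi> q))"
        by (rule M.dir_deriv_cong[OF pM U pU]) (rule hV)
      also have "\<dots> = (\<Sum>j\<in>UNIV. dir_deriv M p v (F j) * H j (\<phi> p) + F j p * dir_deriv M p v (\<lambda>q. H j (\<phi> q)))"
        by (simp add: M.dir_deriv_sum[OF pM M.smooth_fun_diff_at[OF FH pU]]
            M.dir_deriv_mult[OF pM M.smooth_fun_diff_at[OF F pU] M.smooth_fun_diff_at[OF H\<phi> pU]])
      also have "\<dots> = (\<Sum>j\<in>UNIV. dir_deriv M p v (F j) * h (\<phi> p) (Y (\<phi> p)) (E j (\<phi> p))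
          + F j p * (h (\<phi> p) (DN (\<phi> p) ?w Y) (E j (\<phi> p)) + h (\<phi> p) (Y (\<phi> p)) (DN (\<phi> p) ?w (E j))))"
      proof (intro sum.cong refl arg_cong2[of _ _ _ _ "(+)"] arg_cong2[of _ _ _ _ "(*)"])
        fix j
        have "dir_deriv M p v (\<lambda>q. H j (\<phi> q)) = dir_deriv N (\<phi> p) ?w (H j)"
          by (rule dir_deriv_pullback[OF pM N.smooth_fun_diff_at[OF H d(2)]])
        then show "dir_deriv M p v (\<lambda>q. H j (\<phi> q))
            = h (\<phi> p) (DN (\<phi> p) ?w Y) (E j (\<phi> p)) + h (\<phi> p) (Y (\<phi> p)) (DN (\<phi> p) ?w (E j))"
          unfolding H_def[abs_def] using N.lc_metric[OF Y' E d(2)] by simp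
      qed (simp add: H_def)
      also have "\<dots> = h (\<phi> p) (DN (\<phi> p) ?w Y) (\<Sum>j\<in>UNIV. F j p *\<^sub>R E j (\<phi> p))
          + h (\<phi> p) (Y (\<phi> p)) (\<Sum>j\<in>UNIV. dir_deriv M p v (F j) *\<^sub>R E j (\<phi> p) + F j p *\<^sub>R DN (\<phi> p) ?w (E j))"
        by (simp add: sum.distrib linear_add[OF N.metric_linear(1)[OF pN]] N.metric_sum_right[OF pN] distrib_left)
      also have "(\<Sum>j\<in>UNIV. dir_deriv M p v (F j) *\<^sub>R E j (\<phi> p) + F j p *\<^sub>R DN (\<phi> p) ?w (E j)) = D\<phi> p v V"
      proof -
        have "D\<phi> p v V = D\<phi> p v (\<lambda>q. \<Sum>j\<in>UNIV. F j q *\<^sub>R E j (\<phi> q))"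
          by (rule conn_cong[OF pullback_is_connection section_sum[OF U section_scaleR[OF F E\<phi>]] pU]) (rule VE)
        also have "\<dots> = (\<Sum>j\<in>UNIV. dir_deriv M p v (F j) *\<^sub>R E j (\<phi> p) + F j p *\<^sub>R D\<phi> p v (\<lambda>q. E j (\<phi> q)))"
          by (rule conn_sum_scaleR[OF pullback_is_connection U pU F E\<phi>])
        finally show ?thesis by (simp add: pullback_field[OF E pM d(2)])
      qed
      finally show ?thesis by (simp add: VE[OF pU])
    qed
    ultimately show ?thesis using pU by (intro conjI allI exI[of _ ?U])
  qed
  show ?A by (rule M.smooth_fun_local[OF section_open[OF V]]) (rule *[THEN conjunct1])
  show "dir_deriv M p v (\<lambda>q. h (\<phi> q) (Y (\<phi> q)) (V q))
      = h (\<phi> p) (DN (\<phi> p) (differential M N \<phi> p v) Y) (V p) + h (\<phi> p) (Y (\<phi> p)) (D\<phi> p v V)" if "p \<in> U"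
    by (rule *[OF that, THEN conjunct2, THEN spec])
qed

text \<open>In a local orthonormal frame the dual vector has the coefficients
  \<open>?\<omega> p (e i p)\<close>, which are smooth. By nondegeneracy it is unique, so a
  pointwise choice of \<open>Z\<close> agrees with each of these local formulas and is
  smooth.\<close>

lemma dual_field_exists:
  assumes \<xi>: "smooth_vector_field N (points N) \<xi>"
  obtains Z where "smooth_vector_field M (points M) Z"
    "\<And>p v. p \<in> points M \<Longrightarrow> g p (Z p) v = h (\<phi> p) (\<xi> (\<phi> p)) (differential M N \<phi> p v)"
proof -
  let ?\<omega> = "\<lambda>p v. h (\<phi> p) (\<xi> (\<phi> p)) (differential M N \<phi> p v)"
  have dual: "g p (\<Sum>i\<in>UNIV. ?\<omega> p (e i p) *\<^sub>R e i p) v = ?\<omega> p v"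
    if U: "orthonormal_frame M g U e" "p \<in> U" for U e p v
  proof -
    have p: "p \<in> points M" using U M.field_points unfolding orthonormal_frame_def by blast
    have e: "g p (e i p) (e j p) = (if i = j then 1 else 0)" for i j
      using U by (simp add: orthonormal_frame_def)
    have lin: "linear (?\<omega> p)"
      using linear_compose[OF linear_differential[OF p] N.metric_linear(1)[OF map_points[OF p]]] by (simp add: o_def)
    have "?\<omega> p v = ?\<omega> p (\<Sum>i\<in>UNIV. g p v (e i p) *\<^sub>R e i p)"
      by (rule arg_cong[OF M.orthonormal_expand[OF p e]])
    also have "\<dots> = (\<Sum>i\<in>UNIV. g p v (e i p) * ?\<omega> p (e i p))"
      by (simp add: linear_sum[OF lin] linear_scale[OF lin])
    also have "\<dots> = g p (\<Sum>i\<in>UNIV. ?\<omega> p (e i p) *\<^sub>R e i p) v"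
      by (simp add: M.metric_sum_left[OF p] M.metric_sym[OF p, of v] mult.commute)
    finally show ?thesis ..
  qed
  have "\<exists>z. \<forall>v. g p z v = ?\<omega> p v" if p: "p \<in> points M" for p
  proof -
    obtain U e where "p \<in> U" "orthonormal_frame M g U e" using M.orthonormal_frame_exists[OF p] by blast
    then show ?thesis using dual by blast
  qed
  then obtain Z where Z: "\<And>p v. p \<in> points M \<Longrightarrow> g p (Z p) v = ?\<omega> p v" by metis
  have "smooth_vector_field M (points M) Z"
  proof (rule M.field_local[OF openin_topspace])
    fix p assume "p \<in> points M"
    then obtain U e where pU: "p \<in> U" and frame: "orthonormal_frame M g U e"
      using M.orthonormal_frame_exists by blast
    then have e: "smooth_vector_field M U (e i)" for i by (simp add: orthonormal_frame_def)
    have "smooth_vector_field M U (\<lambda>q. \<Sum>i\<in>UNIV. ?\<omega> q (e i q) *\<^sub>R e i q)"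
      by (intro M.field_sum[OF M.field_open[OF e]] M.field_scaleR pullback_metric(1)[OF \<xi>] section_differential e)
    then have "smooth_vector_field M U Z"
    proof (rule M.field_cong)
      fix q assume q: "q \<in> U"
      have qM: "q \<in> points M" by (rule M.field_points[OF e q])
      show "(\<Sum>i\<in>UNIV. ?\<omega> q (e i q) *\<^sub>R e i q) = Z q"
        by (rule M.metric_eqI[OF qM]) (simp only: dual[OF frame q] Z[OF qM])
    qed
    with pU show "\<exists>W. p \<in> W \<and> smooth_vector_field M W Z" by (intro exI conjI)
  qed
  from that[OF this Z] show ?thesis .
qed

theorem harmonic_map_constant:
  assumes compact: "compact_space (mtop M)"
    and conformal: "conformal_field N h DN \<xi> f" and f: "\<And>q. q \<in> points N \<Longrightarrow> f q > 0"
    and harmonic: "harmonic_map M g N \<phi> DM D\<phi>"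
  shows "\<exists>q\<in>points N. \<forall>p\<in>points M. \<phi> p = q"
proof (rule constant_if_differential_eq_0)
  have \<xi>: "smooth_vector_field N (points N) \<xi>"
    using conformal by (simp add: conformal_field_def)
  obtain Z where Z: "smooth_vector_field M (points M) Z"
    "\<And>p v. p \<in> points M \<Longrightarrow> g p (Z p) v = h (\<phi> p) (\<xi> (\<phi> p)) (differential M N \<phi> p v)"
    by (rule dual_field_exists[OF \<xi>]) (rule that)
  have div: "\<exists>e :: 'n \<Rightarrow> real ^ 'n. (\<forall>i j. g p (e i) (e j) = (if i = j then 1 else 0)) \<and>
      M.divergence Z p = (\<Sum>i\<in>UNIV. f (\<phi> p) * h (\<phi> p) (differential M N \<phi> p (e i)) (differential M N \<phi> p (e i)))"
    if p: "p \<in> points M" for p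
  proof -
    have pN: "\<phi> p \<in> points N" by (rule map_points[OF p])
    \<comment> \<open>This must be the very frame selected in \<open>tension_field\<close>, so that
      harmonicity applies to it directly; for the divergence any orthonormal frame serves.\<close>
    define e where "e = (SOME e. \<exists>U. p \<in> U \<and> orthonormal_frame M g U e)"
    have "\<exists>U. p \<in> U \<and> orthonormal_frame M g U e"
      unfolding e_def by (rule someI_ex[OF M.orthonormal_frame_exists[OF p]])
    then obtain U where U: "p \<in> U" "orthonormal_frame M g U e" by blast
    then have e: "smooth_vector_field M U (e i)" and on: "g p (e i p) (e j p) = (if i = j then 1 else 0)" for i j
      by (auto simp: orthonormal_frame_def)
    have UM: "U \<subseteq> points M" using openin_subset[OF M.field_open[OF e]] .
    have ZU: "smooth_vector_field M U Z" by (rule M.field_subset[OF Z(1) M.field_open[OF e] UM])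
    let ?d = "differential M N \<phi>" and ?\<xi> = "\<xi> (\<phi> p)"
    let ?S = "\<lambda>i. D\<phi> p (e i p) (\<lambda>q. ?d q (e i q)) - ?d p (DM p (e i p) (e i))"
    have "(\<Sum>i\<in>UNIV. ?S i) = 0"
      using harmonic p by (simp add: harmonic_map_def tension_field_def Let_def e_def)
    then have tension: "(\<Sum>i\<in>UNIV. h (\<phi> p) ?\<xi> (?S i)) = 0"
      using linear_sum[OF N.metric_linear(1)[OF pN], of ?\<xi> ?S UNIV] linear_0[OF N.metric_linear(1)[OF pN]] by simp
    have "g p (DM p (e i p) Z) (e i p) = f (\<phi> p) * h (\<phi> p) (?d p (e i p)) (?d p (e i p)) + h (\<phi> p) ?\<xi> (?S i)" for i
    proof -
      \<comment> \<open>The function \<open>g Z (e i) = h \<xi> (d\<phi> (e i))\<close> is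
        differentiated once as an inner product on \<open>M\<close> and once along \<phi>; the term
        with \<open>DM p (e i p) (e i)\<close> moves across to complete the tension summand.\<close>
      have "g p (DM p (e i p) Z) (e i p) + h (\<phi> p) ?\<xi> (?d p (DM p (e i p) (e i)))
          = dir_deriv M p (e i p) (\<lambda>q. g q (Z q) (e i q))"
        using M.lc_metric[OF ZU e U(1)] Z(2)[OF p] by simp
      also have "\<dots> = dir_deriv M p (e i p) (\<lambda>q. h (\<phi> q) (\<xi> (\<phi> q)) (?d q (e i q)))"
        by (rule M.dir_deriv_cong[OF p M.field_open[OF e] U(1)]) (use Z(2) UM in auto)
      also have "\<dots> = h (\<phi> p) (DN (\<phi> p) (?d p (e i p)) \<xi>) (?d p (e i p))
          + h (\<phi> p) ?\<xi> (D\<phi> p (e i p) (\<lambda>q. ?d q (e i q)))"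
        by (rule pullback_metric(2)[OF \<xi> section_differential[OF e] U(1)])
      finally show ?thesis
        using N.conformal_field_pointwise[OF conformal pN] linear_diff[OF N.metric_linear(1)[OF pN]] by simp
    qed
    then have "M.divergence Z p = (\<Sum>i\<in>UNIV. f (\<phi> p) * h (\<phi> p) (?d p (e i p)) (?d p (e i p)))"
      using M.divergence_frame[OF ZU U(1) on] tension by (simp add: sum.distrib)
    with on show ?thesis by (intro exI[of _ "\<lambda>i. e i p"]) simp
  qed
  have h_nonneg: "f (\<phi> p) * h (\<phi> p) u u \<ge> 0" and h_zero: "f (\<phi> p) * h (\<phi> p) u u = 0 \<Longrightarrow> u = 0"
    if "p \<in> points M" for p u
    using f[OF map_points[OF that]] N.metric_pos[OF map_points[OF that], of u]
      bilinear_lzero[OF N.metric_bilinear[OF map_points[OF that]], of u]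
    by (cases "u = 0"; simp add: less_imp_le)+
  have nonneg: "M.divergence Z p \<ge> 0" if p: "p \<in> points M" for p
    using div[OF p] by (elim exE conjE) (simp only:, intro sum_nonneg h_nonneg p)
  fix p v assume p: "p \<in> points M"
  obtain e :: "'n \<Rightarrow> real ^ 'n" where e: "\<And>i j. g p (e i) (e j) = (if i = j then 1 else 0)"
    and eq: "M.divergence Z p = (\<Sum>i\<in>UNIV. f (\<phi> p) * h (\<phi> p) (differential M N \<phi> p (e i)) (differential M N \<phi> p (e i)))"
    using div[OF p] by blast
  have "(\<Sum>i\<in>UNIV. f (\<phi> p) * h (\<phi> p) (differential M N \<phi> p (e i)) (differential M N \<phi> p (e i))) = 0"
    using M.nonneg_divergence_eq_0[OF compact Z(1) nonneg p] eq by simp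
  then have "\<forall>i\<in>UNIV. f (\<phi> p) * h (\<phi> p) (differential M N \<phi> p (e i)) (differential M N \<phi> p (e i)) = 0"
    by (subst (asm) sum_nonneg_eq_0_iff[OF finite h_nonneg[OF p]])
  \<comment> \<open>Strict positivity of \<open>f\<close> is decisive here: it forces each frame
    vector to have an image of length zero.\<close>
  then have zero: "differential M N \<phi> p (e i) = 0" for i
    by (intro h_zero[OF p]) (rule bspec[OF _ UNIV_I])
  have "differential M N \<phi> p v = differential M N \<phi> p (\<Sum>i\<in>UNIV. g p v (e i) *\<^sub>R e i)"
    by (rule arg_cong[OF M.orthonormal_expand[OF p e]])
  then show "differential M N \<phi> p v = 0"
    by (simp add: linear_sum[OF linear_differential[OF p]] linear_scale[OF linear_differential[OF p]] zero)
qed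

end

theorem proposition1:
  fixes M :: "('m, 'n::finite) manifold" and N :: "('q, 'k::finite) manifold"
    and g :: "('m, 'n) metric" and h :: "('q, 'k) metric"
    and \<xi> :: "'q \<Rightarrow> real ^ 'k" and f :: "'q \<Rightarrow> real" and \<phi> :: "'m \<Rightarrow> 'q"
  assumes "riemannian_manifold M g" and "compact_space (mtop M)" and "orientable M"
    and "riemannian_manifold N h"
    and "levi_civita M g DM" and "levi_civita N h DN"
    and "conformal_field N h DN \<xi> f" and "\<forall>q\<in>points N. f q > 0"
    and "pullback_connection M N \<phi> DN D\<phi>"
    and "harmonic_map M g N \<phi> DM D\<phi>"
  shows "\<exists>q\<in>points N. \<forall>p\<in>points M. \<phi> p = q"
proof -
  \<comment> \<open>Smoothness of \<open>\<phi>\<close>, required by the locale, is contained in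
    \<open>harmonic_map\<close>.\<close>
  interpret pullback_setup M g DM N h DN \<phi> D\<phi>
    using assms by unfold_locales (auto simp: riemannian_manifold_def harmonic_map_def)
  show ?thesis
    by (rule harmonic_map_constant[OF assms(2,7)]) (use assms(8,10) in auto)
qed

end
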